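(* Let $\rho:X\to Y$ be the blowdown map, constructed in the context, between positively omnioriented $4$-dimensional primitive quasitoric orbifolds $\mathbf{X}$ and $\mathbf{Y}$. Then $\rho$ is pseudo-holomorphic with respect to the almost complex structures $J_1$ on $\mathbf{X}$ and $J_2$ on $\mathbf{Y}$ described in the context.
   Context: **Quasitoric orbifolds.** Let $N=\mathbb{Z}^2$, $T_N=(N\otimes\mathbb{R})/N$, with standard angular coordinates $q_1,q_2$. Let $P\subset\mathbb{R}^2$ be a $2$-dimensional convex polytope. A characteristic function $\Lambda$ assigns to each edge $E_i$ a vector $\lambda_i=\Lambda(E_i)\in N$ such that $\lambda_i,\lambda_j$ are linearly independent whenever $E_i,E_j$ meet at a vertex. All $\lambda_i$ are assumed primitive (the orbifold is then called primitive). For a face $F$ let $N(F)$ be the submodule of $N$ generated by the $\lambda_i$ with $F\subset E_i$, let $T_{N(F)}=(N(F)\otimes\mathbb{R})/N(F)$, and let $T(N(F))$ be its image in $T_N$. For $p\in P$ let $F(p)$ be the face whose relative interior contains $p$. Put $X=P\times T_N/\sim$, where $(p,t)\sim(q,s)$ iff $p=q$ and $s^{-1}t\in T(N(F(p)))$. $T_N$ acts through the second factor; $\pi:X\to P$ is the orbit map (the same letter is used for $Y\to\widehat P$ below). **Orbifold structure.** For a vertex $v$ let $U_v$ be the complement in $P$ of all edges not containing $v$, and $X_v=\pi^{-1}(U_v)$. Put $\widetilde X_v=U_v\times T_{N(v)}/\sim_v$, where $(p,t)\sim_v(q,s)$ iff $p=q$ and $s^{-1}t\in T_{N(F(p))}\subset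 T_{N(v)}$. The finite group $G_v=N/N(v)=\ker(T_{N(v)}\to T_N)$ acts on $\widetilde X_v$, and $T_{N(v)}\to T_N$ induces $\xi_v:\widetilde X_v\to X_v\cong\widetilde X_v/G_v$. Let the edges at $v$ be $E_i,E_j$ in clockwise order (the clockwise angle from $E_i$ to $E_j$ is less than $180^\circ$); let $p_1(v),p_2(v)$ be affine functions vanishing on $E_i,E_j$ respectively and positive on the interior of $P$, and $q_1(v),q_2(v)$ the angular coordinates with respect to the basis $\lambda_i,\lambda_j$. The functions $z_a(v)=\sqrt{p_a(v)}\,e^{2\pi\sqrt{-1}q_a(v)}$, $a=1,2$, identify $\widetilde X_v$ with an open subset of $\mathbb{C}^2$ and define its smooth structure. The charts $(\widetilde X_v,G_v,\xi_v)$ define the orbifold $\mathbf{X}$ with model $(P,\Lambda)$. $X_{reg}$ is the set of points with trivial local group. **Omniorientation.** $\mathbf{X}$ is oriented via the standard orientations of $P$ and $T_N$; an omniorientation is then a choice of sign of each characteristic vector. It is positive if at every vertex the matrix of the two adjacent characteristic vectors, in clockwise order of the adjacent edges, has positive determinant. **Torus invariance.** A metric or almost complex structure on $\mathbf{X}$ is torus invariant if it is $T_{N(v)}$-invariant in some neighborhood of each vertex $v$ and $T_N$-invariant on $X_{reg}$. **Blowdown.** Let $E_2$ be an edge of $P$ with neighboring edges $E_1,E_3$, with $\det[\lambda_1,\lambda_2]=1$ and $0<\det[\lambda_2,\lambda_3]\le\det[\lambda_1,\lambda_3]$. Put $k=\det[\lambda_2,\lambda_3]$, $m=\det[\lambda_1,\lambda_3]$.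 Let $v_1=E_1\cap E_2$, $v_2=E_2\cap E_3$. Delete $E_2$ and extend $E_1,E_3$ till they meet at a new vertex $w$ (first replacing $P$ by a diffeomorphic polytope with the same characteristic vectors if necessary; this does not change $\mathbf{X}$ up to equivariant diffeomorphism); this gives a polytope $\widehat P$ with inherited characteristic function $\widehat\Lambda$, and $\mathbf{Y}$ is the quasitoric orbifold with model $(\widehat P,\widehat\Lambda)$. By a change of basis of $N$ assume $\lambda_1=(1,0)$, $\lambda_2=(0,1)$, $\lambda_3=(-k,m)$. Choose coordinates $(p_1,p_2)$ on $\mathbb{R}^2$ so that $E_1$ is on $p_1=0$, $E_3$ is on $p_2=0$, and $E_2$ is on $\widehat p:=p_2+sp_1-t=0$ with constants $s,t>0$, where $p_1,p_2,\widehat p>0$ in the interior of $P$. Choose small numbers $0<\epsilon_1<\epsilon_2<1$ and a non-decreasing function $\delta:[0,\infty)\to\mathbb{R}$, smooth away from $0$, with $\delta(x)=x^{1/m}$ for $x<\epsilon_1$ and $\delta(x)=1$ for $x>\epsilon_2$. Let $f:P\to\widehat P$, $f(p_1,p_2)=(r_1,r_2)=(\delta(\widehat p)^kp_1,\delta(\widehat p)p_2)$. The blowdown $\rho:X\to Y$ is $\rho(p_1,p_2,q_1,q_2)=(f(p_1,p_2),q_1,q_2)$. It contracts $\pi^{-1}(E_2)$ to $w$ and is a diffeomorphism of orbifolds from $\mathbf X\setminus\pi^{-1}(E_2)$ onto $\mathbf Y\setminus\{w\}$. **Coordinates.** With $r_1,r_2$ the coordinates $p_1,p_2$ on $\widehat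 P$, the chart coordinates are $z_1(v_1)=\sqrt{p_1}e^{2\pi\sqrt{-1}q_1}$, $z_2(v_1)=\sqrt{\widehat p}\,e^{2\pi\sqrt{-1}q_2}$; $z_1(v_2)=\sqrt{\widehat p}\,e^{2\pi\sqrt{-1}(mq_1+kq_2)/k}$, $z_2(v_2)=\sqrt{p_2}\,e^{-2\pi\sqrt{-1}q_1/k}$; $z_1(w)=\sqrt{r_1}\,e^{2\pi\sqrt{-1}(mq_1+kq_2)/m}$, $z_2(w)=\sqrt{r_2}\,e^{2\pi\sqrt{-1}q_2/m}$. Set $$z_1'(v_1)=z_1(v_1)\sqrt{p_2^{-k}},\quad z_2'(v_1)=z_2(v_1)\sqrt{\delta(\widehat p)^mp_2^m/\widehat p},$$ $$z_1'(v_2)=z_1(v_2)\sqrt{\delta(\widehat p)^mp_1^{m/k}/\widehat p},\quad z_2'(v_2)=z_2(v_2)\sqrt{p_1^{-1/k}}.$$ **The almost complex structures.** For a small tubular neighborhood $U$ of $E_2$ in $P$, $J_1$ is a torus invariant almost complex structure on $\mathbf{X}$ (orthogonal with respect to a torus invariant metric) which on $\pi^{-1}(U)$ is the complex structure for which $z_1'(v_j),z_2'(v_j)$ are holomorphic coordinates on $\pi^{-1}(U)\cap X_{v_j}$, $j=1,2$ (these agree on the overlap). $J_2$ is the torus invariant almost complex structure on $\mathbf{Y}$ which on $\pi^{-1}(f(U))$ is the complex structure with holomorphic coordinates $z_1(w),z_2(w)$, and on $\mathbf Y\setminus\{w\}$ equals $d\rho\circ J_1\circ d\rho^{-1}$ (the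 two agree on the overlap). **Pseudo-holomorphic maps.** A continuous function $g:X\to\mathbb{C}$ on an orbifold is smooth if $g\circ\xi$ is smooth for every orbifold chart $(\widetilde U,G,\xi)$. On an almost complex orbifold $(\mathbf X,J)$ a smooth function $g$ is $J$-holomorphic if the differential $d(g\circ\xi)$ commutes with $J$ (i.e. is complex linear) for every chart; $\Omega^0_{J,X}$ denotes the sheaf (on $X$) of $J$-holomorphic functions. A continuous map $\rho:X\to Y$ between almost complex orbifolds $(\mathbf X,J_1)$, $(\mathbf Y,J_2)$ is pseudo-holomorphic if $g\circ\rho\in\Omega^0_{J_1,X}(\rho^{-1}(V))$ for every open $V\subset Y$ and every $g\in\Omega^0_{J_2,Y}(V)$. *)

theory Defs
  imports "HOL-Analysis.Analysis"
begin

section \<open>Smooth maps between Euclidean spaces\<close>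

primrec C_k_on :: "nat \<Rightarrow> 'a::euclidean_space set \<Rightarrow> ('a \<Rightarrow> 'b::real_normed_vector) \<Rightarrow> bool" where
  "C_k_on 0 S f \<longleftrightarrow> continuous_on S f"
| "C_k_on (Suc n) S f \<longleftrightarrow> (\<forall>x\<in>S. f differentiable (at x)) \<and>
     (\<forall>h. C_k_on n S (\<lambda>x. frechet_derivative f (at x) h))"

text \<open>Derivatives are taken at points of the ambient space, so this is meant for open \<open>S\<close>.\<close>

definition smooth_on :: "'a::euclidean_space set \<Rightarrow> ('a \<Rightarrow> 'b::real_normed_vector) \<Rightarrow> bool" where
  "smooth_on S f \<longleftrightarrow> (\<forall>n. C_k_on n S f)"

abbreviation differential :: "('a::real_normed_vector \<Rightarrow> 'b::real_normed_vector) \<Rightarrow> 'a \<Rightarrow> 'a \<Rightarrow> 'b" where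
  "differential f z \<equiv> frechet_derivative f (at z)"


section \<open>Models of quasitoric orbifolds\<close>

type_synonym plane = "real \<times> real"
type_synonym lattice = "int \<times> int"
type_synonym C2 = "complex \<times> complex"

definition det2 :: "'a::comm_ring \<times> 'a \<Rightarrow> 'a \<times> 'a \<Rightarrow> 'a" where
  "det2 x y = fst x * snd y - snd x * fst y"

definition lat :: "lattice \<Rightarrow> plane" where
  "lat n = (of_int (fst n), of_int (snd n))"

text \<open>A model \<open>(P, \<Lambda>)\<close> comes with one affine function per edge, vanishing on the edge and positive on
  the interior of \<open>P\<close>. At a vertex \<open>v\<close> the functions \<open>p\<^sub>1(v), p\<^sub>2(v)\<close> are those of the two
  edges at \<open>v\<close>; a different choice rescales the chart coordinates by positive constants.
  Edges are subsets of the plane; only the values at edges of \<open>P\<close> matter.\<close>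

record model =
  Poly :: "plane set"
  Char :: "plane set \<Rightarrow> lattice"
  EdgeFun :: "plane set \<Rightarrow> plane \<Rightarrow> real"

definition vertices :: "plane set \<Rightarrow> plane set" where
  "vertices P = {v. v extreme_point_of P}"

definition primitive_model :: "model \<Rightarrow> bool" where
  "primitive_model M \<longleftrightarrow>
     polytope (Poly M) \<and> aff_dim (Poly M) = 2 \<and>
     (\<forall>E E'. E edge_of Poly M \<and> E' edge_of Poly M \<and> E \<noteq> E' \<and> (\<exists>v\<in>vertices (Poly M). v \<in> E \<inter> E')
        \<longrightarrow> det2 (Char M E) (Char M E') \<noteq> 0) \<and>
     (\<forall>E. E edge_of Poly M \<longrightarrow> gcd (fst (Char M E)) (snd (Char M E)) = 1) \<and>
     (\<forall>E. E edge_of Poly M \<longrightarrow>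
        (\<exists>a b. \<forall>x. EdgeFun M E x = a \<bullet> x + b) \<and>
        (\<forall>x\<in>E. EdgeFun M E x = 0) \<and>
        (\<forall>x\<in>interior (Poly M). EdgeFun M E x > 0))"

text \<open>The edges \<open>E, E'\<close> at \<open>v\<close> are in clockwise order: turning clockwise from \<open>E\<close> to \<open>E'\<close>
  takes an angle less than 180 degrees.\<close>

definition clockwise_at :: "plane set \<Rightarrow> plane \<Rightarrow> plane set \<Rightarrow> plane set \<Rightarrow> bool" where
  "clockwise_at P v E E' \<longleftrightarrow> E edge_of P \<and> E' edge_of P \<and> v \<in> E \<and> v \<in> E' \<and>
     (\<forall>x\<in>E - {v}. \<forall>y\<in>E' - {v}. det2 (x - v) (y - v) < 0)"

definition edge1 :: "plane set \<Rightarrow> plane \<Rightarrow> plane set" where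
  "edge1 P v = (THE E. \<exists>E'. clockwise_at P v E E')"

definition edge2 :: "plane set \<Rightarrow> plane \<Rightarrow> plane set" where
  "edge2 P v = (THE E'. \<exists>E. clockwise_at P v E E')"

definition positively_omnioriented :: "model \<Rightarrow> bool" where
  "positively_omnioriented M \<longleftrightarrow> (\<forall>v\<in>vertices (Poly M).
     det2 (Char M (edge1 (Poly M) v)) (Char M (edge2 (Poly M) v)) > 0)"

definition face_at :: "plane set \<Rightarrow> plane \<Rightarrow> plane set" where
  "face_at P p = (THE F. F face_of P \<and> p \<in> rel_interior F)"

definition N_face :: "model \<Rightarrow> plane set \<Rightarrow> lattice set" where
  "N_face M F = {(\<Sum>E | E edge_of Poly M \<and> F \<subseteq> E. (c E * fst (Char M E), c E * snd (Char M E))) | c.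
     True}"


section \<open>The orbifold\<close>

text \<open>The torus \<open>T\<^sub>L = (L \<otimes> \<real>)/L\<close>, for \<open>L = N\<close> or \<open>L = N(v)\<close>, is represented by lifts to
  \<open>L \<otimes> \<real> = \<real>\<^sup>2\<close>: the relation below on \<open>D \<times> \<real>\<^sup>2\<close> is the pullback of
  the relation \<open>p = q\<close> and \<open>s\<^sup>-\<^sup>1t \<in> T(N(F(p)))\<close> on \<open>D \<times> T\<^sub>L\<close>, where \<open>T(N(F(p)))\<close> is
  the image of \<open>N(F(p)) \<otimes> \<real>\<close> in \<open>T\<^sub>L\<close>.\<close>

definition torus_rel :: "model \<Rightarrow> plane set \<Rightarrow> lattice set \<Rightarrow> ((plane \<times> plane) \<times> (plane \<times> plane)) set" where
  "torus_rel M D L = {((p, t), (q, s)). p \<in> D \<and> p = q \<and>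
     (\<exists>a \<in> span (lat ` N_face M (face_at (Poly M) p)). \<exists>n\<in>L. t - s = a + lat n)}"

type_synonym point = "(plane \<times> plane) set"

definition orb_rel :: "model \<Rightarrow> ((plane \<times> plane) \<times> (plane \<times> plane)) set" where
  "orb_rel M = torus_rel M (Poly M) UNIV"

definition orb :: "model \<Rightarrow> point set" where
  "orb M = (Poly M \<times> UNIV) // orb_rel M"

definition orb_topology :: "model \<Rightarrow> point topology" where
  "orb_topology M = topology (\<lambda>V. V \<subseteq> orb M \<and>
     openin (top_of_set (Poly M \<times> UNIV)) {x \<in> Poly M \<times> UNIV. orb_rel M `` {x} \<in> V})"

text \<open>The orbit map and the torus action are defined alike on the orbifold and on its charts.\<close>

definition orbit_map :: "point \<Rightarrow> plane" where
  "orbit_map c = the_elem (fst ` c)"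

definition torus_act :: "plane \<Rightarrow> point \<Rightarrow> point" where
  "torus_act t c = (\<lambda>(p, s). (p, s + t)) ` c"


subsection \<open>Orbifold charts\<close>

definition U_vertex :: "plane set \<Rightarrow> plane \<Rightarrow> plane set" where
  "U_vertex P v = P - \<Union>{E. E edge_of P \<and> v \<notin> E}"

definition chart_space :: "model \<Rightarrow> plane \<Rightarrow> point set" where
  "chart_space M v = (U_vertex (Poly M) v \<times> UNIV) //
     torus_rel M (U_vertex (Poly M) v) (N_face M {v})"

text \<open>The projection \<open>\<xi>\<^sub>v\<close>: a class of the finer relation is saturated to a class of \<open>orb_rel\<close>.\<close>

definition chart_proj :: "model \<Rightarrow> point \<Rightarrow> point" where
  "chart_proj M c = orb_rel M `` c"

text \<open>Coordinates of \<open>t\<close> with respect to the basis of characteristic vectors at \<open>v\<close>, by Cramer's rule.\<close>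

definition angle1 :: "model \<Rightarrow> plane \<Rightarrow> plane \<Rightarrow> real" where
  "angle1 M v t = (let a = lat (Char M (edge1 (Poly M) v)); b = lat (Char M (edge2 (Poly M) v))
     in det2 t b / det2 a b)"

definition angle2 :: "model \<Rightarrow> plane \<Rightarrow> plane \<Rightarrow> real" where
  "angle2 M v t = (let a = lat (Char M (edge1 (Poly M) v)); b = lat (Char M (edge2 (Poly M) v))
     in det2 a t / det2 a b)"

definition chart_coord :: "model \<Rightarrow> plane \<Rightarrow> point \<Rightarrow> C2" where
  "chart_coord M v c = the_elem ((\<lambda>(p, t).
     (of_real (sqrt (EdgeFun M (edge1 (Poly M) v) p)) * cis (2 * pi * angle1 M v t),
      of_real (sqrt (EdgeFun M (edge2 (Poly M) v) p)) * cis (2 * pi * angle2 M v t))) ` c)"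

text \<open>The chart as an open subset of \<open>\<complex>\<^sup>2\<close>, and \<open>\<xi>\<^sub>v\<close> as a map on it.\<close>

definition chart_dom :: "model \<Rightarrow> plane \<Rightarrow> C2 set" where
  "chart_dom M v = chart_coord M v ` chart_space M v"

definition chart_map :: "model \<Rightarrow> plane \<Rightarrow> C2 \<Rightarrow> point" where
  "chart_map M v z = chart_proj M (inv_into (chart_space M v) (chart_coord M v) z)"

text \<open>The action of \<open>T\<^bsub>N(v)\<^esub>\<close> in the coordinates of the chart.\<close>

definition rotate_chart :: "model \<Rightarrow> plane \<Rightarrow> plane \<Rightarrow> C2 \<Rightarrow> C2" where
  "rotate_chart M v t z = (cis (2 * pi * angle1 M v t) * fst z, cis (2 * pi * angle2 M v t) * snd z)"

text \<open>The local group at a point is the stabiliser of a preimage under \<open>G\<^sub>v = N / N(v)\<close>.\<close>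

definition regular_points :: "model \<Rightarrow> point set" where
  "regular_points M = {x \<in> orb M. \<forall>v\<in>vertices (Poly M). \<forall>c\<in>chart_space M v.
     chart_proj M c = x \<longrightarrow> (\<forall>n. torus_act (lat n) c = c \<longrightarrow> n \<in> N_face M {v})}"


section \<open>Almost complex structures and metrics\<close>

text \<open>\<open>\<phi>\<close> is a smooth lift, over an open part \<open>W\<close> of the chart at \<open>v\<close>, of the map \<open>F\<close> to the chart at
  \<open>u\<close>.\<close>

definition is_lift ::
  "model \<Rightarrow> plane \<Rightarrow> model \<Rightarrow> plane \<Rightarrow> (point \<Rightarrow> point) \<Rightarrow> C2 set \<Rightarrow> (C2 \<Rightarrow> C2) \<Rightarrow> bool" where
  "is_lift M v M' u F W \<phi> \<longleftrightarrow> open W \<and> W \<subseteq> chart_dom M v \<and> smooth_on W \<phi> \<and>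
     \<phi> ` W \<subseteq> chart_dom M' u \<and> (\<forall>z\<in>W. chart_map M' u (\<phi> z) = F (chart_map M v z))"

text \<open>Tensors on an orbifold are given by a tensor on the chart at each vertex.\<close>

type_synonym endo_field = "plane \<Rightarrow> C2 \<Rightarrow> C2 \<Rightarrow> C2"
type_synonym form_field = "plane \<Rightarrow> C2 \<Rightarrow> C2 \<Rightarrow> C2 \<Rightarrow> real"

text \<open>\<open>dF \<circ> J = J' \<circ> dF\<close> over the set \<open>D\<close>. Where \<open>F\<close> is a local diffeomorphism of orbifolds,
  this says that \<open>J' = dF \<circ> J \<circ> dF\<^sup>-\<^sup>1\<close>.\<close>

definition intertwines ::
  "model \<Rightarrow> model \<Rightarrow> (point \<Rightarrow> point) \<Rightarrow> point set \<Rightarrow> endo_field \<Rightarrow> endo_field \<Rightarrow> bool" where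
  "intertwines M M' F D J J' \<longleftrightarrow>
     (\<forall>v\<in>vertices (Poly M). \<forall>u\<in>vertices (Poly M'). \<forall>W \<phi>.
        is_lift M v M' u F W \<phi> \<and> chart_map M v ` W \<subseteq> D \<longrightarrow>
        (\<forall>z\<in>W. \<forall>h. differential \<phi> z (J v z h) = J' u (\<phi> z) (differential \<phi> z h)))"

definition preserves_form :: "model \<Rightarrow> (point \<Rightarrow> point) \<Rightarrow> point set \<Rightarrow> form_field \<Rightarrow> bool" where
  "preserves_form M F D g \<longleftrightarrow>
     (\<forall>v\<in>vertices (Poly M). \<forall>u\<in>vertices (Poly M). \<forall>W \<phi>.
        is_lift M v M u F W \<phi> \<and> chart_map M v ` W \<subseteq> D \<longrightarrow>
        (\<forall>z\<in>W. \<forall>h h'. g u (\<phi> z) (differential \<phi> z h) (differential \<phi> z h') = g v z h h'))"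

text \<open>Compatibility with all lifts of the identity comprises invariance under the groups \<open>G\<^sub>v\<close>
  and agreement on overlaps of charts.\<close>

definition almost_complex :: "model \<Rightarrow> endo_field \<Rightarrow> bool" where
  "almost_complex M J \<longleftrightarrow>
     (\<forall>v\<in>vertices (Poly M).
        (\<forall>h. smooth_on (chart_dom M v) (\<lambda>z. J v z h)) \<and>
        (\<forall>z\<in>chart_dom M v. linear (J v z) \<and> (\<forall>h. J v z (J v z h) = - h))) \<and>
     intertwines M M id (orb M) J J"

definition riemannian :: "model \<Rightarrow> form_field \<Rightarrow> bool" where
  "riemannian M g \<longleftrightarrow>
     (\<forall>v\<in>vertices (Poly M).
        (\<forall>h h'. smooth_on (chart_dom M v) (\<lambda>z. g v z h h')) \<and>
        (\<forall>z\<in>chart_dom M v. bilinear (g v z) \<and> (\<forall>h h'. g v z h h' = g v z h' h) \<and>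
           (\<forall>h. h \<noteq> 0 \<longrightarrow> g v z h h > 0))) \<and>
     preserves_form M id (orb M) g"

text \<open>The point of the chart at \<open>v\<close> lying over \<open>v\<close> is the origin.\<close>

definition invariant_nbhd :: "model \<Rightarrow> plane \<Rightarrow> C2 set \<Rightarrow> bool" where
  "invariant_nbhd M v W \<longleftrightarrow> open W \<and> 0 \<in> W \<and> W \<subseteq> chart_dom M v \<and> (\<forall>t. rotate_chart M v t ` W \<subseteq> W)"

definition torus_invariant_acs :: "model \<Rightarrow> endo_field \<Rightarrow> bool" where
  "torus_invariant_acs M J \<longleftrightarrow>
     (\<forall>v\<in>vertices (Poly M). \<exists>W. invariant_nbhd M v W \<and>
        (\<forall>t. \<forall>z\<in>W. \<forall>h. rotate_chart M v t (J v z h)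
            = J v (rotate_chart M v t z) (rotate_chart M v t h))) \<and>
     (\<forall>t. intertwines M M (torus_act t) (regular_points M) J J)"

definition torus_invariant_metric :: "model \<Rightarrow> form_field \<Rightarrow> bool" where
  "torus_invariant_metric M g \<longleftrightarrow>
     (\<forall>v\<in>vertices (Poly M). \<exists>W. invariant_nbhd M v W \<and>
        (\<forall>t. \<forall>z\<in>W. \<forall>h h'. g v (rotate_chart M v t z) (rotate_chart M v t h) (rotate_chart M v t h')
            = g v z h h')) \<and>
     (\<forall>t. preserves_form M (torus_act t) (regular_points M) g)"

definition orthogonal_acs :: "model \<Rightarrow> form_field \<Rightarrow> endo_field \<Rightarrow> bool" where
  "orthogonal_acs M g J \<longleftrightarrow>
     (\<forall>v\<in>vertices (Poly M). \<forall>z\<in>chart_dom M v. \<forall>h h'. g v z (J v z h) (J v z h') = g v z h h')"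

definition times_i :: "C2 \<Rightarrow> C2" where
  "times_i h = (\<i> * fst h, \<i> * snd h)"

text \<open>\<open>\<zeta>\<close> is a system of local holomorphic coordinates for \<open>J\<close> on the open set \<open>W\<close>.\<close>

definition holomorphic_coords :: "C2 set \<Rightarrow> (C2 \<Rightarrow> C2) \<Rightarrow> (C2 \<Rightarrow> C2 \<Rightarrow> C2) \<Rightarrow> bool" where
  "holomorphic_coords W \<zeta> J \<longleftrightarrow> smooth_on W \<zeta> \<and>
     (\<forall>z\<in>W. inj (differential \<zeta> z) \<and> (\<forall>h. differential \<zeta> z (J z h) = times_i (differential \<zeta> z h)))"

text \<open>The sections over \<open>V\<close> of the sheaf of \<open>J\<close>-holomorphic functions.\<close>

definition holomorphic_functions :: "model \<Rightarrow> endo_field \<Rightarrow> point set \<Rightarrow> (point \<Rightarrow> complex) set" where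
  "holomorphic_functions M J V = {g.
     continuous_map (subtopology (orb_topology M) V) euclidean g \<and>
     (\<forall>v\<in>vertices (Poly M). let W = {z \<in> chart_dom M v. chart_map M v z \<in> V} in
        smooth_on W (g \<circ> chart_map M v) \<and>
        (\<forall>z\<in>W. \<forall>h. differential (g \<circ> chart_map M v) z (J v z h)
            = \<i> * differential (g \<circ> chart_map M v) z h))}"

definition pseudo_holomorphic ::
  "model \<Rightarrow> endo_field \<Rightarrow> model \<Rightarrow> endo_field \<Rightarrow> (point \<Rightarrow> point) \<Rightarrow> bool" where
  "pseudo_holomorphic M J M' J' F \<longleftrightarrow>
     continuous_map (orb_topology M) (orb_topology M') F \<and>
     (\<forall>V g. openin (orb_topology M') V \<and> g \<in> holomorphic_functions M' J' V \<longrightarrow>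
        g \<circ> F \<in> holomorphic_functions M J {x \<in> orb M. F x \<in> V})"


section \<open>The blowdown\<close>

text \<open>Below, \<open>p\<^sub>1\<close>, \<open>p\<^sub>2\<close> and \<open>p\<close>-hat are the functions of the edges \<open>E\<^sub>1\<close>, \<open>E\<^sub>3\<close> and \<open>E\<^sub>2\<close>.
  No basis of \<open>N\<close> is fixed: the coordinates at each vertex refer to its characteristic vectors.\<close>

definition new_vertex :: "model \<Rightarrow> plane set \<Rightarrow> plane set \<Rightarrow> plane" where
  "new_vertex M E1 E3 = (THE w. EdgeFun M E1 w = 0 \<and> EdgeFun M E3 w = 0)"

text \<open>Each edge of the new polytope contains exactly one edge of \<open>P\<close> other than \<open>E\<^sub>2\<close>, and inherits its
  characteristic vector and affine function.\<close>

definition old_edge :: "model \<Rightarrow> plane set \<Rightarrow> plane set \<Rightarrow> plane set" where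
  "old_edge M E2 E' = (THE E. E edge_of Poly M \<and> E \<noteq> E2 \<and> E \<subseteq> E')"

definition blowdown_model :: "model \<Rightarrow> plane set \<Rightarrow> plane set \<Rightarrow> plane set \<Rightarrow> model" where
  "blowdown_model M E1 E2 E3 =
     \<lparr>Poly = convex hull (insert (new_vertex M E1 E3) (Poly M)),
      Char = (\<lambda>E'. Char M (old_edge M E2 E')),
      EdgeFun = (\<lambda>E'. EdgeFun M (old_edge M E2 E'))\<rparr>"

definition blowdown_base ::
  "model \<Rightarrow> plane set \<Rightarrow> plane set \<Rightarrow> plane set \<Rightarrow> nat \<Rightarrow> (real \<Rightarrow> real) \<Rightarrow> plane \<Rightarrow> plane" where
  "blowdown_base M E1 E2 E3 k \<delta> p = (THE r.
     EdgeFun M E1 r = \<delta> (EdgeFun M E2 p) ^ k * EdgeFun M E1 p \<and>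
     EdgeFun M E3 r = \<delta> (EdgeFun M E2 p) * EdgeFun M E3 p)"

definition blowdown_map ::
  "model \<Rightarrow> plane set \<Rightarrow> plane set \<Rightarrow> plane set \<Rightarrow> nat \<Rightarrow> (real \<Rightarrow> real) \<Rightarrow> point \<Rightarrow> point" where
  "blowdown_map M E1 E2 E3 k \<delta> c = orb_rel (blowdown_model M E1 E2 E3) ``
     ((\<lambda>(p, t). (blowdown_base M E1 E2 E3 k \<delta> p, t)) ` c)"

text \<open>The coordinates \<open>(z\<^sub>1'(v\<^sub>j), z\<^sub>2'(v\<^sub>j))\<close> as functions of \<open>z = (z\<^sub>1(v\<^sub>j), z\<^sub>2(v\<^sub>j))\<close>. Where \<open>p\<close>-hat
  vanishes, so does the coordinate that is multiplied by a quotient with denominator \<open>p\<close>-hat.\<close>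

definition new_coords1 ::
  "model \<Rightarrow> plane set \<Rightarrow> plane set \<Rightarrow> plane \<Rightarrow> nat \<Rightarrow> nat \<Rightarrow> (real \<Rightarrow> real) \<Rightarrow> C2 \<Rightarrow> C2" where
  "new_coords1 M E2 E3 v1 k m \<delta> z =
     (let p = orbit_map (chart_map M v1 z); p2 = EdgeFun M E3 p; ph = EdgeFun M E2 p
      in (fst z * of_real (sqrt (p2 powi (- int k))),
          snd z * of_real (sqrt (\<delta> ph ^ m * p2 ^ m / ph))))"

definition new_coords2 ::
  "model \<Rightarrow> plane set \<Rightarrow> plane set \<Rightarrow> plane \<Rightarrow> nat \<Rightarrow> nat \<Rightarrow> (real \<Rightarrow> real) \<Rightarrow> C2 \<Rightarrow> C2" where
  "new_coords2 M E1 E2 v2 k m \<delta> z =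
     (let p = orbit_map (chart_map M v2 z); p1 = EdgeFun M E1 p; ph = EdgeFun M E2 p
      in (fst z * of_real (sqrt (\<delta> ph ^ m * p1 powr (real m / real k) / ph)),
          snd z * of_real (sqrt (p1 powr (- 1 / real k)))))"

text \<open>The part over \<open>U\<close> of the chart at \<open>v\<close>.\<close>

definition chart_over :: "model \<Rightarrow> plane \<Rightarrow> plane set \<Rightarrow> C2 set" where
  "chart_over M v U = {z \<in> chart_dom M v. orbit_map (chart_map M v z) \<in> U}"

end

theory Submission
  imports Defs "HOL-Complex_Analysis.Complex_Analysis"
begin

text \<open>Let \<open>g\<close> be a \<open>J2\<close>-holomorphic function on an open part of \<open>Y\<close>. Away from \<open>\<pi>\<^sup>-\<^sup>1(E2)\<close> the blowdown is a local
  diffeomorphism of orbifolds that carries \<open>J1\<close> to \<open>J2\<close>, so \<open>g \<circ> \<rho>\<close> is \<open>J1\<close>-holomorphic there. This uses that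
  \<open>\<rho>\<close> lifts locally to smooth maps between charts (lemma \<open>local_lift\<close>), to which the chain rule applies
  (lemma \<open>pullback_off_E2\<close>).

  At points of \<open>\<pi>\<^sup>-\<^sup>1(E2)\<close> there need not be such lifts: near \<open>v1\<close>, in the coordinates \<open>z\<^sub>1'\<close>, \<open>z\<^sub>2'\<close>, the
  blowdown is \<open>(z\<^sub>1' z\<^sub>2'\<^bsup>k/m\<^esup>, z\<^sub>2'\<^bsup>1/m\<^esup>)\<close>, with a branch point along \<open>z\<^sub>2' = 0\<close>. But \<open>\<rho>\<close> is continuous on the
  quotient space, so \<open>g \<circ> \<rho>\<close> is a continuous function which is holomorphic off the complex curve
  \<open>\<pi>\<^sup>-\<^sup>1(E2)\<close>, and in the holomorphic coordinates of \<open>J1\<close> this curve is a coordinate line. Riemann's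
  theorem on removable singularities in each variable, followed by Osgood's theorem, shows that
  \<open>g \<circ> \<rho>\<close> is holomorphic and smooth across the curve (lemmas \<open>holomorphic_extension_snd\<close> and
  \<open>holomorphic_extension_fst\<close>, applied in \<open>pullback_holomorphic\<close>).

  The geometric part makes charts and blowdown explicit. The polygon is the intersection of the
  half-planes of its edge functions, and exactly two edges meet at a vertex (lemmas \<open>P_iff\<close> and
  \<open>vertex_edges\<close>). The chart map at a vertex is continuous on an open subset of \<open>\<complex>\<^sup>2\<close> (lemma
  \<open>open_chart_map_preimage\<close>). The edges of the new polygon are the extensions of the edges other than \<open>E2\<close>
  (lemma \<open>edge_of_Y\<close>), because the remaining edges keep away from the corner at \<open>w\<close> in which \<open>f\<close> differs from the identity
  (lemma \<open>others_pos\<close>).\<close>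

section \<open>Calculus of smooth maps\<close>

text \<open>The successor step of the definition speaks of \<open>frechet_derivative\<close>, a choice operator. In proofs a
  derivative is usually known explicitly, and on an open set it may be used in place of the chosen one.\<close>

lemma C_k_on_SucI:
  assumes "\<And>x. x \<in> S \<Longrightarrow> (f has_derivative F x) (at x)" and "\<And>h. C_k_on n S (\<lambda>x. F x h)"
    and "open S"
  shows "C_k_on (Suc n) S f"
proof -
  (* The derivative at a point of an open set only depends on the values on that set. *)
  have cong: "C_k_on n S f \<longleftrightarrow> C_k_on n S g" if "\<And>x. x \<in> S \<Longrightarrow> f x = g x"
    for n and f g :: "'a \<Rightarrow> 'b"
    using that
  proof (induction n arbitrary: f g)
    case 0
    then show ?case by (simp cong: continuous_on_cong)
  next
    case (Suc n)
    have "(f has_derivative D) (at x) \<longleftrightarrow> (g has_derivative D) (at x)" if "x \<in> S" for x D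
      using has_derivative_transform_within_open[of f D x UNIV S g]
        has_derivative_transform_within_open[of g D x UNIV S f] Suc.prems that \<open>open S\<close>
      by metis
    then have "f differentiable (at x) \<longleftrightarrow> g differentiable (at x)"
      and "frechet_derivative f (at x) = frechet_derivative g (at x)" if "x \<in> S" for x
      using that by (auto simp: differentiable_def frechet_derivative_def)
    then show ?case
      using Suc.IH[of "\<lambda>x. frechet_derivative f (at x) h" "\<lambda>x. frechet_derivative g (at x) h" for h]
      by auto
  qed
  have "frechet_derivative f (at x) = F x" if "x \<in> S" for x
    using assms(1)[OF that] frechet_derivative_at by force
  then have "C_k_on n S (\<lambda>x. frechet_derivative f (at x) h)" for h
    using cong[of "\<lambda>x. frechet_derivative f (at x) h" "\<lambda>x. F x h" n] assms(2) by auto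
  then show ?thesis
    using assms(1) by (auto simp: differentiable_def)
qed

lemma C_k_on_has_derivative:
  "C_k_on (Suc n) S f \<Longrightarrow> x \<in> S \<Longrightarrow> (f has_derivative frechet_derivative f (at x)) (at x)"
  by (simp add: frechet_derivative_works)

lemma C_k_on_cong:
  assumes "open S" "\<And>x. x \<in> S \<Longrightarrow> f x = g x" "C_k_on n S f"
  shows "C_k_on n S g"
proof (cases n)
  case 0
  then show ?thesis using assms by (simp cong: continuous_on_cong)
next
  case (Suc l)
  show ?thesis unfolding Suc
  proof (rule C_k_on_SucI)
    show "(g has_derivative frechet_derivative f (at x)) (at x)" if "x \<in> S" for x
      using C_k_on_has_derivative[of l S f x] assms Suc that
      by (metis has_derivative_transform_within_open)
  qed (use assms Suc in auto)
qed

lemma C_k_on_SucD: "C_k_on (Suc n) S f \<Longrightarrow> C_k_on n S f"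
proof (induction n arbitrary: f)
  case 0
  then show ?case
    by (auto intro!: continuous_at_imp_continuous_on differentiable_imp_continuous_within)
next
  case (Suc n)
  then show ?case
    unfolding C_k_on.simps(2)[of "Suc n"] C_k_on.simps(2)[of n] by blast
qed

lemma C_k_on_local:
  assumes "\<And>x. x \<in> S \<Longrightarrow> \<exists>T. open T \<and> x \<in> T \<and> C_k_on n T f"
  shows "C_k_on n S f"
  using assms
proof (induction n arbitrary: f)
  case 0
  then have "continuous (at x) f" if "x \<in> S" for x
    using that by (metis C_k_on.simps(1) continuous_on_eq_continuous_at)
  then show ?case by (simp add: continuous_at_imp_continuous_on)
next
  case (Suc n)
  have "f differentiable (at x)" if "x \<in> S" for x
    using Suc.prems[OF that] by auto
  moreover have "C_k_on n S (\<lambda>x. frechet_derivative f (at x) h)" for h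
    by (rule Suc.IH) (use Suc.prems in fastforce)
  ultimately show ?case by simp
qed

lemma C_k_on_subset: "C_k_on n S f \<Longrightarrow> T \<subseteq> S \<Longrightarrow> C_k_on n T f"
  by (induction n arbitrary: f) (auto intro: continuous_on_subset)

lemma C_k_on_const: "open S \<Longrightarrow> C_k_on n S (\<lambda>x. c)"
proof (induction n arbitrary: c)
  case (Suc n)
  then show ?case by (intro C_k_on_SucI[where F = "\<lambda>x h. 0"]) auto
qed auto

lemma C_k_on_ident: "open S \<Longrightarrow> C_k_on n S (\<lambda>x. x)"
proof (cases n)
  case (Suc l)
  assume "open S"
  then show ?thesis unfolding Suc
    by (intro C_k_on_SucI[where F = "\<lambda>x h. h"]) (auto intro: C_k_on_const)
qed auto

lemma C_k_on_bounded_linear: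
  assumes "bounded_linear L" "open S"
  shows "C_k_on n S f \<Longrightarrow> C_k_on n S (\<lambda>x. L (f x))"
proof (induction n arbitrary: f)
  case 0
  then show ?case using assms by (simp add: bounded_linear.continuous_on)
next
  case (Suc n)
  show ?case
  proof (rule C_k_on_SucI)
    show "((\<lambda>x. L (f x)) has_derivative (\<lambda>h. L (frechet_derivative f (at x) h))) (at x)"
      if "x \<in> S" for x
      using bounded_linear.has_derivative[OF assms(1) C_k_on_has_derivative[OF Suc.prems that]] .
  qed (use Suc assms in auto)
qed

lemma C_k_on_add:
  assumes "open S"
  shows "C_k_on n S f \<Longrightarrow> C_k_on n S g \<Longrightarrow> C_k_on n S (\<lambda>x. f x + g x)"
proof (induction n arbitrary: f g)
  case 0
  then show ?case by (simp add: continuous_on_add)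
next
  case (Suc n)
  show ?case
  proof (rule C_k_on_SucI)
    show "((\<lambda>x. f x + g x) has_derivative
        (\<lambda>h. frechet_derivative f (at x) h + frechet_derivative g (at x) h)) (at x)"
      if "x \<in> S" for x
      using has_derivative_add C_k_on_has_derivative Suc.prems that by blast
  qed (use Suc assms in auto)
qed

lemma C_k_on_sum:
  assumes "open S" "\<And>i. i \<in> I \<Longrightarrow> C_k_on n S (f i)"
  shows "C_k_on n S (\<lambda>x. \<Sum>i\<in>I. f i x)"
  using assms(2)
  by (induction I rule: infinite_finite_induct) (auto intro: C_k_on_const C_k_on_add assms(1))

lemma C_k_on_bilinear:
  assumes "bounded_bilinear \<beta>" "open S"
  shows "C_k_on n S f \<Longrightarrow> C_k_on n S g \<Longrightarrow> C_k_on n S (\<lambda>x. \<beta> (f x) (g x))"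
proof (induction n arbitrary: f g)
  case 0
  then show ?case using bounded_bilinear.continuous_on[OF assms(1)] by auto
next
  case (Suc n)
  show ?case
  proof (rule C_k_on_SucI)
    show "((\<lambda>x. \<beta> (f x) (g x)) has_derivative
        (\<lambda>h. \<beta> (f x) (frechet_derivative g (at x) h) + \<beta> (frechet_derivative f (at x) h) (g x)))
        (at x)" if "x \<in> S" for x
      by (rule bounded_bilinear.FDERIV[OF assms(1)])
        (fact C_k_on_has_derivative[OF Suc.prems(1) that] C_k_on_has_derivative[OF Suc.prems(2) that])+
    show "C_k_on n S (\<lambda>x. \<beta> (f x) (frechet_derivative g (at x) h)
        + \<beta> (frechet_derivative f (at x) h) (g x))" for h
      using Suc.prems assms C_k_on_SucD[OF Suc.prems(1)] C_k_on_SucD[OF Suc.prems(2)]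
      by (intro C_k_on_add Suc.IH) auto
  qed (fact assms)
qed

lemma C_k_on_compose:
  fixes g :: "'a::euclidean_space \<Rightarrow> 'b::euclidean_space" and f :: "'b \<Rightarrow> 'c::real_normed_vector"
  assumes "open S" "open T" "g ` S \<subseteq> T"
  shows "C_k_on n T f \<Longrightarrow> C_k_on n S g \<Longrightarrow> C_k_on n S (\<lambda>x. f (g x))"
proof (induction n arbitrary: f)
  case 0
  then show ?case using assms by (auto intro: continuous_on_compose2)
next
  case (Suc n)
  let ?F = "\<lambda>x h. \<Sum>b\<in>Basis. (frechet_derivative g (at x) h \<bullet> b) *\<^sub>R frechet_derivative f (at (g x)) b"
  show ?case
  proof (rule C_k_on_SucI)
    show "((\<lambda>x. f (g x)) has_derivative ?F x) (at x)" if "x \<in> S" for x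
    proof -
      have f: "(f has_derivative frechet_derivative f (at (g x))) (at (g x))"
        using C_k_on_has_derivative Suc.prems(1) that assms(3) by blast
      have g: "(g has_derivative frechet_derivative g (at x)) (at x)"
        using C_k_on_has_derivative Suc.prems(2) that by blast
      interpret linear "frechet_derivative f (at (g x))"
        using f has_derivative_linear by blast
      (* For the induction hypothesis to apply, f' must be evaluated at constant directions, hence the
         expansion along the basis. *)
      have expand: "frechet_derivative f (at (g x)) y
          = (\<Sum>b\<in>Basis. (y \<bullet> b) *\<^sub>R frechet_derivative f (at (g x)) b)" for y
      proof -
        have "frechet_derivative f (at (g x)) y
            = frechet_derivative f (at (g x)) (\<Sum>b\<in>Basis. (y \<bullet> b) *\<^sub>R b)"
          by (simp only: euclidean_representation)
        then show ?thesis by (simp only: sum scale)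
      qed
      have "?F x = (\<lambda>h. frechet_derivative f (at (g x)) (frechet_derivative g (at x) h))"
        by (intro ext) (rule expand[symmetric])
      then show ?thesis using has_derivative_compose[OF g f] by simp
    qed
    show "C_k_on n S (\<lambda>x. ?F x h)" for h
    proof (intro C_k_on_sum C_k_on_bilinear[OF bounded_bilinear_scaleR] assms)
      fix b :: 'b
      show "C_k_on n S (\<lambda>x. frechet_derivative g (at x) h \<bullet> b)"
        using Suc.prems by (intro C_k_on_bounded_linear[OF bounded_linear_inner_left] assms) auto
      show "C_k_on n S (\<lambda>x. frechet_derivative f (at (g x)) b)"
        using Suc.prems(1) C_k_on_SucD[OF Suc.prems(2)] by (intro Suc.IH) auto
    qed
  qed (fact assms)
qed

lemma smooth_on_subset: "smooth_on S f \<Longrightarrow> T \<subseteq> S \<Longrightarrow> smooth_on T f"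
  by (auto simp: smooth_on_def intro: C_k_on_subset)

lemma smooth_on_cong: "open S \<Longrightarrow> (\<And>x. x \<in> S \<Longrightarrow> f x = g x) \<Longrightarrow> smooth_on S f \<Longrightarrow> smooth_on S g"
  unfolding smooth_on_def using C_k_on_cong by blast

lemma smooth_on_local:
  "(\<And>x. x \<in> S \<Longrightarrow> \<exists>T. open T \<and> x \<in> T \<and> smooth_on T f) \<Longrightarrow> smooth_on S f"
  unfolding smooth_on_def by (meson C_k_on_local)

lemma smooth_on_imp_continuous_on: "smooth_on S f \<Longrightarrow> continuous_on S f"
  unfolding smooth_on_def using C_k_on.simps(1) by blast

lemma smooth_on_has_derivative:
  "smooth_on S f \<Longrightarrow> x \<in> S \<Longrightarrow> (f has_derivative frechet_derivative f (at x)) (at x)"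
  unfolding smooth_on_def using C_k_on_has_derivative by blast

lemma smooth_on_const: "open S \<Longrightarrow> smooth_on S (\<lambda>x. c)"
  by (simp add: smooth_on_def C_k_on_const)

lemma smooth_on_ident: "open S \<Longrightarrow> smooth_on S (\<lambda>x. x)"
  by (simp add: smooth_on_def C_k_on_ident)

lemma smooth_on_bounded_linear:
  "bounded_linear L \<Longrightarrow> open S \<Longrightarrow> smooth_on S f \<Longrightarrow> smooth_on S (\<lambda>x. L (f x))"
  by (simp add: smooth_on_def C_k_on_bounded_linear)

lemma smooth_on_add:
  "open S \<Longrightarrow> smooth_on S f \<Longrightarrow> smooth_on S g \<Longrightarrow> smooth_on S (\<lambda>x. f x + g x)"
  by (simp add: smooth_on_def C_k_on_add)

lemma smooth_on_bilinear:
  "bounded_bilinear \<beta> \<Longrightarrow> open S \<Longrightarrow> smooth_on S f \<Longrightarrow> smooth_on S g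
    \<Longrightarrow> smooth_on S (\<lambda>x. \<beta> (f x) (g x))"
  by (simp add: smooth_on_def C_k_on_bilinear)

lemmas smooth_on_mult = smooth_on_bilinear[OF bounded_bilinear_mult]

lemma smooth_on_power:
  fixes f :: "'a::euclidean_space \<Rightarrow> 'b::real_normed_field"
  shows "open S \<Longrightarrow> smooth_on S f \<Longrightarrow> smooth_on S (\<lambda>x. f x ^ n)"
  by (induction n) (auto intro: smooth_on_const smooth_on_mult)

lemma smooth_on_compose:
  fixes g :: "'a::euclidean_space \<Rightarrow> 'b::euclidean_space" and f :: "'b \<Rightarrow> 'c::real_normed_vector"
  shows "open S \<Longrightarrow> open T \<Longrightarrow> g ` S \<subseteq> T \<Longrightarrow> smooth_on T f \<Longrightarrow> smooth_on S g
    \<Longrightarrow> smooth_on S (\<lambda>x. f (g x))"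
  using C_k_on_compose unfolding smooth_on_def by blast

lemma smooth_on_Pair:
  fixes f :: "'a::euclidean_space \<Rightarrow> 'b::real_normed_vector" and g :: "'a \<Rightarrow> 'c::real_normed_vector"
  assumes "open S" "smooth_on S f" "smooth_on S g"
  shows "smooth_on S (\<lambda>x. (f x, g x))"
proof -
  have "smooth_on S (\<lambda>x. (f x, 0::'c) + (0::'b, g x))"
    using assms
    by (intro smooth_on_add smooth_on_bounded_linear[where L = "\<lambda>y. (y, 0)"]
      smooth_on_bounded_linear[where L = "\<lambda>y. (0, y)"]
      bounded_linear_Pair bounded_linear_ident bounded_linear_zero assms)
  then show ?thesis by simp
qed

text \<open>Square roots, quotients and fractional powers of positive functions are all reduced to this family,
  which is closed under differentiation up to constant factors.\<close>

lemma smooth_on_powr: "smooth_on {0<..} (\<lambda>x::real. x powr a)"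
proof -
  have "C_k_on n {0<..} (\<lambda>x::real. x powr a)" for n
  proof (induction n arbitrary: a)
    case 0
    then show ?case by (auto intro!: continuous_intros)
  next
    case (Suc n)
    show ?case
    proof (rule C_k_on_SucI)
      show "((\<lambda>x. x powr a) has_derivative (\<lambda>h. (a * x powr (a - 1)) * h)) (at x)"
        if "x \<in> {0<..}" for x
        using has_real_derivative_powr[of x a] that by (simp add: has_field_derivative_def)
      show "C_k_on n {0<..} (\<lambda>x. a * x powr (a - 1) * h)" for h
        using C_k_on_bounded_linear[OF bounded_linear_mult_right[of "a * h"] open_greaterThan Suc[of "a - 1"]]
        by (simp add: mult_ac)
    qed auto
  qed
  then show ?thesis by (simp add: smooth_on_def)
qed

lemma smooth_on_holomorphic:
  assumes "open S" "f holomorphic_on S"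
  shows "smooth_on S f"
proof -
  have "C_k_on n S f" for n
    using assms(2)
  proof (induction n arbitrary: f)
    case 0
    then show ?case by (simp add: holomorphic_on_imp_continuous_on)
  next
    case (Suc n)
    show ?case
    proof (rule C_k_on_SucI)
      show "(f has_derivative (\<lambda>h. deriv f x * h)) (at x)" if "x \<in> S" for x
        using holomorphic_derivI[OF Suc.prems assms(1) that]
        by (simp add: has_field_derivative_def)
      show "C_k_on n S (\<lambda>x. deriv f x * h)" for h
        by (rule C_k_on_bounded_linear[OF bounded_linear_mult_left assms(1)])
          (simp add: Suc holomorphic_deriv assms(1))
    qed (fact assms)
  qed
  then show ?thesis by (simp add: smooth_on_def)
qed

section \<open>Holomorphic functions of two complex variables\<close>

text \<open>By Osgood's theorem this notion coincides with holomorphy in two variables.\<close>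

definition separately_holomorphic_on :: "C2 set \<Rightarrow> (C2 \<Rightarrow> complex) \<Rightarrow> bool" where
  "separately_holomorphic_on W F \<longleftrightarrow> continuous_on W F \<and>
     (\<forall>a b. (a, b) \<in> W \<longrightarrow> (\<lambda>x. F (x, b)) field_differentiable (at a) \<and>
        (\<lambda>y. F (a, y)) field_differentiable (at b))"

abbreviation partial1 :: "(C2 \<Rightarrow> complex) \<Rightarrow> C2 \<Rightarrow> complex" where
  "partial1 F p \<equiv> deriv (\<lambda>x. F (x, snd p)) (fst p)"

abbreviation partial2 :: "(C2 \<Rightarrow> complex) \<Rightarrow> C2 \<Rightarrow> complex" where
  "partial2 F p \<equiv> deriv (\<lambda>y. F (fst p, y)) (snd p)"

lemma open_C2_contains_bidisc:
  assumes "open W" "(a, b) \<in> (W :: C2 set)"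
  obtains r where "r > 0" "cball a r \<times> cball b r \<subseteq> W"
proof -
  obtain A B where "open A" "open B" "(a, b) \<in> A \<times> B" "A \<times> B \<subseteq> W"
    using open_prod_elim[OF assms] by blast
  then obtain r s where "r > 0" "cball a r \<subseteq> A" "s > 0" "cball b s \<subseteq> B"
    by (metis SigmaE2 open_contains_cball)
  then have "cball a (min r s) \<subseteq> A" "cball b (min r s) \<subseteq> B" by auto
  then have "cball a (min r s) \<times> cball b (min r s) \<subseteq> W"
    using \<open>A \<times> B \<subseteq> W\<close> by (meson Sigma_mono subset_trans)
  then show ?thesis using that[of "min r s"] \<open>r > 0\<close> \<open>s > 0\<close> by simp
qed

text \<open>Cauchy's estimate bounds \<open>f''\<close> on the smaller disc by the maximum of \<open>f\<close> on the larger one, so that the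
  remainder of the first order Taylor expansion is controlled without any knowledge of derivatives.\<close>

lemma difference_quotient_estimate:
  assumes "f holomorphic_on S" "open S" "cball a (2 * r) \<subseteq> S" "r > 0"
    and M: "\<And>x. x \<in> cball a (2 * r) \<Longrightarrow> norm (f x) \<le> M"
    and "x \<in> cball a r" "x + h \<in> cball a r"
  shows "norm (f (x + h) - f x - deriv f x * h) \<le> 2 * M / r ^ 2 * norm h ^ 2"
proof -
  have "norm ((deriv ^^ 2) f y) \<le> 2 * M / r ^ 2" if "y \<in> cball a r" for y
  proof -
    (* Cauchy's inequality is applied on the disc of radius r about y. *)
    have sub: "cball y r \<subseteq> cball a (2 * r)"
      using that by (simp add: cball_subset_cball_iff dist_commute)
    have "norm ((deriv ^^ 2) f y) \<le> fact 2 * M / r ^ 2"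
    proof (rule Cauchy_inequality)
      show "f holomorphic_on ball y r"
        using assms sub ball_subset_cball by (meson holomorphic_on_subset subset_trans)
      show "continuous_on (cball y r) f"
        using assms sub by (meson holomorphic_on_imp_continuous_on holomorphic_on_subset subset_trans)
      show "norm (f x) \<le> M" if "norm (y - x) = r" for x
        using that sub by (intro M) (auto simp: dist_norm)
    qed (fact assms)
    then show ?thesis by (simp add: fact_numeral)
  qed
  moreover have "((deriv ^^ i) f has_field_derivative (deriv ^^ Suc i) f y) (at y within cball a r)"
    if "y \<in> cball a r" for y i
  proof -
    have "y \<in> S" using that assms(3) \<open>r > 0\<close> by auto
    then show ?thesis
      using has_field_derivative_at_within
        [OF holomorphic_derivI[OF holomorphic_higher_deriv[OF assms(1,2)] assms(2)], of y i]
      by simp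
  qed
  ultimately have "norm ((deriv ^^ 0) f (x + h) - (\<Sum>i\<le>1. (deriv ^^ i) f x * (x + h - x) ^ i / fact i))
      \<le> 2 * M / r ^ 2 * norm (x + h - x) ^ Suc 1 / fact 1"
    using assms(6,7) by (intro complex_Taylor[where S = "cball a r"]) (auto simp: numeral_2_eq_2)
  then show ?thesis by (simp add: numeral_2_eq_2 algebra_simps)
qed

lemma separately_holomorphic_on_swap:
  assumes "separately_holomorphic_on W F"
  shows "separately_holomorphic_on (prod.swap ` W) (F \<circ> prod.swap)"
proof -
  have "continuous_on (prod.swap ` W) (F \<circ> prod.swap)"
    using assms unfolding separately_holomorphic_on_def
    by (intro continuous_on_compose continuous_on_swap) (auto simp: image_image)
  then show ?thesis
    using assms by (auto simp: separately_holomorphic_on_def)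
qed

lemma open_swap: "open W \<Longrightarrow> open (prod.swap ` (W :: C2 set))"
proof -
  assume "open W"
  then have "open (prod.swap -` W)"
    by (intro open_vimage continuous_on_swap)
  moreover have "prod.swap ` W = prod.swap -` W" by force
  ultimately show ?thesis by simp
qed

text \<open>Difference quotients of \<open>F\<close> in the first variable converge to the partial derivative, locally uniformly
  in both variables, and uniform limits inherit continuity as well as holomorphy in the second variable.\<close>

lemma separately_holomorphic_on_partial1:
  assumes "open W" and F: "separately_holomorphic_on W F"
  shows "separately_holomorphic_on W (partial1 F)"
proof -
  have "continuous (at (a, b)) (partial1 F) \<and> (\<lambda>x. partial1 F (x, b)) field_differentiable (at a) \<and>
      (\<lambda>y. partial1 F (a, y)) field_differentiable (at b)" if ab: "(a, b) \<in> W" for a b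
  proof -
    obtain R where R: "R > 0" "cball a R \<times> cball b R \<subseteq> W"
      using open_C2_contains_bidisc[OF \<open>open W\<close> ab] .
    define r where "r = R / 3"
    have "r > 0" using R by (simp add: r_def)
    have cont: "continuous_on (cball a R \<times> cball b R) F"
      using F R continuous_on_subset unfolding separately_holomorphic_on_def by blast
    then have "bounded (F ` (cball a R \<times> cball b R))"
      by (intro compact_imp_bounded compact_continuous_image compact_Times) auto
    then obtain M where M: "\<And>p. p \<in> cball a R \<times> cball b R \<Longrightarrow> norm (F p) \<le> M"
      unfolding bounded_iff by auto
    have hol1: "(\<lambda>x. F (x, y)) holomorphic_on ball a R" if "y \<in> ball b R" for y
    proof -
      have "(x, y) \<in> W" if "x \<in> ball a R" for x
        using R that \<open>y \<in> ball b R\<close> by (intro subsetD[OF R(2)]) auto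
      then show ?thesis
        using F unfolding separately_holomorphic_on_def holomorphic_on_def
        by (blast intro: field_differentiable_at_within)
    qed
    have hol2: "(\<lambda>y. F (x, y)) holomorphic_on ball b R" if "x \<in> ball a R" for x
    proof -
      have "(x, y) \<in> W" if "y \<in> ball b R" for y
        using R that \<open>x \<in> ball a R\<close> by (intro subsetD[OF R(2)]) auto
      then show ?thesis
        using F unfolding separately_holomorphic_on_def holomorphic_on_def
        by (blast intro: field_differentiable_at_within)
    qed
    (* Increments tending to 0; the summand 3 keeps them below r / 2, so that shifted points of Q stay
       in the disc of radius r on which the estimate is available. *)
    define e where "e n = complex_of_real (r / (real n + 3))" for n
    have ne: "norm (e n) = r / (real n + 3)" for n
      unfolding e_def norm_of_real using \<open>r > 0\<close> by simp
    have e: "e n \<noteq> 0" "norm (e n) < r / 2" for n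
    proof -
      have "norm (e n) > 0" unfolding ne using \<open>r > 0\<close> by simp
      then show "e n \<noteq> 0" by auto
      show "norm (e n) < r / 2" unfolding ne using \<open>r > 0\<close> by (simp add: field_simps add_pos_nonneg)
    qed
    have e0: "(\<lambda>n. norm (e n)) \<longlonglongrightarrow> 0"
    proof -
      have "(\<lambda>n. r / real (n + 3)) \<longlonglongrightarrow> 0"
        using LIMSEQ_ignore_initial_segment[OF lim_const_over_n[of r], of 3] by simp
      then have "(\<lambda>n. r / (real n + 3)) \<longlonglongrightarrow> 0" by (simp add: add.commute)
      then have "e \<longlonglongrightarrow> of_real 0" unfolding e_def by (rule tendsto_of_real)
      then show ?thesis by (simp add: tendsto_norm_zero)
    qed
    define G where "G n p = (F (fst p + e n, snd p) - F p) / e n" for n p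
    define Q where "Q = ball a (r / 2) \<times> ball b R"
    have inQ: "x + e n \<in> ball a r" if "x \<in> ball a (r / 2)" for x n
    proof -
      have "dist a (x + e n) \<le> dist a x + norm (e n)"
        using dist_triangle[of a "x + e n" x] by (simp add: dist_norm)
      then show ?thesis using that e(2)[of n] by simp
    qed
    have est: "norm (G n p - partial1 F p) \<le> 2 * M / r ^ 2 * norm (e n)" if "p \<in> Q" for n p
    proof -
      obtain x y where p: "p = (x, y)" by (cases p)
      have xy: "x \<in> ball a (r / 2)" "y \<in> ball b R" using that by (auto simp: Q_def p)
      have "norm (F (x + e n, y) - F (x, y) - deriv (\<lambda>x. F (x, y)) x * e n) \<le> 2 * M / r ^ 2 * norm (e n) ^ 2"
        using hol1[OF xy(2)]
      proof (rule difference_quotient_estimate[where a = a])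
        show "cball a (2 * r) \<subseteq> ball a R" using R by (simp add: r_def cball_subset_ball_iff)
        show "norm (F (x, y)) \<le> M" if "x \<in> cball a (2 * r)" for x
          using that xy R by (intro M) (auto simp: r_def)
      qed (use xy inQ[OF xy(1), of n] \<open>r > 0\<close> in auto)
      then have "norm (F (x + e n, y) - F (x, y) - deriv (\<lambda>x. F (x, y)) x * e n) / norm (e n)
          \<le> 2 * M / r ^ 2 * norm (e n)"
        using e(1)[of n] by (simp add: power2_eq_square pos_divide_le_eq mult_ac)
      moreover have "G n p - partial1 F p
          = (F (x + e n, y) - F (x, y) - deriv (\<lambda>x. F (x, y)) x * e n) / e n"
        using e(1)[of n] by (simp add: G_def p diff_divide_distrib)
      ultimately show ?thesis by (simp add: norm_divide)
    qed
    have lim: "uniform_limit Q G (partial1 F) sequentially"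
    proof (rule uniform_limitI)
      fix \<epsilon> :: real assume "\<epsilon> > 0"
      have "(\<lambda>n. 2 * M / r ^ 2 * norm (e n)) \<longlonglongrightarrow> 0"
        using tendsto_mult_right_zero[OF e0] by blast
      then have "\<forall>\<^sub>F n in sequentially. 2 * M / r ^ 2 * norm (e n) < \<epsilon>"
        using \<open>\<epsilon> > 0\<close> by (rule order_tendstoD(2))
      then show "\<forall>\<^sub>F n in sequentially. \<forall>p\<in>Q. dist (G n p) (partial1 F p) < \<epsilon>"
        by eventually_elim (use est in \<open>auto simp: dist_norm intro: le_less_trans\<close>)
    qed
    have shift: "(fst p + e n, snd p) \<in> cball a R \<times> cball b R" "p \<in> cball a R \<times> cball b R"
      if "p \<in> Q" for p n
      using that inQ[of "fst p" n] R by (auto simp: Q_def r_def)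
    have "continuous_on Q (G n)" for n
      unfolding G_def using e(1)[of n] shift(1)[of _ n] shift(2)
      by (intro continuous_intros continuous_on_compose2[OF cont]) auto
    then have "continuous_on Q (partial1 F)"
      by (intro uniform_limit_theorem[OF _ lim]) auto
    moreover have "open Q" "(a, b) \<in> Q" using R \<open>r > 0\<close> by (auto simp: Q_def open_Times)
    ultimately have 1: "continuous (at (a, b)) (partial1 F)"
      using continuous_on_eq_continuous_at by blast
    have "(\<lambda>x. deriv (\<lambda>x. F (x, b)) x) holomorphic_on ball a R"
      using holomorphic_deriv[OF hol1] R by auto
    then have 2: "(\<lambda>x. partial1 F (x, b)) field_differentiable (at a)"
      using R holomorphic_on_imp_differentiable_at by force
    have "(\<lambda>y. partial1 F (a, y)) holomorphic_on ball b R"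
    proof (rule holomorphic_uniform_sequence)
      have "a \<in> ball a R" "a + e n \<in> ball a R" for n
        using R inQ[of a n] \<open>r > 0\<close> by (auto simp: r_def)
      then show "(\<lambda>y. G n (a, y)) holomorphic_on ball b R" for n
        unfolding G_def fst_conv snd_conv
        by (intro holomorphic_intros hol2) (auto simp: e)
      show "\<exists>d>0. cball y d \<subseteq> ball b R \<and>
          uniform_limit (cball y d) (\<lambda>n y. G n (a, y)) (\<lambda>y. partial1 F (a, y)) sequentially"
        if "y \<in> ball b R" for y
      proof -
        obtain d where d: "d > 0" "cball y d \<subseteq> ball b R"
          using \<open>y \<in> ball b R\<close> by (meson open_ball open_contains_cball)
        have "uniform_limit (cball y d) (\<lambda>n y. G n (a, y)) (\<lambda>y. partial1 F (a, y)) sequentially"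
          using lim d(2) \<open>r > 0\<close> unfolding uniform_limit_iff by (fastforce simp: Q_def elim!: eventually_mono)
        with d show ?thesis by blast
      qed
    qed auto
    then have "(\<lambda>y. partial1 F (a, y)) field_differentiable (at b)"
      using R holomorphic_on_imp_differentiable_at by force
    with 1 2 show ?thesis by blast
  qed
  then show ?thesis
    unfolding separately_holomorphic_on_def
    by (auto intro!: continuous_at_imp_continuous_on)
qed

lemma separately_holomorphic_on_partial2:
  assumes "open W" and F: "separately_holomorphic_on W F"
  shows "separately_holomorphic_on W (partial2 F)"
proof -
  have "separately_holomorphic_on (prod.swap ` prod.swap ` W) (partial1 (F \<circ> prod.swap) \<circ> prod.swap)"
    by (intro separately_holomorphic_on_swap separately_holomorphic_on_partial1 open_swap assms)
  moreover have "prod.swap ` prod.swap ` W = W" by (simp add: image_image)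
  ultimately show ?thesis by (simp add: comp_def)
qed

lemma separately_holomorphic_on_has_derivative:
  assumes "open W" and F: "separately_holomorphic_on W F" and "p \<in> W"
  shows "(F has_derivative (\<lambda>h. partial1 F p * fst h + partial2 F p * snd h)) (at p)"
proof -
  obtain a b where p: "p = (a, b)" by (cases p)
  obtain R where R: "R > 0" "cball a R \<times> cball b R \<subseteq> W"
    using open_C2_contains_bidisc[OF \<open>open W\<close>] \<open>p \<in> W\<close> p by blast
  let ?fy = "\<lambda>x y. blinfun_mult_right (partial2 F (x, y))"
  have "((\<lambda>(x, y). F (x, y)) has_derivative (\<lambda>(tx, ty). partial1 F p * tx + ?fy a b ty))
      (at (a, b) within ball a R \<times> ball b R)"
  proof (rule has_derivative_partialsI[where fy = ?fy])
    show "((\<lambda>x. F (x, b)) has_derivative (\<lambda>tx. partial1 F p * tx)) (at a within ball a R)"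
    proof -
      have "(\<lambda>x. F (x, b)) field_differentiable (at a)"
        using F \<open>p \<in> W\<close> unfolding p separately_holomorphic_on_def by blast
      then have "((\<lambda>x. F (x, b)) has_field_derivative partial1 F p) (at a)"
        by (simp add: p field_differentiable_derivI)
      then show ?thesis
        by (simp add: has_field_derivative_def has_derivative_at_withinI)
    qed
    show "((\<lambda>y. F (x, y)) has_derivative blinfun_apply (?fy x y)) (at y within ball b R)"
      if "x \<in> ball a R" "y \<in> ball b R" for x y
    proof -
      have "(x, y) \<in> W" using R that by auto
      then have "(\<lambda>y. F (x, y)) field_differentiable (at y)"
        using F unfolding separately_holomorphic_on_def by blast
      then have "((\<lambda>y. F (x, y)) has_field_derivative partial2 F (x, y)) (at y)"
        by (simp add: field_differentiable_derivI)
      then show ?thesis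
        by (simp add: has_field_derivative_def has_derivative_at_withinI)
    qed
    have "continuous_on W (partial2 F)"
      using separately_holomorphic_on_partial2[OF assms(1,2)]
      by (simp add: separately_holomorphic_on_def)
    then have "continuous (at p) (partial2 F)"
      using \<open>open W\<close> \<open>p \<in> W\<close> continuous_on_eq_continuous_at by blast
    then have "continuous (at p) (\<lambda>q. blinfun_mult_right (partial2 F q))"
      by (rule bounded_linear.continuous[OF bounded_linear_blinfun_mult_right])
    then have "continuous (at p) (\<lambda>(x, y). ?fy x y)" unfolding case_prod_beta' by simp
    then show "continuous (at (a, b) within ball a R \<times> ball b R) (\<lambda>(x, y). ?fy x y)"
      unfolding p by (rule continuous_at_imp_continuous_within)
  qed (use R in auto)
  moreover have "at (a, b) within ball a R \<times> ball b R = at p"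
    unfolding p using R by (intro at_within_open open_Times) auto
  ultimately have "((\<lambda>q. F (fst q, snd q)) has_derivative
      (\<lambda>h. partial1 F p * fst h + blinfun_apply (?fy a b) (snd h))) (at p)"
    unfolding case_prod_unfold by argo
  then show ?thesis by (simp add: p)
qed

text \<open>Osgood's theorem: continuous partial derivatives make \<open>F\<close> differentiable, and they belong to the same
  class of functions, so the argument can be repeated for derivatives of any order.\<close>

lemma separately_holomorphic_on_imp_smooth_on:
  assumes "open W" and F: "separately_holomorphic_on W F"
  shows "smooth_on W F"
proof -
  have "C_k_on n W F" for n
    using F
  proof (induction n arbitrary: F)
    case 0
    then show ?case by (simp add: separately_holomorphic_on_def)
  next
    case (Suc n)
    show ?case
    proof (rule C_k_on_SucI)
      show "(F has_derivative (\<lambda>h. partial1 F p * fst h + partial2 F p * snd h)) (at p)"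
        if "p \<in> W" for p
        using separately_holomorphic_on_has_derivative[OF assms(1) Suc.prems that] .
      show "C_k_on n W (\<lambda>p. partial1 F p * fst h + partial2 F p * snd h)" for h
        using separately_holomorphic_on_partial1[OF assms(1) Suc.prems]
          separately_holomorphic_on_partial2[OF assms(1) Suc.prems]
        by (intro C_k_on_add C_k_on_bounded_linear[OF bounded_linear_mult_left] Suc.IH assms)
    qed (fact assms)
  qed
  then show ?thesis by (simp add: smooth_on_def)
qed

text \<open>Riemann's theorem on removable singularities for the line \<open>b = 0\<close>. It applies directly in the second
  variable; along the line itself \<open>F\<close> is a uniform limit of its restrictions to parallel lines.\<close>

lemma separately_holomorphic_on_removable:
  assumes "open W" and cont: "continuous_on W F"
    and off: "\<And>a b. (a, b) \<in> W \<Longrightarrow> b \<noteq> 0 \<Longrightarrow> (\<lambda>x. F (x, b)) field_differentiable (at a) \<and>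
      (\<lambda>y. F (a, y)) field_differentiable (at b)"
  shows "separately_holomorphic_on W F"
proof -
  have "(\<lambda>x. F (x, 0)) field_differentiable (at a) \<and> (\<lambda>y. F (a, y)) field_differentiable (at 0)"
    if a: "(a, 0) \<in> W" for a
  proof -
    obtain R where R: "R > 0" "cball a R \<times> cball 0 R \<subseteq> W"
      using open_C2_contains_bidisc[OF \<open>open W\<close> a] .
    have "(\<lambda>y. F (a, y)) holomorphic_on ball 0 R"
    proof (rule no_isolated_singularity[where K = "{0}"])
      show "continuous_on (ball 0 R) (\<lambda>y. F (a, y))"
        using R by (intro continuous_on_compose2[OF cont] continuous_intros) auto
      have "(\<lambda>y. F (a, y)) field_differentiable (at y)" if "y \<in> ball 0 R - {0}" for y
      proof -
        have "(a, y) \<in> W" using R that by (intro subsetD[OF R(2)]) auto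
        then show ?thesis using off that by blast
      qed
      then show "(\<lambda>y. F (a, y)) holomorphic_on ball 0 R - {0}"
        by (simp add: holomorphic_on_def field_differentiable_at_within)
    qed auto
    then have 1: "(\<lambda>y. F (a, y)) field_differentiable (at 0)"
      using R by (auto intro: holomorphic_on_imp_differentiable_at)
    define e where "e n = complex_of_real (R / (real n + 2))" for n
    have ne: "norm (e n) = R / (real n + 2)" for n
      unfolding e_def norm_of_real using R by simp
    have e: "e n \<noteq> 0" "norm (e n) < R" for n
    proof -
      have "norm (e n) > 0" unfolding ne using R by simp
      then show "e n \<noteq> 0" by auto
      show "norm (e n) < R" unfolding ne using R by (simp add: field_simps add_pos_nonneg)
    qed
    have "(\<lambda>n. R / real (n + 2)) \<longlonglongrightarrow> 0"
      using LIMSEQ_ignore_initial_segment[OF lim_const_over_n[of R], of 2] by simp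
    then have "(\<lambda>n. R / (real n + 2)) \<longlonglongrightarrow> 0" by (simp add: add.commute)
    then have "e \<longlonglongrightarrow> of_real 0" unfolding e_def by (rule tendsto_of_real)
    then have e0: "e \<longlonglongrightarrow> 0" by simp
    have "uniformly_continuous_on (cball a R \<times> cball 0 R) F"
      using continuous_on_subset[OF cont R(2)]
      by (intro compact_uniformly_continuous compact_Times) auto
    have lim: "uniform_limit (ball a R) (\<lambda>n x. F (x, e n)) (\<lambda>x. F (x, 0)) sequentially"
    proof (rule uniform_limitI)
      fix \<epsilon> :: real assume "\<epsilon> > 0"
      then obtain d where d: "d > 0" "\<And>p q. p \<in> cball a R \<times> cball 0 R \<Longrightarrow> q \<in> cball a R \<times> cball 0 R
          \<Longrightarrow> dist q p < d \<Longrightarrow> dist (F q) (F p) < \<epsilon>"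
        using \<open>uniformly_continuous_on _ F\<close> unfolding uniformly_continuous_on_def by metis
      have "\<forall>\<^sub>F n in sequentially. dist (e n) 0 < d"
        using tendstoD[OF e0 d(1)] .
      then show "\<forall>\<^sub>F n in sequentially. \<forall>x\<in>ball a R. dist (F (x, e n)) (F (x, 0)) < \<epsilon>"
      proof eventually_elim
        case (elim n)
        show ?case
          using elim e(2)[of n] R by (intro ballI d(2)) (auto simp: dist_Pair_Pair less_imp_le)
      qed
    qed
    have "(\<lambda>x. F (x, 0)) holomorphic_on ball a R"
    proof (rule holomorphic_uniform_sequence)
      have "(\<lambda>x. F (x, e n)) field_differentiable (at x)" if "x \<in> ball a R" for x n
      proof -
        have "(x, e n) \<in> W" using R e(2)[of n] that by (auto dest!: subsetD[of _ W "(x, e n)"])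
        then show ?thesis using off e(1) by blast
      qed
      then show "(\<lambda>x. F (x, e n)) holomorphic_on ball a R" for n
        by (simp add: holomorphic_on_def field_differentiable_at_within)
      show "\<exists>d>0. cball x d \<subseteq> ball a R \<and>
          uniform_limit (cball x d) (\<lambda>n x. F (x, e n)) (\<lambda>x. F (x, 0)) sequentially"
        if "x \<in> ball a R" for x
        using uniform_limit_on_subset[OF lim] that by (meson open_ball open_contains_cball)
    qed auto
    then have "(\<lambda>x. F (x, 0)) field_differentiable (at a)"
      using R by (auto intro: holomorphic_on_imp_differentiable_at)
    with 1 show ?thesis by blast
  qed
  then show ?thesis
    using off cont unfolding separately_holomorphic_on_def by metis
qed

section \<open>Extension across a complex curve\<close>

text \<open>Restricting a complex linear differential to the coordinate axes gives the complex derivatives in each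
  variable.\<close>

lemma complex_linear_slices:
  assumes D: "(F has_derivative D) (at (a, b))" and lin: "\<And>k. D (times_i k) = \<i> * D k"
  shows "(\<lambda>x. F (x, b)) field_differentiable (at a) \<and> (\<lambda>y. F (a, y)) field_differentiable (at b)"
proof -
  interpret D: linear D using D has_derivative_linear by blast
  have c: "D (t, 0) = D (1, 0) * t" "D (0, t) = D (0, 1) * t" for t
  proof -
    have "(t, 0::complex) = Re t *\<^sub>R (1, 0) + Im t *\<^sub>R times_i (1, 0)"
      "(0::complex, t) = Re t *\<^sub>R (0, 1) + Im t *\<^sub>R times_i (0, 1)"
      by (auto simp: times_i_def complex_eq_iff)
    then have "D (t, 0) = Re t *\<^sub>R D (1, 0) + Im t *\<^sub>R (\<i> * D (1, 0))"
      "D (0, t) = Re t *\<^sub>R D (0, 1) + Im t *\<^sub>R (\<i> * D (0, 1))"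
      by (metis D.add D.scale lin)+
    then show "D (t, 0) = D (1, 0) * t" "D (0, t) = D (0, 1) * t"
      by (auto simp: complex_eq_iff)
  qed
  have "((\<lambda>x. (x, b)) has_derivative (\<lambda>t. (t, 0))) (at a)"
    "((\<lambda>y. (a, y)) has_derivative (\<lambda>t. (0, t))) (at b)"
    by (auto intro!: derivative_eq_intros)
  then have "((\<lambda>x. F (x, b)) has_derivative (\<lambda>t. D (t, 0))) (at a)"
    "((\<lambda>y. F (a, y)) has_derivative (\<lambda>t. D (0, t))) (at b)"
    using D has_derivative_compose by fast+
  moreover have "(\<lambda>t. D (t, 0)) = (*) (D (1, 0))" "(\<lambda>t. D (0, t)) = (*) (D (0, 1))"
    by (intro ext c)+
  ultimately show ?thesis
    unfolding field_differentiable_def has_field_derivative_def by metis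
qed

text \<open>Holomorphic coordinates for \<open>J\<close> turn \<open>J\<close> into the standard complex structure. In these coordinates,
  which exist by the inverse function theorem, \<open>h\<close> is a continuous function, holomorphic off the line
  where the second coordinate vanishes; this line is a removable singularity.\<close>

lemma holomorphic_extension_snd:
  fixes h :: "C2 \<Rightarrow> complex"
  assumes "open B" and N: "holomorphic_coords B N J" and cont: "continuous_on B h"
    and off: "\<And>z. z \<in> B \<Longrightarrow> snd (N z) \<noteq> 0 \<Longrightarrow>
      h differentiable (at z) \<and> (\<forall>k. differential h z (J z k) = \<i> * differential h z k)"
  shows "smooth_on B h \<and> (\<forall>z\<in>B. \<forall>k. differential h z (J z k) = \<i> * differential h z k)"
proof -
  have Nsm: "smooth_on B N" and inj: "\<And>z. z \<in> B \<Longrightarrow> inj (differential N z)"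
    and NJ: "\<And>z k. z \<in> B \<Longrightarrow> differential N z (J z k) = times_i (differential N z k)"
    using N by (auto simp: holomorphic_coords_def)
  define N' where "N' z = Blinfun (differential N z)" for z
  have N': "blinfun_apply (N' z) = differential N z" if "z \<in> B" for z
    using smooth_on_has_derivative[OF Nsm that] has_derivative_bounded_linear
    unfolding N'_def by (blast intro: bounded_linear_Blinfun_apply)
  have derN: "(N has_derivative blinfun_apply (N' z)) (at z)" if "z \<in> B" for z
    using smooth_on_has_derivative[OF Nsm that] N'[OF that] by simp
  have contN': "continuous_on B N'"
  proof (rule continuous_on_blinfun_componentwise)
    fix i :: C2
    have "C_k_on (Suc 0) B N" using Nsm by (simp only: smooth_on_def)
    then have "continuous_on B (\<lambda>z. differential N z i)" unfolding C_k_on.simps by blast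
    then show "continuous_on B (\<lambda>z. blinfun_apply (N' z) i)"
      by (simp add: N' cong: continuous_on_cong)
  qed
  have local: "\<exists>T. open T \<and> z0 \<in> T \<and> smooth_on T h \<and>
      (\<forall>k. differential h z0 (J z0 k) = \<i> * differential h z0 k)" if z0: "z0 \<in> B" for z0
  proof -
    obtain g where g: "linear g" "g \<circ> differential N z0 = id"
      using linear_injective_left_inverse[OF has_derivative_linear[OF smooth_on_has_derivative[OF Nsm z0]] inj[OF z0]]
      by blast
    have "Blinfun g o\<^sub>L N' z0 = id_blinfun"
      using g N'[OF z0] by (intro blinfun_eqI)
        (simp add: bounded_linear_Blinfun_apply linear_conv_bounded_linear pointfree_idE)
    then obtain T V M M' where T: "open T" "T \<subseteq> B" "z0 \<in> T" and "open V"
      and hom: "homeomorphism T V N M" and derM: "\<And>y. y \<in> V \<Longrightarrow> (M has_derivative M' y) (at y)"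
      and M': "\<And>y. y \<in> V \<Longrightarrow> M' y = inv (blinfun_apply (N' (M y)))"
      using inverse_function_theorem[OF \<open>open B\<close> derN contN' z0, of "Blinfun g"] by metis
    have MN: "M (N z) = z" "N z \<in> V" if "z \<in> T" for z
      using hom that by (auto simp: homeomorphism_def)
    have NM: "N (M y) = y" "M y \<in> T" if "y \<in> V" for y
      using hom that by (auto simp: homeomorphism_def)
    (* F is the function h written in the holomorphic coordinates. *)
    define F where "F = h \<circ> M"
    have "continuous_on V F"
      unfolding F_def using hom T continuous_on_subset[OF cont]
      by (intro continuous_on_compose) (auto simp: homeomorphism_def)
    then have sep: "separately_holomorphic_on V F"
    proof (rule separately_holomorphic_on_removable[OF \<open>open V\<close>])
      fix a b assume ab: "(a, b) \<in> V" "b \<noteq> (0::complex)"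
      let ?z = "M (a, b)"
      have zB: "?z \<in> B" using NM ab T by blast
      have off': "h differentiable (at ?z)" "\<And>k. differential h ?z (J ?z k) = \<i> * differential h ?z k"
        using off[OF zB] NM(1) ab by auto
      have bij: "M' (a, b) (differential N ?z k) = k" for k
        using M'[OF ab(1)] N'[OF zB] inj[OF zB] by simp
      have surj: "\<exists>k'. k = differential N ?z k'" for k
        using linear_injective_imp_surjective[OF has_derivative_linear[OF smooth_on_has_derivative[OF Nsm zB]] inj[OF zB]]
        unfolding surj_def by blast
      have "(F has_derivative (\<lambda>k. differential h ?z (M' (a, b) k))) (at (a, b))"
        unfolding F_def comp_def
        using has_derivative_compose[OF derM[OF ab(1)]] off'(1) by (simp add: frechet_derivative_works)
      moreover have "differential h ?z (M' (a, b) (times_i k)) = \<i> * differential h ?z (M' (a, b) k)" for k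
      proof -
        obtain k' where "k = differential N ?z k'" using surj by blast
        then show ?thesis
          using NJ[OF zB, of k'] bij[of k'] bij[of "J ?z k'"] off'(2) by simp
      qed
      ultimately show "(\<lambda>x. F (x, b)) field_differentiable (at a) \<and> (\<lambda>y. F (a, y)) field_differentiable (at b)"
        by (rule complex_linear_slices)
    qed
    have hF: "h z = F (N z)" if "z \<in> T" for z
      using MN(1)[OF that] by (simp add: F_def)
    have "smooth_on T (\<lambda>z. F (N z))"
      using smooth_on_compose[OF T(1) \<open>open V\<close> _ separately_holomorphic_on_imp_smooth_on[OF \<open>open V\<close> sep]
          smooth_on_subset[OF Nsm T(2)]] MN(2) by blast
    then have sm: "smooth_on T h"
      using smooth_on_cong[OF T(1)] hF by metis
    have "((\<lambda>z. F (N z)) has_derivative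
        (\<lambda>k. partial1 F (N z0) * fst (differential N z0 k) + partial2 F (N z0) * snd (differential N z0 k))) (at z0)"
      using has_derivative_compose[OF smooth_on_has_derivative[OF Nsm z0]
          separately_holomorphic_on_has_derivative[OF \<open>open V\<close> sep MN(2)[OF T(3)]]] .
    then have "(h has_derivative
        (\<lambda>k. partial1 F (N z0) * fst (differential N z0 k) + partial2 F (N z0) * snd (differential N z0 k))) (at z0)"
      by (rule has_derivative_transform_within_open[OF _ T(1,3)]) (simp add: hF)
    then have "differential h z0 =
        (\<lambda>k. partial1 F (N z0) * fst (differential N z0 k) + partial2 F (N z0) * snd (differential N z0 k))"
      by (rule frechet_derivative_at[symmetric])
    then have "differential h z0 (J z0 k) = \<i> * differential h z0 k" for k
      by (simp add: NJ[OF z0] times_i_def algebra_simps)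
    with T sm show ?thesis by blast
  qed
  then have "smooth_on B h" by (intro smooth_on_local) blast
  with local show ?thesis by blast
qed

lemma holomorphic_extension_fst:
  fixes h :: "C2 \<Rightarrow> complex"
  assumes "open B" and N: "holomorphic_coords B N J" and cont: "continuous_on B h"
    and off: "\<And>z. z \<in> B \<Longrightarrow> fst (N z) \<noteq> 0 \<Longrightarrow>
      h differentiable (at z) \<and> (\<forall>k. differential h z (J z k) = \<i> * differential h z k)"
  shows "smooth_on B h \<and> (\<forall>z\<in>B. \<forall>k. differential h z (J z k) = \<i> * differential h z k)"
proof (rule holomorphic_extension_snd[where N = "\<lambda>z. prod.swap (N z)", OF \<open>open B\<close> _ cont])
  have swap: "bounded_linear (prod.swap :: C2 \<Rightarrow> C2)"
    unfolding prod.swap_def by (intro bounded_linear_Pair bounded_linear_fst bounded_linear_snd)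
  have d: "differential (\<lambda>z. prod.swap (N z)) z = (\<lambda>k. prod.swap (differential N z k))" if "z \<in> B" for z
  proof -
    have "((\<lambda>z. prod.swap (N z)) has_derivative (\<lambda>k. prod.swap (differential N z k))) (at z)"
      using N that by (intro bounded_linear.has_derivative[OF swap] smooth_on_has_derivative)
        (auto simp: holomorphic_coords_def)
    then show ?thesis using frechet_derivative_at by metis
  qed
  show "holomorphic_coords B (\<lambda>z. prod.swap (N z)) J"
    unfolding holomorphic_coords_def
  proof (intro conjI ballI allI)
    show "smooth_on B (\<lambda>z. prod.swap (N z))"
      using N \<open>open B\<close> by (auto simp: holomorphic_coords_def intro: smooth_on_bounded_linear[OF swap])
    fix z assume "z \<in> B"
    then show "inj (differential (\<lambda>z. prod.swap (N z)) z)"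
      using N unfolding holomorphic_coords_def d[OF \<open>z \<in> B\<close>] inj_def by (metis swap_swap)
    show "differential (\<lambda>z. prod.swap (N z)) z (J z k)
        = times_i (differential (\<lambda>z. prod.swap (N z)) z k)" for k
    proof -
      have "differential N z (J z k) = times_i (differential N z k)"
        using N \<open>z \<in> B\<close> unfolding holomorphic_coords_def by blast
      then show ?thesis unfolding d[OF \<open>z \<in> B\<close>] by (simp add: times_i_def)
    qed
  qed
qed (use off in auto)

section \<open>Polygons cut out by their edge functions\<close>

definition grad :: "model \<Rightarrow> plane set \<Rightarrow> plane" where
  "grad M E = (SOME a. \<exists>b. \<forall>x. EdgeFun M E x = a \<bullet> x + b)"

definition edges_at :: "model \<Rightarrow> plane \<Rightarrow> plane set set" where
  "edges_at M p = {E. E edge_of Poly M \<and> p \<in> E}"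

text \<open>Multiplicativity of the determinant (the Cauchy--Binet identity), which relates the orientation of two
  directions to that of two linear functionals.\<close>

lemma det2_mult_det2:
  "det2 x y * det2 a b = (a \<bullet> x) * (b \<bullet> y) - (a \<bullet> y) * (b \<bullet> x)" for x y a b :: plane
  by (simp add: det2_def inner_prod_def algebra_simps)

text \<open>The linear dependence of three vectors in the plane, paired with a fourth vector.\<close>

lemma det2_three_term:
  "(a \<bullet> x) * det2 b c + (b \<bullet> x) * det2 c a + (c \<bullet> x) * det2 a b = 0" for a b c x :: plane
  by (simp add: det2_def inner_prod_def algebra_simps)

lemma det2_swap: "det2 b a = - det2 a b" for a b :: "'a::comm_ring \<times> 'a"
  by (simp add: det2_def algebra_simps)

locale quasitoric =
  fixes M :: model
  assumes prim: "primitive_model M" and pos: "positively_omnioriented M"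
begin

abbreviation "P \<equiv> Poly M"

lemma polytope_P: "polytope P" and aff_dim_P: "aff_dim P = 2"
  using prim by (auto simp: primitive_model_def)

lemma convex_P: "convex P" and closed_P: "closed P"
  using polytope_P polytope_imp_convex polytope_imp_closed by auto

lemma finite_edges: "finite {E. E edge_of P}"
  using finite_polytope_faces[OF polytope_P] by (rule finite_subset[rotated]) (auto simp: edge_of_def)

lemma finite_edges_at: "finite (edges_at M p)"
  using finite_edges by (rule finite_subset[rotated]) (auto simp: edges_at_def)

lemma edge_iff_facet: "E edge_of P \<longleftrightarrow> E facet_of P"
  by (auto simp: edge_of_def facet_of_def aff_dim_P)

lemma edge_subset: "E edge_of P \<Longrightarrow> E \<subseteq> P"
  by (rule edge_of_imp_subset)

lemma rel_interior_P: "rel_interior P = interior P"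
  using aff_dim_P by (intro rel_interior_interior) (simp add: aff_dim_eq_full flip: aff_dim_eq_full)

lemma interior_P_nonempty: "interior P \<noteq> {}"
  using rel_interior_eq_empty[OF convex_P] aff_dim_P rel_interior_P by auto

lemma Union_edges: "\<Union>{E. E edge_of P} = P - interior P"
  using rel_boundary_of_polyhedron[OF polytope_imp_polyhedron[OF polytope_P]]
  by (simp add: edge_iff_facet rel_interior_P)

lemma EdgeFun_grad:
  assumes "E edge_of P"
  shows "EdgeFun M E x = EdgeFun M E y + grad M E \<bullet> (x - y)"
proof -
  have "\<exists>a b. \<forall>x. EdgeFun M E x = a \<bullet> x + b"
    using prim assms by (auto simp: primitive_model_def)
  then have "\<exists>b. \<forall>x. EdgeFun M E x = grad M E \<bullet> x + b"
    unfolding grad_def by (rule someI_ex)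
  then obtain b where b: "\<And>x. EdgeFun M E x = grad M E \<bullet> x + b" by blast
  show ?thesis using b[of x] b[of y] by (simp add: inner_diff_right)
qed

lemma EdgeFun_convex_combination:
  assumes "E edge_of P"
  shows "EdgeFun M E ((1 - u) *\<^sub>R x + u *\<^sub>R y) = (1 - u) * EdgeFun M E x + u * EdgeFun M E y"
proof -
  have "(1 - u) *\<^sub>R x + u *\<^sub>R y - x = u *\<^sub>R (y - x)" by (simp add: algebra_simps)
  then show ?thesis
    using EdgeFun_grad[OF assms, of "(1 - u) *\<^sub>R x + u *\<^sub>R y" x] EdgeFun_grad[OF assms, of y x]
    by (simp only: inner_scaleR_right) (simp add: algebra_simps)
qed

lemma continuous_on_EdgeFun: "E edge_of P \<Longrightarrow> continuous_on S (EdgeFun M E)"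
proof -
  assume "E edge_of P"
  have "continuous_on S (\<lambda>x. EdgeFun M E 0 + grad M E \<bullet> x)" by (intro continuous_intros)
  then show ?thesis
  proof (rule continuous_on_eq)
    show "EdgeFun M E 0 + grad M E \<bullet> x = EdgeFun M E x" for x
      using EdgeFun_grad[OF \<open>E edge_of P\<close>, of x 0] by simp
  qed
qed

lemma EdgeFun_interior: "E edge_of P \<Longrightarrow> x \<in> interior P \<Longrightarrow> EdgeFun M E x > 0"
  and EdgeFun_edge: "E edge_of P \<Longrightarrow> x \<in> E \<Longrightarrow> EdgeFun M E x = 0"
  using prim by (auto simp: primitive_model_def)

lemma EdgeFun_nonneg:
  assumes "E edge_of P" "x \<in> P"
  shows "EdgeFun M E x \<ge> 0"
proof -
  have "x \<in> closure (interior P)"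
    using convex_closure_interior[OF convex_P interior_P_nonempty] assms(2) closure_subset by blast
  moreover have "\<And>y. y \<in> interior P \<Longrightarrow> 0 \<le> EdgeFun M E y"
    using EdgeFun_interior[OF assms(1)] less_imp_le by blast
  ultimately show ?thesis
    using continuous_ge_on_closure[OF continuous_on_EdgeFun[OF assms(1)]] by blast
qed

text \<open>A point outside \<open>P\<close> is separated from an interior point by the edge through which the segment
  between them leaves \<open>P\<close>.\<close>

lemma P_iff: "x \<in> P \<longleftrightarrow> (\<forall>E. E edge_of P \<longrightarrow> EdgeFun M E x \<ge> 0)"
proof
  assume nonneg: "\<forall>E. E edge_of P \<longrightarrow> EdgeFun M E x \<ge> 0"
  show "x \<in> P"
  proof (rule ccontr)
    assume "x \<notin> P"
    obtain c where c: "c \<in> interior P" using interior_P_nonempty by blast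
    then have "closed_segment c x \<inter> frontier P \<noteq> {}"
      using \<open>x \<notin> P\<close> interior_subset by (intro connected_Int_frontier) auto
    then obtain u where u: "0 \<le> u" "u \<le> 1" and fr: "(1 - u) *\<^sub>R c + u *\<^sub>R x \<in> frontier P"
      by (auto simp: in_segment)
    then have "(1 - u) *\<^sub>R c + u *\<^sub>R x \<in> \<Union>{E. E edge_of P}"
      using Union_edges closed_P by (simp add: frontier_def)
    then obtain E where E: "E edge_of P" "(1 - u) *\<^sub>R c + u *\<^sub>R x \<in> E" by blast
    then have "(1 - u) * EdgeFun M E c + u * EdgeFun M E x = 0"
      using EdgeFun_edge EdgeFun_convex_combination by metis
    moreover have "EdgeFun M E c > 0" "EdgeFun M E x \<ge> 0" using E c nonneg EdgeFun_interior by auto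
    ultimately have "u = 1"
      using u by (smt (verit) mult_nonneg_nonneg mult_pos_pos)
    then show False using E \<open>x \<notin> P\<close> edge_subset by auto
  qed
qed (auto intro: EdgeFun_nonneg)

text \<open>The zero set of the edge function on \<open>P\<close> is a proper face containing \<open>E\<close>, and hence has no room for
  more than \<open>E\<close> by dimension.\<close>

lemma edge_iff:
  assumes E: "E edge_of P"
  shows "x \<in> E \<longleftrightarrow> x \<in> P \<and> EdgeFun M E x = 0"
proof -
  define F where "F = P \<inter> {x. grad M E \<bullet> x = - EdgeFun M E 0}"
  have F: "x \<in> F \<longleftrightarrow> x \<in> P \<and> EdgeFun M E x = 0" for x
    using EdgeFun_grad[OF E, of x 0] by (auto simp: F_def)
  have "F face_of P"
    unfolding F_def
  proof (rule face_of_Int_supporting_hyperplane_ge[OF convex_P])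
    show "- EdgeFun M E 0 \<le> grad M E \<bullet> x" if "x \<in> P" for x
      using EdgeFun_grad[OF E, of x 0] EdgeFun_nonneg[OF E that] by simp
  qed
  have "E \<subseteq> F" using F edge_subset[OF E] EdgeFun_edge[OF E] by blast
  then have "E face_of F"
    using E \<open>F face_of P\<close> face_of_imp_subset[of F P] by (auto simp: edge_of_def intro: face_of_subset)
  have "F \<noteq> P"
    using interior_P_nonempty EdgeFun_interior[OF E] F interior_subset by (metis ex_in_conv less_irrefl subsetD)
  then have "aff_dim F < 2"
    using face_of_aff_dim_lt[OF convex_P \<open>F face_of P\<close>] aff_dim_P by simp
  moreover have "aff_dim E = 1" using E by (simp add: edge_of_def)
  moreover have "convex F" using \<open>F face_of P\<close> face_of_imp_convex by blast
  ultimately have "E = F"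
    using face_of_aff_dim_lt[OF \<open>convex F\<close> \<open>E face_of F\<close>] by fastforce
  then show ?thesis using F by simp
qed

lemma interior_iff: "x \<in> interior P \<longleftrightarrow> x \<in> P \<and> edges_at M x = {}"
  using Union_edges interior_subset by (auto simp: edges_at_def)

lemma edges_subset_eq: "E edge_of P \<Longrightarrow> E' edge_of P \<Longrightarrow> E \<subseteq> E' \<Longrightarrow> E = E'"
proof (rule ccontr)
  assume "E edge_of P" "E' edge_of P" "E \<subseteq> E'" "E \<noteq> E'"
  then have "aff_dim E < aff_dim E'"
    by (meson edge_of_def edge_subset face_of_aff_dim_lt face_of_imp_convex face_of_subset)
  with \<open>E edge_of P\<close> \<open>E' edge_of P\<close> show False by (simp add: edge_of_def)
qed

lemma edges_meet_once:
  assumes E: "E edge_of P" and E': "E' edge_of P" and "E \<noteq> E'" "x \<in> E \<inter> E'" "y \<in> E \<inter> E'"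
  shows "x = y"
proof -
  have "E \<inter> E' face_of E"
    using E E' face_of_Int face_of_subset[of "E \<inter> E'" P E] edge_subset[OF E] by (auto simp: edge_of_def)
  moreover have "E \<inter> E' \<noteq> E" using edges_subset_eq[OF E E'] \<open>E \<noteq> E'\<close> by blast
  moreover have "convex E" using E by (auto simp: edge_of_def face_of_imp_convex)
  ultimately have "aff_dim (E \<inter> E') < 1"
    using face_of_aff_dim_lt[of E "E \<inter> E'"] E by (simp add: edge_of_def)
  moreover have "aff_dim {x, y} \<le> aff_dim (E \<inter> E')"
    by (rule aff_dim_subset) (use assms in auto)
  ultimately show ?thesis by (simp add: aff_dim_2 split: if_splits)
qed

subsection \<open>The two edges at a vertex\<close>

lemma edge_other_point: 
  assumes "E edge_of P"
  obtains x where "x \<in> E" "x \<noteq> v"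
proof -
  have "aff_dim E = 1" using assms by (simp add: edge_of_def)
  then have "\<not> E \<subseteq> {v}" using aff_dim_subset[of E "{v}"] by auto
  then show ?thesis using that by blast
qed

lemma edges_at_other_point: "E \<in> edges_at M v \<Longrightarrow> \<exists>x. x \<in> E - {v}"
  using edge_other_point[of E v] unfolding edges_at_def by blast

lemma EdgeFun_other_edge_pos:
  assumes "E \<in> edges_at M v" "E' \<in> edges_at M v" "E \<noteq> E'" "x \<in> E" "x \<noteq> v"
  shows "EdgeFun M E' x > 0"
proof (rule ccontr)
  assume "\<not> EdgeFun M E' x > 0"
  moreover have E: "E edge_of P" "E' edge_of P" using assms by (auto simp: edges_at_def)
  moreover have "x \<in> P" using edge_subset[OF E(1)] assms(4) by blast
  ultimately have "x \<in> E'"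
    using EdgeFun_nonneg[OF E(2) \<open>x \<in> P\<close>] edge_iff[OF E(2), of x] by linarith
  then show False using edges_meet_once[of E E' x v] assms by (auto simp: edges_at_def)
qed

lemma EdgeFun_at: "E \<in> edges_at M v \<Longrightarrow> EdgeFun M E x = grad M E \<bullet> (x - v)"
  using EdgeFun_grad[of E x v] EdgeFun_edge[of E v] by (simp add: edges_at_def)

text \<open>Each of the two functionals vanishes on its own edge and is positive along the other one. Hence the
  orientation of the pair of edges, for any choice of points on them, is opposite to that of the
  gradients.\<close>

lemma det_edges_grads:
  assumes AB: "A \<in> edges_at M v" "B \<in> edges_at M v" "A \<noteq> B" and "x \<in> A - {v}" "y \<in> B - {v}"
  shows "det2 (x - v) (y - v) * det2 (grad M A) (grad M B) < 0"
proof -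
  have "grad M A \<bullet> (x - v) = 0"
    using assms EdgeFun_edge[of A x] EdgeFun_at[OF AB(1), of x] by (simp add: edges_at_def)
  moreover have "grad M A \<bullet> (y - v) > 0" "grad M B \<bullet> (x - v) > 0"
    using EdgeFun_other_edge_pos[of B v A y] EdgeFun_other_edge_pos[of A v B x] assms
      EdgeFun_at[OF AB(1), of y] EdgeFun_at[OF AB(2), of x] by auto
  ultimately show ?thesis by (simp add: det2_mult_det2)
qed

lemma clockwise_at_iff:
  assumes AB: "A \<in> edges_at M v" "B \<in> edges_at M v" "A \<noteq> B"
  shows "clockwise_at P v A B \<longleftrightarrow> det2 (grad M A) (grad M B) > 0"
proof -
  obtain x y where xy: "x \<in> A - {v}" "y \<in> B - {v}"
    using edges_at_other_point[OF AB(1)] edges_at_other_point[OF AB(2)] by blast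
  have "A edge_of P" "B edge_of P" "v \<in> A" "v \<in> B" using AB by (auto simp: edges_at_def)
  then have "clockwise_at P v A B \<longleftrightarrow> (\<forall>x\<in>A - {v}. \<forall>y\<in>B - {v}. det2 (x - v) (y - v) < 0)"
    by (simp add: clockwise_at_def)
  also have "\<dots> \<longleftrightarrow> det2 (grad M A) (grad M B) > 0"
  proof
    assume "\<forall>x\<in>A - {v}. \<forall>y\<in>B - {v}. det2 (x - v) (y - v) < 0"
    then have "det2 (x - v) (y - v) < 0" using xy by blast
    then show "det2 (grad M A) (grad M B) > 0"
      using det_edges_grads[OF AB xy] by (simp add: mult_less_0_iff)
  next
    assume g: "det2 (grad M A) (grad M B) > 0"
    show "\<forall>x\<in>A - {v}. \<forall>y\<in>B - {v}. det2 (x - v) (y - v) < 0"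
    proof (intro ballI)
      fix x y assume "x \<in> A - {v}" "y \<in> B - {v}"
      from det_edges_grads[OF AB this] g show "det2 (x - v) (y - v) < 0"
        by (simp add: mult_less_0_iff)
    qed
  qed
  finally show ?thesis .
qed

lemma det_grads_nonzero:
  assumes AB: "A \<in> edges_at M v" "B \<in> edges_at M v" "A \<noteq> B"
  shows "det2 (grad M A) (grad M B) \<noteq> 0"
proof -
  obtain x y where xy: "x \<in> A - {v}" "y \<in> B - {v}"
    using edges_at_other_point[OF AB(1)] edges_at_other_point[OF AB(2)] by blast
  from det_edges_grads[OF AB this] show ?thesis by auto
qed

text \<open>The three-term identity at a point of each of the edges forces any two of the determinants
  \<open>det(A, B)\<close>, \<open>det(B, C)\<close>, \<open>det(C, A)\<close> of the gradients to have opposite signs, which is impossible for three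
  of them.\<close>

lemma at_most_two_edges:
  assumes "A \<in> edges_at M v" "B \<in> edges_at M v" "C \<in> edges_at M v" "A \<noteq> B" "B \<noteq> C" "A \<noteq> C"
  shows False
proof -
  let ?p = "det2 (grad M A) (grad M B)" and ?q = "det2 (grad M B) (grad M C)"
    and ?r = "det2 (grad M C) (grad M A)"
  obtain x y z where xyz: "x \<in> A - {v}" "y \<in> B - {v}" "z \<in> C - {v}"
    using assms(1-3)[THEN edges_at_other_point] by blast
  have "grad M E \<bullet> (p - v) = 0" if "E \<in> edges_at M v" "p \<in> E" for E p
    using EdgeFun_at[OF that(1), of p] EdgeFun_edge[of E p] that by (simp add: edges_at_def)
  then have zero: "grad M A \<bullet> (x - v) = 0" "grad M B \<bullet> (y - v) = 0" "grad M C \<bullet> (z - v) = 0"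
    using xyz assms by auto
  have pos: "grad M A \<bullet> (y - v) > 0" "grad M A \<bullet> (z - v) > 0" "grad M B \<bullet> (x - v) > 0"
    "grad M B \<bullet> (z - v) > 0" "grad M C \<bullet> (x - v) > 0" "grad M C \<bullet> (y - v) > 0"
    using EdgeFun_other_edge_pos[of _ v] xyz assms by (auto simp flip: EdgeFun_at)
  have rel: "(grad M B \<bullet> (x - v)) * ?r = - ((grad M C \<bullet> (x - v)) * ?p)"
    "(grad M A \<bullet> (y - v)) * ?q = - ((grad M C \<bullet> (y - v)) * ?p)"
    "(grad M A \<bullet> (z - v)) * ?q = - ((grad M B \<bullet> (z - v)) * ?r)"
    using det2_three_term[of "grad M A" "x - v" "grad M B" "grad M C"]
      det2_three_term[of "grad M A" "y - v" "grad M B" "grad M C"]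
      det2_three_term[of "grad M A" "z - v" "grad M B" "grad M C"] zero by simp_all
  have opp: "q < 0 \<longleftrightarrow> p > 0" "q > 0 \<longleftrightarrow> p < 0"
    if "a * q = - (b * p)" "a > 0" "b > 0" for a b p q :: real
  proof -
    define c where "c = b / a"
    have "q = - (c * p)" using that by (simp add: c_def field_simps)
    moreover have "c > 0" using that by (simp add: c_def)
    ultimately show "q < 0 \<longleftrightarrow> p > 0" "q > 0 \<longleftrightarrow> p < 0"
      by (simp_all add: mult_less_0_iff zero_less_mult_iff)
  qed
  have "?p \<noteq> 0" by (rule det_grads_nonzero[OF assms(1,2,4)])
  then show False
    using opp[OF rel(1) pos(3,5)] opp[OF rel(2) pos(1,6)] opp[OF rel(3) pos(2,4)] by linarith
qed

lemma edges_at_two: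
  assumes "A \<in> edges_at M v" "B \<in> edges_at M v" "A \<noteq> B"
  shows "edges_at M v = {A, B}"
  using at_most_two_edges[of A v B] assms by blast

text \<open>A vertex is the intersection of the edges through it, and a single edge is not a point.\<close>

lemma vertex_two_edges:
  assumes "v \<in> vertices P"
  obtains A B where "A \<in> edges_at M v" "B \<in> edges_at M v" "A \<noteq> B"
proof -
  have "{v} face_of P" using assms by (simp add: vertices_def face_of_singleton)
  moreover have "{v} \<noteq> P" using aff_dim_P by (metis aff_dim_sing zero_neq_numeral)
  ultimately have "{v} = \<Inter>{F. F facet_of P \<and> {v} \<subseteq> F}"
    using polytope_imp_polyhedron[OF polytope_P] by (intro face_of_polyhedron) auto
  then have v: "{v} = \<Inter>(edges_at M v)" by (simp add: edges_at_def edge_iff_facet)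
  have "edges_at M v \<noteq> {}"
  proof
    assume "edges_at M v = {}"
    with v have "{v} = (UNIV :: plane set)" by simp
    then have "v + (1, 0) \<in> {v}" by blast
    then show False by (simp add: prod_eq_iff)
  qed
  then obtain A where A: "A \<in> edges_at M v" by blast
  obtain x where "x \<in> A" "x \<noteq> v" using edge_other_point A unfolding edges_at_def by blast
  then have "\<exists>B\<in>edges_at M v. x \<notin> B" using v by blast
  then show ?thesis using that A \<open>x \<in> A\<close> by blast
qed

lemma vertex_edges:
  assumes v: "v \<in> vertices P"
  shows "edges_at M v = {edge1 P v, edge2 P v}" "edge1 P v \<noteq> edge2 P v"
    "det2 (Char M (edge1 P v)) (Char M (edge2 P v)) > 0"
proof -
  obtain A B where AB: "A \<in> edges_at M v" "B \<in> edges_at M v" "A \<noteq> B" "det2 (grad M A) (grad M B) > 0"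
  proof -
    obtain A B where AB: "A \<in> edges_at M v" "B \<in> edges_at M v" "A \<noteq> B"
      using vertex_two_edges[OF v] .
    show ?thesis
    proof (cases "det2 (grad M A) (grad M B) > 0")
      case True
      then show ?thesis by (rule that[OF AB])
    next
      case False
      then have "det2 (grad M B) (grad M A) > 0"
        using det_grads_nonzero[OF AB] det2_swap[of "grad M B" "grad M A"] by linarith
      then show ?thesis by (rule that[OF AB(2,1) AB(3)[symmetric]])
    qed
  qed
  have two: "edges_at M v = {A, B}" by (rule edges_at_two[OF AB(1-3)])
  have cw: "clockwise_at P v A B" "\<not> clockwise_at P v B A"
    using clockwise_at_iff[OF AB(1-3)] clockwise_at_iff[of B v A] AB det2_swap[of "grad M A" "grad M B"] by auto
  have iff: "clockwise_at P v E E' \<longleftrightarrow> E = A \<and> E' = B" for E E'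
  proof
    assume *: "clockwise_at P v E E'"
    then have "E \<in> edges_at M v" "E' \<in> edges_at M v"
      unfolding clockwise_at_def edges_at_def by blast+
    then have "E \<in> {A, B}" "E' \<in> {A, B}" by (simp_all only: two)
    moreover have "E \<noteq> E'"
    proof
      assume "E = E'"
      obtain x where "x \<in> E" "x \<noteq> v"
        using edge_other_point * unfolding clockwise_at_def by blast
      then have "det2 (x - v) (x - v) < 0"
        using * \<open>E = E'\<close> unfolding clockwise_at_def by blast
      then show False by (simp add: det2_def)
    qed
    ultimately show "E = A \<and> E' = B" using * cw by auto
  qed (use cw in auto)
  have "edge1 P v = A" "edge2 P v = B" unfolding edge1_def edge2_def iff by auto
  then show "edges_at M v = {edge1 P v, edge2 P v}" "edge1 P v \<noteq> edge2 P v"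
    using two AB(3) by auto
  show "det2 (Char M (edge1 P v)) (Char M (edge2 P v)) > 0"
    using pos v unfolding positively_omnioriented_def by blast
qed

text \<open>The signs in the omniorientation tell the two edges at a vertex apart.\<close>

lemma edge12_eqI:
  assumes "v \<in> vertices P" "A \<in> edges_at M v" "B \<in> edges_at M v" "det2 (Char M A) (Char M B) > 0"
  shows "edge1 P v = A" "edge2 P v = B"
proof -
  have "A \<noteq> B" using assms(4) by (auto simp: det2_def)
  moreover have "\<not> (edge1 P v = B \<and> edge2 P v = A)"
    using vertex_edges(3)[OF assms(1)] assms(4) det2_swap[of "Char M B" "Char M A"] by auto
  ultimately show "edge1 P v = A" "edge2 P v = B"
    using vertex_edges(1)[OF assms(1)] assms(2,3) by auto
qed

lemma vertexI:
  assumes "A \<in> edges_at M v" "B \<in> edges_at M v" "A \<noteq> B"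
  shows "v \<in> vertices P"
proof -
  have "A \<inter> B = {v}" using edges_meet_once[of A B _ v] assms unfolding edges_at_def by blast
  moreover have "A \<inter> B face_of P" using assms by (auto simp: edges_at_def edge_of_def intro: face_of_Int)
  ultimately show ?thesis by (simp add: vertices_def face_of_singleton)
qed

lemma U_vertex_iff:
  assumes "v \<in> P"
  shows "p \<in> U_vertex P v \<longleftrightarrow> p \<in> P \<and> edges_at M p \<subseteq> edges_at M v"
  unfolding U_vertex_def edges_at_def by auto

subsection \<open>Stabilisers\<close>

text \<open>A minimal face containing \<open>p\<close> has \<open>p\<close> in its relative interior, because the relative boundary of a
  polytope is covered by its facets.\<close>

lemma face_at:
  assumes "p \<in> P"
  shows "face_at P p face_of P" "p \<in> rel_interior (face_at P p)"
proof -
  have "\<exists>F. F face_of P \<and> p \<in> rel_interior F"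
  proof -
    let ?\<F> = "{F. F face_of P \<and> p \<in> F}"
    have "finite ?\<F>"
      by (rule finite_subset[OF _ finite_polytope_faces[OF polytope_P]]) blast
    moreover have "P \<in> ?\<F>"
      using assms face_of_refl[OF convex_P] by blast
    ultimately have "\<exists>F\<in>?\<F>. F \<subseteq> P \<and> (\<forall>G\<in>?\<F>. G \<subseteq> F \<longrightarrow> F = G)"
      by (rule finite_has_minimal2)
    then obtain F where F: "F \<in> ?\<F>" "\<forall>G\<in>?\<F>. G \<subseteq> F \<longrightarrow> F = G"
      by (elim bexE conjE)
    have "p \<in> rel_interior F"
    proof (rule ccontr)
      assume "p \<notin> rel_interior F"
      moreover have "polyhedron F"
        using F(1) polytope_P face_of_polytope_polytope polytope_imp_polyhedron by blast
      ultimately obtain G where "G facet_of F" "p \<in> G"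
        using rel_boundary_of_polyhedron[of F] F(1) by blast
      then have "G \<in> ?\<F>" "G \<subseteq> F" "G \<noteq> F"
        using F(1) by (auto intro: face_of_trans dest: facet_of_imp_face_of facet_of_imp_subset)
      then show False using F(2)[THEN bspec, of G] by simp
    qed
    then show ?thesis using F(1) by blast
  qed
  then obtain F where F: "F face_of P \<and> p \<in> rel_interior F" ..
  have "G = F" if "G face_of P \<and> p \<in> rel_interior G" for G
    using face_of_eq[of G P F] that F by (metis IntI empty_iff)
  then have "face_at P p = F" unfolding face_at_def using F by (intro the_equality)
  with F show "face_at P p face_of P" "p \<in> rel_interior (face_at P p)" by auto
qed

lemma edges_containing_face_at:
  assumes "p \<in> P"
  shows "{E. E edge_of P \<and> face_at P p \<subseteq> E} = edges_at M p"
proof -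
  have "face_at P p \<subseteq> E \<longleftrightarrow> p \<in> E" if "E edge_of P" for E
  proof
    show "p \<in> E" if "face_at P p \<subseteq> E"
      using face_at(2)[OF assms] rel_interior_subset that by blast
    show "face_at P p \<subseteq> E" if "p \<in> E"
      using face_at[OF assms] \<open>E edge_of P\<close> that
      by (intro subset_of_face_of[of E P]) (auto simp: edge_of_def face_of_imp_subset)
  qed
  then show ?thesis by (auto simp: edges_at_def)
qed

end

text \<open>The Lie algebra of the isotropy group \<open>T(N(F(p)))\<close>, described by edges through \<open>p\<close> instead of the face
  \<open>F(p)\<close>.\<close>

definition stab :: "model \<Rightarrow> plane \<Rightarrow> plane set" where
  "stab M p = span (lat ` Char M ` edges_at M p)"

lemma lat_add: "lat (x + y) = lat x + lat y" and lat_0: "lat 0 = 0"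
  by (auto simp: lat_def zero_prod_def)

lemma lat_sum: "lat (\<Sum>i\<in>I. f i) = (\<Sum>i\<in>I. lat (f i))"
  by (induction I rule: infinite_finite_induct) (auto simp: lat_add lat_0)

lemma lat_scale: "lat (c * a, c * b) = of_int c *\<^sub>R lat (a, b)"
  by (simp add: lat_def)

lemma (in quasitoric) span_N_face:
  assumes "p \<in> P"
  shows "span (lat ` N_face M (face_at P p)) = stab M p"
proof
  note * = N_face_def[of M "face_at P p", unfolded edges_containing_face_at[OF assms]]
  show "span (lat ` N_face M (face_at P p)) \<subseteq> stab M p"
    unfolding stab_def
  proof (rule span_minimal)
    show "lat ` N_face M (face_at P p) \<subseteq> span (lat ` Char M ` edges_at M p)"
    proof
      fix x assume "x \<in> lat ` N_face M (face_at P p)"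
      then obtain c where "x = (\<Sum>E\<in>edges_at M p. of_int (c E) *\<^sub>R lat (Char M E))"
        unfolding * by (auto simp: lat_sum lat_scale simp del: split_paired_All)
      then show "x \<in> span (lat ` Char M ` edges_at M p)"
        by (auto intro!: span_sum span_scale intro: span_base)
    qed
  qed auto
  show "stab M p \<subseteq> span (lat ` N_face M (face_at P p))"
    unfolding stab_def
  proof (rule span_mono, rule subsetI)
    fix x assume "x \<in> lat ` Char M ` edges_at M p"
    then obtain E where E: "E \<in> edges_at M p" and x: "x = lat (Char M E)" by blast
    let ?c = "\<lambda>E'. if E' = E then 1 else 0"
    have "(\<Sum>E'\<in>edges_at M p. (?c E' * fst (Char M E'), ?c E' * snd (Char M E')))
        = (\<Sum>E'\<in>edges_at M p. if E' = E then Char M E' else 0)"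
      by (intro sum.cong) (auto simp: zero_prod_def)
    also have "\<dots> = Char M E" using E finite_edges_at by simp
    finally have "Char M E \<in> N_face M (face_at P p)" unfolding * by (auto intro!: exI[of _ ?c])
    then show "x \<in> lat ` N_face M (face_at P p)" unfolding x by blast
  qed
qed

lemma (in quasitoric) N_face_vertex:
  assumes v: "v \<in> vertices P"
  shows "N_face M {v} = {(i * fst (Char M (edge1 P v)) + j * fst (Char M (edge2 P v)),
      i * snd (Char M (edge1 P v)) + j * snd (Char M (edge2 P v))) | i j. True}"
proof -
  have "{E. E edge_of P \<and> {v} \<subseteq> E} = {edge1 P v, edge2 P v}"
    using vertex_edges(1)[OF v] by (auto simp: edges_at_def)
  then have *: "N_face M {v} = {(c (edge1 P v) * fst (Char M (edge1 P v)) + c (edge2 P v) * fst (Char M (edge2 P v)),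
      c (edge1 P v) * snd (Char M (edge1 P v)) + c (edge2 P v) * snd (Char M (edge2 P v))) | c. True}"
    using vertex_edges(2)[OF v] by (simp add: N_face_def)
  have "\<exists>c. c (edge1 P v) = i \<and> c (edge2 P v) = j" for i j :: int
    using vertex_edges(2)[OF v] by (intro exI[of _ "\<lambda>E. if E = edge1 P v then i else j"]) auto
  then show ?thesis unfolding * by (auto, metis)
qed

lemma (in quasitoric) torus_rel_eq:
  assumes "D \<subseteq> P"
  shows "torus_rel M D L = {((p, t), (q, s)). p \<in> D \<and> p = q \<and> (\<exists>a\<in>stab M p. \<exists>n\<in>L. t - s = a + lat n)}"
  using assms span_N_face unfolding torus_rel_def by blast

section \<open>The quotient space and its charts\<close>

text \<open>Points of the plane and of \<open>\<complex>\<^sup>2\<close> are to be treated as single variables.\<close>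

declare split_paired_All [simp del] split_paired_Ex [simp del]

lemma lat_uminus: "lat (- x) = - lat x" and lat_diff: "lat (x - y) = lat x - lat y"
  by (auto simp: lat_def)

lemma det2_lat: "det2 (lat x) (lat y) = of_int (det2 x y)"
  by (simp add: det2_def lat_def)

lemma det2_add_left: "det2 (x + y) z = det2 x z + det2 y z"
  and det2_add_right: "det2 z (x + y) = det2 z x + det2 z y"
  and det2_diff_left: "det2 (x - y) z = det2 x z - det2 y z"
  and det2_diff_right: "det2 z (x - y) = det2 z x - det2 z y"
  for x y z :: "'a::comm_ring \<times> 'a"
  by (simp_all add: det2_def algebra_simps)

lemma det2_scaleR_left: "det2 (c *\<^sub>R x) z = c * det2 x z"
  and det2_scaleR_right: "det2 z (c *\<^sub>R x) = c * det2 z x" for x z :: plane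
  by (simp_all add: det2_def algebra_simps)

lemma det2_self [simp]: "det2 x x = 0" for x :: "'a::comm_ring \<times> 'a"
  by (simp add: det2_def algebra_simps)

lemmas det2_linear = det2_add_left det2_add_right det2_diff_left det2_diff_right
  det2_scaleR_left det2_scaleR_right

lemma cramer:
  fixes a b t :: plane
  assumes "det2 a b \<noteq> 0"
  shows "t = (det2 t b / det2 a b) *\<^sub>R a + (det2 a t / det2 a b) *\<^sub>R b"
proof -
  have "det2 a b *\<^sub>R t = det2 t b *\<^sub>R a + det2 a t *\<^sub>R b"
    by (simp add: det2_def prod_eq_iff algebra_simps)
  then have "inverse (det2 a b) *\<^sub>R (det2 a b *\<^sub>R t)
      = inverse (det2 a b) *\<^sub>R (det2 t b *\<^sub>R a + det2 a t *\<^sub>R b)" by simp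
  then show ?thesis using assms by (simp add: scaleR_add_right divide_inverse_commute)
qed

lemma cis_2pi_eq_iff: "cis (2 * pi * x) = cis (2 * pi * y) \<longleftrightarrow> x - y \<in> \<int>"
proof -
  have "cis (2 * pi * x) = cis (2 * pi * y) \<longleftrightarrow> exp (\<i> * of_real (2 * pi * x)) = exp (\<i> * of_real (2 * pi * y))"
    by (simp add: cis_conv_exp)
  also have "\<dots> \<longleftrightarrow> (\<exists>n::int. \<i> * of_real (2 * pi * x) = \<i> * of_real (2 * pi * y) + of_int (2 * n) * of_real pi * \<i>)"
    by (simp add: exp_eq)
  also have "\<dots> \<longleftrightarrow> (\<exists>n::int. x = y + of_int n)"
  proof -
    have "\<i> * of_real (2 * pi * x) = \<i> * of_real (2 * pi * y) + of_int (2 * n) * of_real pi * \<i>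
        \<longleftrightarrow> x = y + of_int n" for n :: int
    proof -
      have "\<i> * of_real (2 * pi * x) = \<i> * of_real (2 * pi * y) + of_int (2 * n) * of_real pi * \<i>
        \<longleftrightarrow> 2 * pi * x = 2 * pi * (y + of_int n)"
        by (simp add: complex_eq_iff algebra_simps)
      then show ?thesis by simp
    qed
    then show ?thesis by simp
  qed
  also have "\<dots> \<longleftrightarrow> x - y \<in> \<int>" by (auto simp: Ints_def algebra_simps)
  finally show ?thesis .
qed

lemma smooth_on_cmod_square: "open S \<Longrightarrow> smooth_on S f \<Longrightarrow> smooth_on S (\<lambda>z. (cmod (f z))\<^sup>2)"
  for f :: "'a::euclidean_space \<Rightarrow> complex"
  using smooth_on_bilinear[OF bounded_bilinear_inner, of S f f]
  by (simp add: power2_norm_eq_inner)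

lemma polar: "z = of_real (cmod z) * cis (Arg z)"
  by (metis rcis_cmod_Arg rcis_def)

lemma polar_C2: "z = (of_real (cmod (fst z)) * cis (Arg (fst z)), of_real (cmod (snd z)) * cis (Arg (snd z)))"
  using polar[of "fst z"] polar[of "snd z"] by (simp add: prod_eq_iff)

definition orb_class :: "model \<Rightarrow> plane \<times> plane \<Rightarrow> point" where
  "orb_class M x = orb_rel M `` {x}"

text \<open>The coordinates \<open>(z\<^sub>1(v), z\<^sub>2(v))\<close> as a function on \<open>U\<^sub>v \<times> \<real>\<^sup>2\<close>, before passing to the quotient.\<close>

definition torus_coord :: "model \<Rightarrow> plane \<Rightarrow> plane \<times> plane \<Rightarrow> C2" where
  "torus_coord M v = (\<lambda>(p, t).
     (of_real (sqrt (EdgeFun M (edge1 (Poly M) v) p)) * cis (2 * pi * angle1 M v t),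
      of_real (sqrt (EdgeFun M (edge2 (Poly M) v) p)) * cis (2 * pi * angle2 M v t)))"

text \<open>The inverse of the affine isomorphism \<open>p \<mapsto> (p\<^sub>1(v), p\<^sub>2(v))\<close>, by Cramer's rule for the two gradients.\<close>

definition from_coords :: "model \<Rightarrow> plane \<Rightarrow> real \<times> real \<Rightarrow> plane" where
  "from_coords M v = (\<lambda>(x, y). let a = grad M (edge1 (Poly M) v); b = grad M (edge2 (Poly M) v) in
     v + (x / det2 a b) *\<^sub>R (snd b, - fst b) + (y / det2 a b) *\<^sub>R (- snd a, fst a))"

text \<open>The orbit map in the coordinates of the chart: \<open>\<bar>z\<^sub>a\<bar>\<^sup>2\<close> is the value of \<open>p\<^sub>a(v)\<close>.\<close>

definition base :: "model \<Rightarrow> plane \<Rightarrow> C2 \<Rightarrow> plane" where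
  "base M v z = from_coords M v ((cmod (fst z))\<^sup>2, (cmod (snd z))\<^sup>2)"

context quasitoric
begin

subsection \<open>The quotient space\<close>

lemma subspace_stab: "subspace (stab M p)" by (simp add: stab_def)

lemma orb_rel_eq:
  "orb_rel M = {((p, t), (q, s)). p \<in> P \<and> p = q \<and> (\<exists>a\<in>stab M p. \<exists>n. t - s = a + lat n)}"
  unfolding orb_rel_def torus_rel_eq[OF subset_refl] by simp

lemma torus_rel_iff:
  assumes "D \<subseteq> P"
  shows "((p, t), (q, s)) \<in> torus_rel M D L \<longleftrightarrow>
    p \<in> D \<and> p = q \<and> (\<exists>a\<in>stab M p. \<exists>n\<in>L. t - s = a + lat n)"
  unfolding torus_rel_eq[OF assms] by simp

lemma equiv_torus_rel:
  assumes "D \<subseteq> P" "0 \<in> L" "\<And>x y. x \<in> L \<Longrightarrow> y \<in> L \<Longrightarrow> x - y \<in> L"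
  shows "equiv (D \<times> UNIV) (torus_rel M D L)"
proof (rule equivI)
  have neg: "- x \<in> L" if "x \<in> L" for x using assms(3)[OF assms(2) that] by simp
  have add: "x + y \<in> L" if "x \<in> L" "y \<in> L" for x y using assms(3)[OF that(1) neg[OF that(2)]] by simp
  note iff = torus_rel_iff[OF assms(1)]
  show "torus_rel M D L \<subseteq> (D \<times> UNIV) \<times> (D \<times> UNIV)"
    unfolding torus_rel_eq[OF assms(1)] by auto
  show "refl_on (D \<times> UNIV) (torus_rel M D L)"
  proof (rule refl_onI)
    fix x :: "plane \<times> plane" assume "x \<in> D \<times> UNIV"
    then obtain p t where "x = (p, t)" "p \<in> D" by blast
    moreover have "t - t = 0 + lat 0" by (simp add: lat_0)
    moreover have "0 \<in> stab M p" by (rule subspace_0[OF subspace_stab])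
    ultimately have "p \<in> D \<and> p = p \<and> (\<exists>a\<in>stab M p. \<exists>n\<in>L. t - t = a + lat n)"
      using assms(2) by blast
    then show "(x, x) \<in> torus_rel M D L" unfolding \<open>x = (p, t)\<close> iff .
  qed
  show "sym (torus_rel M D L)"
  proof (rule symI)
    fix x y :: "plane \<times> plane"
    obtain p t q s where xy: "x = (p, t)" "y = (q, s)" by (cases x, cases y)
    assume "(x, y) \<in> torus_rel M D L"
    then obtain a n where *: "p \<in> D" "p = q" "a \<in> stab M p" "n \<in> L" "t - s = a + lat n"
      unfolding xy iff by blast
    then have "s - t = - a + lat (- n)" by (simp add: lat_uminus algebra_simps)
    then show "(y, x) \<in> torus_rel M D L"
      unfolding xy iff using * subspace_neg[OF subspace_stab] neg by blast
  qed
  show "trans (torus_rel M D L)"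
  proof (rule transI)
    fix x y z :: "plane \<times> plane"
    obtain p t q s p' r where xyz: "x = (p, t)" "y = (q, s)" "z = (p', r)" by (cases x, cases y, cases z)
    assume "(x, y) \<in> torus_rel M D L" "(y, z) \<in> torus_rel M D L"
    then obtain a n b m where *: "p \<in> D" "p = q" "q = p'" "a \<in> stab M p" "n \<in> L" "t - s = a + lat n"
      "b \<in> stab M p" "m \<in> L" "s - r = b + lat m"
      unfolding xyz iff by blast
    then have "t - r = (a + b) + lat (n + m)" by (simp add: lat_add algebra_simps)
    then show "(x, z) \<in> torus_rel M D L"
      unfolding xyz iff using * subspace_add[OF subspace_stab] add by blast
  qed
qed

lemma equiv_orb_rel: "equiv (P \<times> UNIV) (orb_rel M)"
  unfolding orb_rel_def by (rule equiv_torus_rel) auto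

lemma orb_class_eq:
  "p \<in> P \<Longrightarrow> orb_class M (p, t) = {(p, s) | s. \<exists>a\<in>stab M p. \<exists>n. t - s = a + lat n}"
  by (auto simp: orb_class_def orb_rel_eq)

lemma orb_class_self: "p \<in> P \<Longrightarrow> (p, t) \<in> orb_class M (p, t)"
  unfolding orb_class_def using equiv_class_self[OF equiv_orb_rel] by simp

lemma orb_eq: "orb M = orb_class M ` (P \<times> UNIV)"
  by (auto simp: orb_def quotient_def orb_class_def)

lemma orbit_map_orb_class: "p \<in> P \<Longrightarrow> orbit_map (orb_class M (p, t)) = p"
proof -
  assume p: "p \<in> P"
  have "fst ` orb_class M (p, t) = {p}"
  proof
    show "fst ` orb_class M (p, t) \<subseteq> {p}" unfolding orb_class_eq[OF p] by auto
    show "{p} \<subseteq> fst ` orb_class M (p, t)"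
      using rev_image_eqI[OF orb_class_self[OF p, of t], of p fst] by simp
  qed
  then show ?thesis by (simp add: orbit_map_def)
qed

lemma openin_orb_topology:
  "openin (orb_topology M) V \<longleftrightarrow> V \<subseteq> orb M \<and>
     openin (top_of_set (P \<times> UNIV)) {x \<in> P \<times> UNIV. orb_class M x \<in> V}"
proof -
  have "istopology (\<lambda>V. V \<subseteq> orb M \<and>
      openin (top_of_set (P \<times> UNIV)) {x \<in> P \<times> UNIV. orb_class M x \<in> V})" (is "istopology ?T")
    unfolding istopology_def
  proof (intro conjI allI impI)
    fix S T assume *: "?T S" "?T T"
    have "{x \<in> P \<times> UNIV. orb_class M x \<in> S \<inter> T}
        = {x \<in> P \<times> UNIV. orb_class M x \<in> S} \<inter> {x \<in> P \<times> UNIV. orb_class M x \<in> T}" by auto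
    then show "S \<inter> T \<subseteq> orb M" and
      "openin (top_of_set (P \<times> UNIV)) {x \<in> P \<times> UNIV. orb_class M x \<in> S \<inter> T}"
      using * by (auto simp only: intro: openin_Int)
  next
    fix K assume *: "\<forall>S\<in>K. ?T S"
    have "{x \<in> P \<times> UNIV. orb_class M x \<in> \<Union>K} = (\<Union>S\<in>K. {x \<in> P \<times> UNIV. orb_class M x \<in> S})"
      by auto
    then show "openin (top_of_set (P \<times> UNIV)) {x \<in> P \<times> UNIV. orb_class M x \<in> \<Union>K}"
      using * by (auto simp only: intro: openin_Union)
    show "\<Union>K \<subseteq> orb M" using * by blast
  qed
  then show ?thesis
    unfolding orb_topology_def orb_class_def by (simp only: topology_inverse')
qed

lemma topspace_orb_topology: "topspace (orb_topology M) = orb M"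
proof -
  have "{x \<in> P \<times> UNIV. orb_class M x \<in> orb M} = P \<times> UNIV" by (auto simp: orb_eq)
  then have "openin (orb_topology M) (orb M)"
    by (simp add: openin_orb_topology)
  then show ?thesis
    by (metis openin_orb_topology openin_subset openin_topspace subset_antisym)
qed

subsection \<open>Coordinates at a vertex\<close>

lemma vertex_in_P: "v \<in> vertices P \<Longrightarrow> v \<in> P"
  by (simp add: vertices_def extreme_point_of_def)

end

text \<open>The edges at the vertex and their characteristic vectors are parameters, so that known edges can be
  substituted for the descriptions by \<open>edge1\<close> and \<open>edge2\<close>.\<close>

locale quasitoric_vertex = quasitoric +
  fixes v :: plane and A B :: "plane set" and a b :: plane
  assumes v: "v \<in> vertices (Poly M)" and A: "A = edge1 (Poly M) v" and B: "B = edge2 (Poly M) v"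
    and a: "a = lat (Char M A)" and b: "b = lat (Char M B)"
begin

lemma vertex_AB: "edges_at M v = {A, B}" "A \<noteq> B" "A \<in> edges_at M v" "B \<in> edges_at M v"
    "A edge_of P" "B edge_of P"
  using vertex_edges[OF v] by (auto simp: A B edges_at_def)

lemma det_ab: "det2 a b > 0"
  using vertex_edges(3)[OF v] by (simp add: a b A B det2_lat)

lemma angle_eq: "angle1 M v t = det2 t b / det2 a b" "angle2 M v t = det2 a t / det2 a b"
  by (simp_all add: angle1_def angle2_def a b A B Let_def)

lemma angles_inverse: "t = angle1 M v t *\<^sub>R a + angle2 M v t *\<^sub>R b"
  using cramer[of a b t] det_ab by (simp add: angle_eq)

lemma angles_combination: "angle1 M v (x *\<^sub>R a + y *\<^sub>R b) = x" "angle2 M v (x *\<^sub>R a + y *\<^sub>R b) = y"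
  using det_ab by (simp_all add: angle_eq det2_linear)

lemma angles_diff: "angle1 M v (t - s) = angle1 M v t - angle1 M v s"
  "angle2 M v (t - s) = angle2 M v t - angle2 M v s"
  by (simp_all add: angle_eq det2_linear diff_divide_distrib)

lemma angles_add: "angle1 M v (t + s) = angle1 M v t + angle1 M v s"
  "angle2 M v (t + s) = angle2 M v t + angle2 M v s"
  by (simp_all add: angle_eq det2_linear add_divide_distrib)

text \<open>With respect to the basis of characteristic vectors, \<open>N(v)\<close> consists of the points with integral angle
  coordinates.\<close>

lemma N_face_lat: "n \<in> N_face M {v} \<longleftrightarrow> (\<exists>i j. lat n = of_int i *\<^sub>R a + of_int j *\<^sub>R b)"
  unfolding N_face_vertex[OF v] a b A B lat_def
  by (cases n) (simp flip: of_int_mult of_int_add)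

lemma from_coords_EdgeFun:
  "EdgeFun M A (from_coords M v xy) = fst xy" "EdgeFun M B (from_coords M v xy) = snd xy"
  using det_grads_nonzero[OF vertex_AB(3,4,2)] EdgeFun_at[OF vertex_AB(3)] EdgeFun_at[OF vertex_AB(4)]
  by (auto simp: from_coords_def A[symmetric] B[symmetric] Let_def inner_prod_def det2_def
      divide_simps split: prod.splits) (auto simp: algebra_simps)

lemma EdgeFuns_determine: "EdgeFun M A p = EdgeFun M A q \<Longrightarrow> EdgeFun M B p = EdgeFun M B q \<Longrightarrow> p = q"
proof -
  assume "EdgeFun M A p = EdgeFun M A q" "EdgeFun M B p = EdgeFun M B q"
  then have 0: "grad M A \<bullet> (p - q) = 0" "grad M B \<bullet> (p - q) = 0"
    using EdgeFun_grad[OF vertex_AB(5), of p q] EdgeFun_grad[OF vertex_AB(6), of p q] by auto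
  have "det2 (p - q) y * det2 (grad M A) (grad M B) = 0" for y
    using 0 by (simp add: det2_mult_det2)
  then have "det2 (p - q) y = 0" for y
    using det_grads_nonzero[OF vertex_AB(3,4,2)] by simp
  from this[of "(0, 1)"] this[of "(1, 0)"] show ?thesis by (simp add: det2_def prod_eq_iff)
qed

lemma EdgeFun_base: "EdgeFun M A (base M v z) = (cmod (fst z))\<^sup>2" "EdgeFun M B (base M v z) = (cmod (snd z))\<^sup>2"
  by (simp_all add: base_def from_coords_EdgeFun)

lemma base_torus_coord: "p \<in> P \<Longrightarrow> base M v (torus_coord M v (p, t)) = p"
  using EdgeFun_nonneg vertex_AB
  by (intro EdgeFuns_determine) (auto simp: EdgeFun_base torus_coord_def norm_mult A[symmetric] B[symmetric])

lemma torus_coord_base: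
  assumes "z = (of_real (cmod (fst z)) * cis \<theta>, of_real (cmod (snd z)) * cis \<psi>)"
  shows "torus_coord M v (base M v z, (\<theta> / (2 * pi)) *\<^sub>R a + (\<psi> / (2 * pi)) *\<^sub>R b) = z"
  by (subst (2) assms) (simp add: torus_coord_def A[symmetric] B[symmetric] EdgeFun_base angles_combination)

lemma U_vertex_iff_pos:
  "p \<in> U_vertex P v \<longleftrightarrow> EdgeFun M A p \<ge> 0 \<and> EdgeFun M B p \<ge> 0 \<and>
     (\<forall>E\<in>{E. E edge_of P} - {A, B}. EdgeFun M E p > 0)"
proof -
  have "edges_at M p \<subseteq> {A, B} \<longleftrightarrow> (\<forall>E\<in>{E. E edge_of P} - {A, B}. EdgeFun M E p \<noteq> 0)" if "p \<in> P"
    using edge_iff[of _ p] that by (auto simp: edges_at_def)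
  then show ?thesis
    unfolding U_vertex_iff[OF vertex_in_P[OF v]] vertex_AB(1)
    using P_iff[of p] vertex_AB(5,6) by (auto simp: less_le)
qed

lemma stab_angles:
  assumes p: "p \<in> U_vertex P v" and t: "t \<in> stab M p"
  shows "EdgeFun M A p \<noteq> 0 \<Longrightarrow> angle1 M v t = 0" "EdgeFun M B p \<noteq> 0 \<Longrightarrow> angle2 M v t = 0"
proof -
  have sub: "edges_at M p \<subseteq> {A, B}" using p U_vertex_iff[OF vertex_in_P[OF v]] vertex_AB(1) by auto
  show "angle1 M v t = 0" if "EdgeFun M A p \<noteq> 0"
  proof -
    have "A \<notin> edges_at M p" using EdgeFun_edge[of A p] that by (auto simp: edges_at_def)
    then have "lat ` Char M ` edges_at M p \<subseteq> {t. angle1 M v t = 0}"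
      using sub by (auto simp: angle_eq b)
    moreover have "subspace {t. angle1 M v t = 0}"
      using det_ab by (auto simp: subspace_def angle_eq det2_linear) (simp add: det2_def)
    ultimately show ?thesis using t span_minimal unfolding stab_def by blast
  qed
  show "angle2 M v t = 0" if "EdgeFun M B p \<noteq> 0"
  proof -
    have "B \<notin> edges_at M p" using EdgeFun_edge[of B p] that by (auto simp: edges_at_def)
    then have "lat ` Char M ` edges_at M p \<subseteq> {t. angle2 M v t = 0}"
      using sub by (auto simp: angle_eq a)
    moreover have "subspace {t. angle2 M v t = 0}"
      using det_ab by (auto simp: subspace_def angle_eq det2_linear) (simp add: det2_def)
    ultimately show ?thesis using t span_minimal unfolding stab_def by blast
  qed
qed

abbreviation "chart_rel \<equiv> torus_rel M (U_vertex P v) (N_face M {v})"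

lemma U_vertex_subset: "U_vertex P v \<subseteq> P" by (auto simp: U_vertex_def)

lemma equiv_chart_rel: "equiv (U_vertex P v \<times> UNIV) chart_rel"
proof (rule equiv_torus_rel[OF U_vertex_subset])
  show "0 \<in> N_face M {v}"
    unfolding N_face_lat lat_0 by (intro exI[of _ 0]) auto
  show "x - y \<in> N_face M {v}" if xy: "x \<in> N_face M {v}" "y \<in> N_face M {v}" for x y
  proof -
    obtain i j i' j' where "lat x = of_int i *\<^sub>R a + of_int j *\<^sub>R b" "lat y = of_int i' *\<^sub>R a + of_int j' *\<^sub>R b"
      using xy unfolding N_face_lat by blast
    then have "lat (x - y) = of_int (i - i') *\<^sub>R a + of_int (j - j') *\<^sub>R b"
      by (simp add: lat_diff algebra_simps)
    then show ?thesis unfolding N_face_lat by blast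
  qed
qed

text \<open>The functions \<open>(z\<^sub>1(v), z\<^sub>2(v))\<close> separate exactly the points of the chart: an angle is forgotten
  precisely where the corresponding radius vanishes.\<close>

lemma torus_coord_eq_iff:
  assumes p: "p \<in> U_vertex P v" and q: "q \<in> U_vertex P v"
  shows "torus_coord M v (p, t) = torus_coord M v (q, s) \<longleftrightarrow> ((p, t), (q, s)) \<in> chart_rel"
proof
  assume "((p, t), (q, s)) \<in> chart_rel"
  then obtain c n where "p = q" and c: "c \<in> stab M p" "n \<in> N_face M {v}" "t - s = c + lat n"
    unfolding torus_rel_eq[OF U_vertex_subset] by auto
  obtain i j where n: "lat n = of_int i *\<^sub>R a + of_int j *\<^sub>R b"
    using c(2) unfolding N_face_lat by blast
  have "angle1 M v (lat n) = of_int i" "angle2 M v (lat n) = of_int j"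
    unfolding n by (rule angles_combination)+
  then have "angle1 M v t - angle1 M v s = angle1 M v c + of_int i"
    "angle2 M v t - angle2 M v s = angle2 M v c + of_int j"
    using c(3) by (simp_all add: angles_add flip: angles_diff)
  then have "EdgeFun M A p \<noteq> 0 \<Longrightarrow> angle1 M v t - angle1 M v s \<in> \<int>"
    "EdgeFun M B p \<noteq> 0 \<Longrightarrow> angle2 M v t - angle2 M v s \<in> \<int>"
    using stab_angles[OF p c(1)] by simp_all
  then show "torus_coord M v (p, t) = torus_coord M v (q, s)"
    using \<open>p = q\<close> by (auto simp: torus_coord_def A[symmetric] B[symmetric] cis_2pi_eq_iff)
next
  assume eq: "torus_coord M v (p, t) = torus_coord M v (q, s)"
  have "p = q" using base_torus_coord[of p t] base_torus_coord[of q s] p q U_vertex_subset eq by auto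
  have "EdgeFun M A p \<noteq> 0 \<Longrightarrow> angle1 M v t - angle1 M v s \<in> \<int>"
    "EdgeFun M B p \<noteq> 0 \<Longrightarrow> angle2 M v t - angle2 M v s \<in> \<int>"
    using eq \<open>p = q\<close> by (auto simp: torus_coord_def A[symmetric] B[symmetric] cis_2pi_eq_iff)
  moreover have "lat (Char M E) \<in> stab M p" if "E \<in> edges_at M p" for E
    using that by (auto simp: stab_def intro: span_base)
  moreover have "EdgeFun M E p = 0 \<Longrightarrow> E \<in> edges_at M p" if "E \<in> {A, B}" for E
    using edge_iff[of E p] that vertex_AB(5,6) p U_vertex_subset by (auto simp: edges_at_def)
  ultimately have "EdgeFun M A p = 0 \<Longrightarrow> a \<in> stab M p" "EdgeFun M B p = 0 \<Longrightarrow> b \<in> stab M p"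
    and int: "EdgeFun M A p \<noteq> 0 \<Longrightarrow> angle1 M v (t - s) \<in> \<int>" "EdgeFun M B p \<noteq> 0 \<Longrightarrow> angle2 M v (t - s) \<in> \<int>"
    by (auto simp: a b angles_diff)
  (* Along an edge containing p any angle is absorbed by the stabiliser; the remaining angles differ by
     integers and are absorbed by N(v). *)
  define c where "c = (if EdgeFun M A p = 0 then angle1 M v (t - s) else 0) *\<^sub>R a
      + (if EdgeFun M B p = 0 then angle2 M v (t - s) else 0) *\<^sub>R b"
  have "c \<in> stab M p"
    unfolding c_def using subspace_stab[of p] \<open>_ \<Longrightarrow> a \<in> stab M p\<close> \<open>_ \<Longrightarrow> b \<in> stab M p\<close>
    by (auto intro!: subspace_add subspace_scale simp: subspace_0)
  define i where "i = (if EdgeFun M A p = 0 then 0 else \<lfloor>angle1 M v (t - s)\<rfloor>)"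
  define j where "j = (if EdgeFun M B p = 0 then 0 else \<lfloor>angle2 M v (t - s)\<rfloor>)"
  define n where "n = (i * fst (Char M A) + j * fst (Char M B), i * snd (Char M A) + j * snd (Char M B))"
  have n: "lat n = of_int i *\<^sub>R a + of_int j *\<^sub>R b" by (simp add: n_def lat_def a b)
  have "t - s = angle1 M v (t - s) *\<^sub>R a + angle2 M v (t - s) *\<^sub>R b" by (rule angles_inverse)
  also have "\<dots> = c + lat n"
    unfolding n c_def i_def j_def using int by (auto simp: algebra_simps)
  finally have "t - s = c + lat n" .
  moreover have "n \<in> N_face M {v}" using n N_face_lat by blast
  ultimately show "((p, t), (q, s)) \<in> chart_rel"
    using \<open>p = q\<close> \<open>c \<in> stab M p\<close> p unfolding torus_rel_eq[OF U_vertex_subset] by auto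
qed

lemma chart_coord_class:
  assumes "p \<in> U_vertex P v"
  shows "chart_coord M v (chart_rel `` {(p, t)}) = torus_coord M v (p, t)"
proof -
  have "torus_coord M v ` (chart_rel `` {(p, t)}) = {torus_coord M v (p, t)}"
  proof
    show "torus_coord M v ` (chart_rel `` {(p, t)}) \<subseteq> {torus_coord M v (p, t)}"
    proof
      fix z assume "z \<in> torus_coord M v ` (chart_rel `` {(p, t)})"
      then obtain q s where *: "((p, t), (q, s)) \<in> chart_rel" and z: "z = torus_coord M v (q, s)"
        by auto
      then have "q \<in> U_vertex P v" unfolding torus_rel_iff[OF U_vertex_subset] by blast
      then show "z \<in> {torus_coord M v (p, t)}"
        using torus_coord_eq_iff[OF assms, of q t s] * z by simp
    qed
    show "{torus_coord M v (p, t)} \<subseteq> torus_coord M v ` (chart_rel `` {(p, t)})"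
      using equiv_class_self[OF equiv_chart_rel, of "(p, t)"] assms by blast
  qed
  then show ?thesis by (simp add: chart_coord_def flip: torus_coord_def)
qed

lemma chart_dom_eq: "chart_dom M v = torus_coord M v ` (U_vertex P v \<times> UNIV)"
proof -
  have "chart_space M v = (\<lambda>x. chart_rel `` {x}) ` (U_vertex P v \<times> UNIV)"
    by (auto simp: chart_space_def quotient_def)
  then show ?thesis
    unfolding chart_dom_def by (simp add: image_image) (intro image_cong, auto simp: chart_coord_class)
qed

text \<open>By injectivity of the coordinates, inverting them returns the class of \<open>(p, t)\<close> in the chart; saturating it
  gives the class in the orbifold.\<close>

lemma chart_map_torus_coord:
  assumes p: "p \<in> U_vertex P v"
  shows "chart_map M v (torus_coord M v (p, t)) = orb_class M (p, t)"
proof -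
  let ?c = "chart_rel `` {(p, t)}"
  have "inj_on (chart_coord M v) (chart_space M v)"
  proof (rule inj_onI)
    fix c d assume "c \<in> chart_space M v" "d \<in> chart_space M v" and eq: "chart_coord M v c = chart_coord M v d"
    then obtain q s q' s' where c: "c = chart_rel `` {(q, s)}" "q \<in> U_vertex P v"
      and d: "d = chart_rel `` {(q', s')}" "q' \<in> U_vertex P v"
      by (auto simp: chart_space_def quotient_def)
    then have "((q, s), (q', s')) \<in> chart_rel"
      using eq chart_coord_class torus_coord_eq_iff by simp
    then show "c = d" unfolding c d by (rule equiv_class_eq[OF equiv_chart_rel])
  qed
  moreover have "?c \<in> chart_space M v"
    unfolding chart_space_def by (rule quotientI) (use p in auto)
  ultimately have "inv_into (chart_space M v) (chart_coord M v) (torus_coord M v (p, t)) = ?c"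
    using chart_coord_class[OF p, of t] by (metis inv_into_f_f)
  moreover have "orb_rel M `` ?c = orb_rel M `` {(p, t)}"
  proof
    have "chart_rel \<subseteq> orb_rel M"
      unfolding torus_rel_eq[OF U_vertex_subset] orb_rel_eq using U_vertex_subset by auto
    then show "orb_rel M `` ?c \<subseteq> orb_rel M `` {(p, t)}"
      using equiv_orb_rel unfolding equiv_def trans_def by blast
    show "orb_rel M `` {(p, t)} \<subseteq> orb_rel M `` ?c"
      using equiv_class_self[OF equiv_chart_rel, of "(p, t)"] p by blast
  qed
  ultimately show ?thesis by (simp add: chart_map_def chart_proj_def orb_class_def)
qed

lemma chart_dom_iff_base: "z \<in> chart_dom M v \<longleftrightarrow> base M v z \<in> U_vertex P v"
proof
  assume "z \<in> chart_dom M v"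
  then show "base M v z \<in> U_vertex P v"
    unfolding chart_dom_eq using base_torus_coord U_vertex_subset by auto
next
  assume U: "base M v z \<in> U_vertex P v"
  obtain t where t: "torus_coord M v (base M v z, t) = z"
    using torus_coord_base[OF polar_C2, of z] by blast
  have "torus_coord M v (base M v z, t) \<in> chart_dom M v"
    unfolding chart_dom_eq by (rule imageI) (simp add: U)
  then show "z \<in> chart_dom M v" by (simp only: t)
qed

text \<open>Any choice of arguments \<open>\<theta>, \<psi>\<close> of the coordinates represents the same point of the orbifold. This freedom
  allows branches of the angles to be chosen locally.\<close>

lemma chart_map_base:
  assumes "z \<in> chart_dom M v" "z = (of_real (cmod (fst z)) * cis \<theta>, of_real (cmod (snd z)) * cis \<psi>)"
  shows "chart_map M v z = orb_class M (base M v z, (\<theta> / (2 * pi)) *\<^sub>R a + (\<psi> / (2 * pi)) *\<^sub>R b)"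
  using chart_map_torus_coord[of "base M v z"] torus_coord_base[OF assms(2)] assms(1)
  unfolding chart_dom_iff_base by metis

lemma base_in_P: "z \<in> chart_dom M v \<Longrightarrow> base M v z \<in> P"
  using chart_dom_iff_base U_vertex_subset by blast

lemma orbit_map_chart_map: "z \<in> chart_dom M v \<Longrightarrow> orbit_map (chart_map M v z) = base M v z"
  using chart_map_base[OF _ polar_C2] base_in_P by (simp add: orbit_map_orb_class)

lemma chart_map_in_orb: "z \<in> chart_dom M v \<Longrightarrow> chart_map M v z \<in> orb M"
  using chart_map_base[OF _ polar_C2] base_in_P by (simp add: orb_eq)

lemma smooth_on_from_coords: "smooth_on UNIV (from_coords M v)"
proof -
  let ?D = "det2 (grad M A) (grad M B)"
  have "from_coords M v = (\<lambda>q. v + (fst q *\<^sub>R ((1 / ?D) *\<^sub>R (snd (grad M B), - fst (grad M B)))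
      + snd q *\<^sub>R ((1 / ?D) *\<^sub>R (- snd (grad M A), fst (grad M A)))))"
    by (auto simp: from_coords_def Let_def A B)
  moreover have "smooth_on UNIV \<dots>"
    by (intro smooth_on_add smooth_on_bilinear[OF bounded_bilinear_scaleR] smooth_on_const
        smooth_on_bounded_linear[OF bounded_linear_fst] smooth_on_bounded_linear[OF bounded_linear_snd]
        smooth_on_ident open_UNIV)
  ultimately show ?thesis by (simp only:)
qed

lemma smooth_on_base: "smooth_on UNIV (base M v)"
  unfolding base_def
  by (intro smooth_on_compose[OF _ open_UNIV _ smooth_on_from_coords] smooth_on_Pair smooth_on_cmod_square
      smooth_on_bounded_linear[OF bounded_linear_fst] smooth_on_bounded_linear[OF bounded_linear_snd]
      smooth_on_ident open_UNIV subset_UNIV)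

lemma smooth_on_EdgeFun_base:
  assumes "E edge_of P"
  shows "smooth_on UNIV (\<lambda>z. EdgeFun M E (base M v z))"
proof -
  have "(\<lambda>z. EdgeFun M E (base M v z)) = (\<lambda>z. EdgeFun M E 0 + grad M E \<bullet> base M v z)"
    using EdgeFun_grad[OF assms, of _ 0] by (metis diff_zero)
  moreover have "smooth_on UNIV \<dots>"
    by (intro smooth_on_add smooth_on_const open_UNIV
        smooth_on_bounded_linear[OF bounded_linear_inner_right] smooth_on_base)
  ultimately show ?thesis by (simp only:)
qed

text \<open>Only the edges away from \<open>v\<close> bound the chart: the inequalities of the two edges at \<open>v\<close> read
  \<open>\<bar>z\<^sub>a\<bar>\<^sup>2 \<ge> 0\<close>.\<close>

lemma open_chart_dom: "open (chart_dom M v)"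
proof -
  have "chart_dom M v = (\<Inter>E\<in>{E. E edge_of P} - {A, B}. {z. EdgeFun M E (base M v z) > 0})"
    by (auto simp: chart_dom_iff_base U_vertex_iff_pos EdgeFun_base)
  also have "open \<dots>"
  proof (intro open_INT ballI)
    show "finite ({E. E edge_of P} - {A, B})" using finite_edges by simp
    show "open {z. EdgeFun M E (base M v z) > 0}" if "E \<in> {E. E edge_of P} - {A, B}" for E
      using smooth_on_imp_continuous_on[OF smooth_on_EdgeFun_base[of E]] that
      by (intro open_Collect_less) auto
  qed
  finally show ?thesis .
qed

text \<open>The angles are not continuous where a coordinate vanishes, but they range over a compact set, and
  the projection along a compact factor is a closed map.\<close>

lemma open_chart_map_preimage:
  assumes "openin (orb_topology M) V"
  shows "open {z \<in> chart_dom M v. chart_map M v z \<in> V}"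
proof -
  let ?T = "cbox (- pi, - pi) (pi, pi)"
  let ?x = "\<lambda>(\<theta>, z). (base M v z, (fst \<theta> / (2 * pi)) *\<^sub>R a + (snd \<theta> / (2 * pi)) *\<^sub>R b)"
  let ?y = "\<lambda>(\<theta>, z). (of_real (cmod (fst z)) * cis (fst \<theta>), of_real (cmod (snd z)) * cis (snd \<theta>)) - z"
  let ?C = "P \<times> UNIV - {x \<in> P \<times> UNIV. orb_class M x \<in> V}"
  let ?U = "((?T \<times> chart_dom M v) \<inter> ?x -` ?C) \<inter> {q \<in> ?T \<times> chart_dom M v. ?y q = 0}"
  note base = smooth_on_imp_continuous_on[OF smooth_on_base]
  have "continuous_on (?T \<times> chart_dom M v) ?x"
    unfolding case_prod_unfold
    by (intro continuous_intros continuous_on_compose2[OF base _ subset_UNIV]) auto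
  moreover have "continuous_on (?T \<times> chart_dom M v) ?y"
    unfolding case_prod_unfold by (intro continuous_intros)
  moreover have "closedin (top_of_set (P \<times> UNIV)) ?C"
    using assms unfolding openin_orb_topology by (intro closedin_diff) auto
  moreover have "?x \<in> ?T \<times> chart_dom M v \<rightarrow> P \<times> UNIV" using base_in_P by auto
  ultimately have "closedin (top_of_set (?T \<times> chart_dom M v)) ?U"
    by (intro closedin_Int continuous_closedin_preimage_gen continuous_closedin_preimage_constant)
  then have "closedin (top_of_set (chart_dom M v)) {z. \<exists>\<theta>. \<theta> \<in> ?T \<and> (\<theta>, z) \<in> ?U}"
    by (rule closedin_compact_projection[OF compact_cbox])
  also have "{z. \<exists>\<theta>. \<theta> \<in> ?T \<and> (\<theta>, z) \<in> ?U} = chart_dom M v - {z \<in> chart_dom M v. chart_map M v z \<in> V}"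
  proof (intro equalityI subsetI)
    fix z assume "z \<in> {z. \<exists>\<theta>. \<theta> \<in> ?T \<and> (\<theta>, z) \<in> ?U}"
    then obtain \<theta> \<psi> where z: "z \<in> chart_dom M v"
      and *: "(of_real (cmod (fst z)) * cis \<theta>, of_real (cmod (snd z)) * cis \<psi>) = z"
      and "orb_class M (base M v z, (\<theta> / (2 * pi)) *\<^sub>R a + (\<psi> / (2 * pi)) *\<^sub>R b) \<notin> V"
      by (auto simp del: mem_box)
    then show "z \<in> chart_dom M v - {z \<in> chart_dom M v. chart_map M v z \<in> V}"
      using chart_map_base[OF z *[symmetric]] by simp
  next
    fix z assume z: "z \<in> chart_dom M v - {z \<in> chart_dom M v. chart_map M v z \<in> V}"
    let ?\<theta> = "(Arg (fst z), Arg (snd z))"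
    have "?\<theta> \<in> ?T" using Arg_bounded[of "fst z"] Arg_bounded[of "snd z"] by (simp add: cbox_Pair_eq)
    moreover have "(?\<theta>, z) \<in> ?U"
    proof -
      have "orb_class M (base M v z, (Arg (fst z) / (2 * pi)) *\<^sub>R a + (Arg (snd z) / (2 * pi)) *\<^sub>R b) \<notin> V"
        "z \<in> chart_dom M v" "base M v z \<in> P"
        using z chart_map_base[OF _ polar_C2, of z] base_in_P by auto
      then have "(?\<theta>, z) \<in> ?T \<times> chart_dom M v" "?x (?\<theta>, z) \<in> ?C"
        using \<open>?\<theta> \<in> ?T\<close> by (simp_all del: mem_box)
      moreover have "?y (?\<theta>, z) = 0"
        unfolding prod.case fst_conv snd_conv polar_C2[of z, symmetric] by (rule diff_self)
      ultimately show ?thesis unfolding Int_iff vimage_eq mem_Collect_eq by (intro conjI)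
    qed
    ultimately show "z \<in> {z. \<exists>\<theta>. \<theta> \<in> ?T \<and> (\<theta>, z) \<in> ?U}"
      unfolding mem_Collect_eq by (intro exI[of _ ?\<theta>] conjI)
  qed
  finally have "openin (top_of_set (chart_dom M v)) {z \<in> chart_dom M v. chart_map M v z \<in> V}"
    by (simp add: openin_closedin_eq)
  then show ?thesis using open_chart_dom openin_open_trans by blast
qed

end

section \<open>The geometry of the blowdown\<close>

text \<open>The data of the blowdown without the almost complex structures. Below, \<open>p1\<close>, \<open>p2\<close>, \<open>ph\<close> stand for \<open>p\<^sub>1\<close>, \<open>p\<^sub>2\<close>
  and \<open>p\<close>-hat, and \<open>c1\<close>, \<open>c2\<close>, \<open>c3\<close> for the characteristic vectors.\<close>

locale blowdown =
  fixes X Y :: model and E1 E2 E3 :: "plane set" and v1 v2 w :: plane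
    and k m :: nat and s t \<epsilon>1 \<epsilon>2 :: real and \<delta> :: "real \<Rightarrow> real"
    and f :: "plane \<Rightarrow> plane" and \<rho> :: "point \<Rightarrow> point"
  assumes X: "primitive_model X" "positively_omnioriented X"
    and edges: "E1 edge_of Poly X" "E2 edge_of Poly X" "E3 edge_of Poly X"
      "E1 \<inter> E2 = {v1}" "E2 \<inter> E3 = {v2}"
    and dets: "det2 (Char X E1) (Char X E2) = 1"
      "det2 (Char X E2) (Char X E3) = int k" "det2 (Char X E1) (Char X E3) = int m"
      "0 < k" "k \<le> m"
    and st: "s > 0" "t > 0" and coords: "\<And>x. EdgeFun X E2 x = EdgeFun X E3 x + s * EdgeFun X E1 x - t"
    and Y_eq: "Y = blowdown_model X E1 E2 E3" and Y: "primitive_model Y" "positively_omnioriented Y"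
    and w: "w = new_vertex X E1 E3"
    and eps: "0 < \<epsilon>1" "\<epsilon>1 < \<epsilon>2" "\<epsilon>2 < 1"
    and small: "\<And>E x. E edge_of Poly X \<Longrightarrow> E \<notin> {E1, E2, E3} \<Longrightarrow> x \<in> E \<Longrightarrow> EdgeFun X E2 x > \<epsilon>2"
    and \<delta>_mono: "mono_on {0..} \<delta>" and \<delta>_smooth: "smooth_on {0<..} \<delta>"
    and \<delta>_root: "\<And>x. 0 \<le> x \<Longrightarrow> x < \<epsilon>1 \<Longrightarrow> \<delta> x = root m x" and \<delta>_one: "\<And>x. x > \<epsilon>2 \<Longrightarrow> \<delta> x = 1"
    and f_def: "f = blowdown_base X E1 E2 E3 k \<delta>" and rho_def: "\<rho> = blowdown_map X E1 E2 E3 k \<delta>"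
begin

abbreviation "p1 \<equiv> EdgeFun X E1"
abbreviation "p2 \<equiv> EdgeFun X E3"
abbreviation "ph \<equiv> EdgeFun X E2"
abbreviation "c1 \<equiv> lat (Char X E1)"
abbreviation "c2 \<equiv> lat (Char X E2)"
abbreviation "c3 \<equiv> lat (Char X E3)"

sublocale X: quasitoric X by unfold_locales (fact X)+
sublocale Y: quasitoric Y by unfold_locales (fact Y)+

lemma m_pos: "m > 0" using dets by simp

lemma edges_distinct: "E1 \<noteq> E2" "E2 \<noteq> E3" "E1 \<noteq> E3"
proof -
  show "E1 \<noteq> E2" using dets(1) by auto
  show "E2 \<noteq> E3" using dets(2,4) by auto
  show "E1 \<noteq> E3" using dets(3) m_pos by auto
qed

lemma dets_lat: "det2 c1 c2 = 1" "det2 c2 c3 = k" "det2 c1 c3 = m"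
  by (simp_all add: det2_lat dets)

lemma v_edges: "E1 \<in> edges_at X v1" "E2 \<in> edges_at X v1" "E2 \<in> edges_at X v2" "E3 \<in> edges_at X v2"
  using edges by (auto simp: edges_at_def)

lemma v_vertices: "v1 \<in> vertices (Poly X)" "v2 \<in> vertices (Poly X)"
  using X.vertexI v_edges edges_distinct by auto

sublocale V1: quasitoric_vertex X v1 E1 E2 c1 c2
  by unfold_locales (use X.edge12_eqI[of v1 E1 E2] v_vertices v_edges dets in auto)

sublocale V2: quasitoric_vertex X v2 E2 E3 c2 c3
  by unfold_locales (use X.edge12_eqI[of v2 E2 E3] v_vertices v_edges dets in auto)

lemma v_in_X: "v1 \<in> Poly X" "v2 \<in> Poly X"
  using X.vertex_in_P v_vertices by auto

lemma v_values: "p1 v1 = 0" "ph v1 = 0" "p2 v1 = t" "p2 v2 = 0" "ph v2 = 0" "p1 v2 = t / s"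
proof -
  show "p1 v1 = 0" "ph v1 = 0" "p2 v2 = 0" "ph v2 = 0"
    using v_edges X.EdgeFun_edge by (auto simp: edges_at_def)
  then show "p2 v1 = t" "p1 v2 = t / s" using coords[of v1] coords[of v2] st by (auto simp: field_simps)
qed

text \<open>The point with prescribed values of \<open>p\<^sub>1\<close> and \<open>p\<^sub>2\<close>. As \<open>E1\<close> and \<open>E3\<close> do not meet, the coordinates at \<open>v1\<close> are
  used, with \<open>p\<close>-hat expressed through \<open>p\<^sub>1\<close> and \<open>p\<^sub>2\<close>.\<close>

definition at_coords :: "real \<times> real \<Rightarrow> plane" where
  "at_coords q = from_coords X v1 (fst q, snd q + s * fst q - t)"

lemma at_coords: "p1 (at_coords q) = fst q" "p2 (at_coords q) = snd q"
  using coords[of "at_coords q"] by (simp_all add: at_coords_def V1.from_coords_EdgeFun)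

lemma coords_determine: "p1 x = p1 y \<Longrightarrow> p2 x = p2 y \<Longrightarrow> x = y"
  by (rule V1.EdgeFuns_determine) (simp_all add: coords)

lemma smooth_at_coords: "smooth_on UNIV at_coords"
proof -
  have "smooth_on UNIV (\<lambda>q::real \<times> real. (snd q + s * fst q) + - t)"
    by (intro smooth_on_add smooth_on_bounded_linear[OF bounded_linear_snd] smooth_on_const smooth_on_ident
        smooth_on_bounded_linear[OF bounded_linear_mult_right]
        smooth_on_bounded_linear[OF bounded_linear_fst] open_UNIV)
  then show ?thesis
    unfolding at_coords_def
    by (intro smooth_on_compose[OF _ open_UNIV _ V1.smooth_on_from_coords] smooth_on_Pair
        smooth_on_bounded_linear[OF bounded_linear_fst] smooth_on_ident open_UNIV subset_UNIV) simp
qed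

lemma w_eq: "w = at_coords (0, 0)"
  unfolding w new_vertex_def
  by (rule the_equality) (auto simp: at_coords intro!: coords_determine)

lemma w_values: "p1 w = 0" "p2 w = 0" "ph w = - t"
  by (simp_all add: w_eq at_coords coords)

lemma f_eq: "f p = at_coords (\<delta> (ph p) ^ k * p1 p, \<delta> (ph p) * p2 p)"
  unfolding f_def blowdown_base_def
  by (rule the_equality) (auto simp: at_coords intro!: coords_determine)

lemma f_values: "p1 (f p) = \<delta> (ph p) ^ k * p1 p" "p2 (f p) = \<delta> (ph p) * p2 p"
  by (simp_all add: f_eq at_coords)

subsection \<open>The function \<open>\<delta>\<close>\<close>

lemma \<delta>_0: "\<delta> 0 = 0"
  using \<delta>_root[of 0] eps by simp

lemma \<delta>_pos: "x > 0 \<Longrightarrow> \<delta> x > 0"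
proof -
  assume "x > 0"
  define y where "y = min x (\<epsilon>1 / 2)"
  have y: "0 < y" "y \<le> x" "y < \<epsilon>1" using \<open>x > 0\<close> eps by (auto simp: y_def min_def)
  then have "0 < \<delta> y" using \<delta>_root[of y] m_pos by simp
  also have "\<delta> y \<le> \<delta> x" using \<delta>_mono y by (auto simp: mono_on_def)
  finally show ?thesis .
qed

lemma \<delta>_nonneg: "x \<ge> 0 \<Longrightarrow> \<delta> x \<ge> 0"
  using \<delta>_pos[of x] \<delta>_0 by (cases "x = 0") auto

lemma \<delta>_le_1: "x \<ge> 0 \<Longrightarrow> \<delta> x \<le> 1"
proof -
  assume "x \<ge> 0"
  then have "\<delta> x \<le> \<delta> (max x 1)" using \<delta>_mono by (auto simp: mono_on_def)
  then show ?thesis using \<delta>_one[of "max x 1"] eps by simp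
qed

lemma continuous_\<delta>: "continuous_on {0..} \<delta>"
proof -
  have 1: "continuous_on {0..<\<epsilon>1} \<delta>"
    by (rule continuous_on_eq[of _ "root m"]) (auto simp: \<delta>_root intro!: continuous_intros)
  have 2: "continuous_on {0<..} \<delta>" by (rule smooth_on_imp_continuous_on[OF \<delta>_smooth])
  have eq: "{0..<\<epsilon>1} \<union> {0<..} = {0..}" using eps by auto
  have "{0..<\<epsilon>1} = {0..} \<inter> {..<\<epsilon>1}" "{0<..} = {0..} \<inter> {0::real<..}" by auto
  then have "openin (top_of_set {0..}) {0..<\<epsilon>1}" "openin (top_of_set {0..}) {0::real<..}"
    by (metis openin_open_Int open_lessThan, metis openin_open_Int open_greaterThan)
  then show ?thesis
    using continuous_on_Un_local_open[of "{0..<\<epsilon>1}" "{0<..}" \<delta>] 1 2 by (simp add: eq)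
qed

subsection \<open>The edges away from the blowdown\<close>

definition others :: "plane set set" where
  "others = {E. E edge_of Poly X} - {E1, E2, E3}"

lemma finite_others: "finite others"
  using X.finite_edges by (simp add: others_def)

lemma edge_cases:
  assumes "E edge_of Poly X" "E \<noteq> E2"
  obtains "E = E1" | "E = E3" | "E \<in> others"
  using assms by (auto simp: others_def)

lemma convex_EdgeFun_ge: "E edge_of Poly X \<Longrightarrow> convex {x. EdgeFun X E x \<ge> 0}"
  and convex_EdgeFun_le: "E edge_of Poly X \<Longrightarrow> convex {x. EdgeFun X E x \<le> r}"
proof -
  assume E: "E edge_of Poly X"
  have 1: "{x. EdgeFun X E x \<ge> 0} = {x. grad X E \<bullet> x \<ge> - EdgeFun X E 0}"
    and 2: "{x. EdgeFun X E x \<le> r} = {x. grad X E \<bullet> x \<le> r - EdgeFun X E 0}"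
    using X.EdgeFun_grad[OF E, of _ 0] by force+
  show "convex {x. EdgeFun X E x \<ge> 0}" unfolding 1 by (rule convex_halfspace_ge)
  show "convex {x. EdgeFun X E x \<le> r}" unfolding 2 by (rule convex_halfspace_le)
qed

text \<open>No other edge enters the strip where \<open>p\<close>-hat lies between \<open>0\<close> and \<open>\<epsilon>\<^sub>2\<close>: where the half-planes of the other edges first
  failed, there would be a point of \<open>P\<close> on one of them.\<close>

lemma others_pos_strip:
  assumes "p1 x \<ge> 0" "p2 x \<ge> 0" "0 \<le> ph x" "ph x \<le> \<epsilon>2" "E \<in> others"
  shows "EdgeFun X E x > 0"
proof -
  (* The part S of the convex strip T where the other edge functions are positive is both open and
     closed in T, and contains v1. *)
  define T where "T = {x. p1 x \<ge> 0} \<inter> {x. p2 x \<ge> 0} \<inter> {x. ph x \<ge> 0} \<inter> {x. ph x \<le> \<epsilon>2}"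
  define S where "S = T \<inter> (\<Inter>E\<in>others. {x. EdgeFun X E x > 0})"
  have "convex T"
    unfolding T_def by (intro convex_Int convex_EdgeFun_ge convex_EdgeFun_le edges)
  have pos: "EdgeFun X E y > 0" if y: "y \<in> T" and nonneg: "\<forall>E\<in>others. EdgeFun X E y \<ge> 0" and E: "E \<in> others" for y E
  proof (rule ccontr)
    assume "\<not> EdgeFun X E y > 0"
    then have "EdgeFun X E y = 0" using nonneg E by (auto intro: antisym)
    moreover have "y \<in> Poly X"
      unfolding X.P_iff using y nonneg by (auto simp: T_def others_def)
    ultimately have "y \<in> E" using X.edge_iff E by (simp add: others_def)
    then have "ph y > \<epsilon>2" using small[of E y] E by (simp add: others_def)
    then show False using y by (simp add: T_def)
  qed
  have "openin (top_of_set T) S"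
    unfolding S_def
  proof (intro openin_open_Int open_INT finite_others ballI)
    show "open {x. EdgeFun X E x > 0}" if "E \<in> others" for E
      using that by (intro open_Collect_less continuous_on_const X.continuous_on_EdgeFun) (auto simp: others_def)
  qed
  moreover have "S = T \<inter> (\<Inter>E\<in>others. {x. EdgeFun X E x \<ge> 0})"
    unfolding S_def using pos by (auto intro: less_imp_le)
  moreover have "closedin (top_of_set T) (T \<inter> (\<Inter>E\<in>others. {x. EdgeFun X E x \<ge> 0}))"
  proof (intro closedin_closed_Int closed_INT ballI)
    show "closed {x. EdgeFun X E x \<ge> 0}" if "E \<in> others" for E
      using that by (intro closed_Collect_le continuous_on_const X.continuous_on_EdgeFun) (auto simp: others_def)
  qed
  moreover have "v1 \<in> S"
  proof -
    have "v1 \<in> T" using v_values st eps by (simp add: T_def)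
    moreover have "\<forall>E\<in>others. EdgeFun X E v1 \<ge> 0"
      using X.EdgeFun_nonneg v_in_X by (simp add: others_def)
    ultimately show ?thesis using pos by (simp add: S_def)
  qed
  ultimately have "S = T"
    using convex_connected[OF \<open>convex T\<close>] unfolding connected_clopen by (metis empty_iff)
  then show ?thesis using assms by (auto simp: S_def T_def)
qed

text \<open>The region cut off from the new polygon by \<open>E2\<close> is the triangle with apex \<open>w\<close>; the ray from \<open>w\<close> through
  \<open>x\<close> leaves it at \<open>x'\<close>.\<close>

lemma cone_point:
  assumes "p1 x \<ge> 0" "p2 x \<ge> 0" "ph x < 0"
  obtains x' \<tau> where "0 \<le> \<tau>" "\<tau> \<le> 1" "x = (1 - \<tau>) *\<^sub>R w + \<tau> *\<^sub>R x'" "p1 x' \<ge> 0" "p2 x' \<ge> 0" "ph x' = 0"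
proof -
  define q where "q = p2 x + s * p1 x"
  have q: "0 \<le> q" "q < t" using assms st by (auto simp: q_def coords)
  show ?thesis
  proof (cases "q = 0")
    case True
    then have "p2 x = 0" "p1 x = 0" using assms st by (auto simp: q_def add_nonneg_eq_0_iff)
    then have "x = w" by (intro coords_determine) (simp_all add: w_values)
    then show ?thesis using that[of 0 v1] v_values st by simp
  next
    case False
    define x' where "x' = at_coords (p1 x * t / q, p2 x * t / q)"
    have x': "p1 x' = p1 x * t / q" "p2 x' = p2 x * t / q" by (simp_all add: x'_def at_coords)
    have "ph x' = q * t / q - t" by (simp add: coords x' q_def add_divide_distrib algebra_simps)
    then have "ph x' = 0" using False by simp
    moreover have "x = (1 - q / t) *\<^sub>R w + (q / t) *\<^sub>R x'"
      using False st by (intro coords_determine)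
        (simp_all add: X.EdgeFun_convex_combination edges x' w_values)
    ultimately show ?thesis using that[of "q / t" x'] assms q st by (simp add: x')
  qed
qed

text \<open>The segment from \<open>w\<close> to a point \<open>y\<close> of \<open>E\<close> crosses the line of \<open>E2\<close> at a point where the function of \<open>E\<close> is
  positive. As this function is affine and vanishes at \<open>y\<close>, it is positive at \<open>w\<close>.\<close>

lemma others_pos_w:
  assumes E: "E \<in> others"
  shows "EdgeFun X E w > 0"
proof -
  have edge: "E edge_of Poly X" using E by (simp add: others_def)
  obtain y where y: "y \<in> E" using X.edge_other_point[OF edge] by blast
  have "ph y > \<epsilon>2" using small[of E y] E y by (simp add: others_def)
  then have "ph y > 0" using eps by simp
  have "y \<in> Poly X" using X.edge_subset[OF edge] y by blast
  (* The parameter at which ph, running from - t to ph y, vanishes. *)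
  define \<tau> where "\<tau> = t / (ph y + t)"
  have \<tau>: "0 < \<tau>" "\<tau> < 1" using \<open>ph y > 0\<close> st by (auto simp: \<tau>_def)
  let ?x = "(1 - \<tau>) *\<^sub>R w + \<tau> *\<^sub>R y"
  have "EdgeFun X E ?x > 0"
  proof (rule others_pos_strip[OF _ _ _ _ E])
    show "p1 ?x \<ge> 0" "p2 ?x \<ge> 0"
      using \<tau> X.EdgeFun_nonneg[OF _ \<open>y \<in> Poly X\<close>] edges
      by (simp_all add: X.EdgeFun_convex_combination w_values)
    have "\<tau> * (ph y + t) = t" using \<open>ph y > 0\<close> st by (simp add: \<tau>_def)
    moreover have "ph ?x = (1 - \<tau>) * - t + \<tau> * ph y"
      by (simp add: X.EdgeFun_convex_combination edges w_values)
    ultimately have "ph ?x = 0" by (simp add: algebra_simps)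
    then show "0 \<le> ph ?x" "ph ?x \<le> \<epsilon>2" using eps by auto
  qed
  moreover have "EdgeFun X E ?x = (1 - \<tau>) * EdgeFun X E w"
    using X.EdgeFun_edge[OF edge y] by (simp add: X.EdgeFun_convex_combination edge)
  ultimately show ?thesis using \<tau> by (simp add: zero_less_mult_iff)
qed

lemma others_pos:
  assumes x: "p1 x \<ge> 0" "p2 x \<ge> 0" "ph x \<le> \<epsilon>2" and E: "E \<in> others"
  shows "EdgeFun X E x > 0"
proof (cases "ph x \<ge> 0")
  case True
  then show ?thesis using others_pos_strip x E by blast
next
  case False
  then obtain x' \<tau> where *: "0 \<le> \<tau>" "\<tau> \<le> 1" "x = (1 - \<tau>) *\<^sub>R w + \<tau> *\<^sub>R x'"
    and x': "p1 x' \<ge> 0" "p2 x' \<ge> 0" "ph x' = 0"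
    using cone_point[of x] x by (metis not_le)
  have pos: "EdgeFun X E x' > 0" "EdgeFun X E w > 0"
    using others_pos_strip[OF x'(1,2) _ _ E] x'(3) eps others_pos_w[OF E] by auto
  have edge: "E edge_of Poly X" using E by (simp add: others_def)
  have "EdgeFun X E x = (1 - \<tau>) * EdgeFun X E w + \<tau> * EdgeFun X E x'"
    by (simp add: *(3) X.EdgeFun_convex_combination edge)
  also have "\<dots> > 0"
  proof (cases "\<tau> = 0")
    case False
    then show ?thesis using pos * by (intro add_nonneg_pos) auto
  qed (use pos in simp)
  finally show ?thesis .
qed

subsection \<open>The new polygon and its edges\<close>

lemma Poly_Y_eq: "Poly Y = convex hull (insert w (Poly X))"
  by (simp add: Y_eq blowdown_model_def w)

lemma X_subset_Y: "Poly X \<subseteq> Poly Y"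
  unfolding Poly_Y_eq by (meson hull_subset insert_subset subset_trans subset_insertI)

lemma w_in_Y: "w \<in> Poly Y"
  unfolding Poly_Y_eq by (simp add: hull_inc)

text \<open>Deleting \<open>E2\<close> and extending \<open>E1\<close> and \<open>E3\<close> removes precisely one of the inequalities that define \<open>P\<close>.\<close>

lemma Poly_Y_iff: "x \<in> Poly Y \<longleftrightarrow> (\<forall>E. E edge_of Poly X \<longrightarrow> E \<noteq> E2 \<longrightarrow> EdgeFun X E x \<ge> 0)"
proof
  assume "x \<in> Poly Y"
  let ?Q = "\<Inter>E\<in>{E. E edge_of Poly X} - {E2}. {x. EdgeFun X E x \<ge> 0}"
  have "convex ?Q" using convex_EdgeFun_ge by (intro convex_INT) auto
  moreover have "insert w (Poly X) \<subseteq> ?Q"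
  proof -
    have "EdgeFun X E w \<ge> 0" if "E edge_of Poly X" "E \<noteq> E2" for E
      by (rule edge_cases[OF that]) (auto simp: w_values intro: less_imp_le others_pos_w)
    then show ?thesis using X.EdgeFun_nonneg by auto
  qed
  ultimately have "Poly Y \<subseteq> ?Q" unfolding Poly_Y_eq by (rule hull_minimal[rotated])
  then show "\<forall>E. E edge_of Poly X \<longrightarrow> E \<noteq> E2 \<longrightarrow> EdgeFun X E x \<ge> 0" using \<open>x \<in> Poly Y\<close> by auto
next
  assume nonneg: "\<forall>E. E edge_of Poly X \<longrightarrow> E \<noteq> E2 \<longrightarrow> EdgeFun X E x \<ge> 0"
  show "x \<in> Poly Y"
  proof (cases "ph x \<ge> 0")
    case True
    then have "x \<in> Poly X" unfolding X.P_iff using nonneg by metis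
    then show ?thesis using X_subset_Y by blast
  next
    case False
    then obtain x' \<tau> where *: "0 \<le> \<tau>" "\<tau> \<le> 1" "x = (1 - \<tau>) *\<^sub>R w + \<tau> *\<^sub>R x'"
      and x': "p1 x' \<ge> 0" "p2 x' \<ge> 0" "ph x' = 0"
      using cone_point[of x] nonneg edges edges_distinct by (metis not_le)
    have "EdgeFun X E x' \<ge> 0" if "E edge_of Poly X" for E
      using x' others_pos[OF x'(1,2), of E] eps edge_cases[OF that] by (cases "E = E2") force+
    then have "x' \<in> Poly Y" using X.P_iff X_subset_Y by blast
    then show ?thesis
      using * convexD_alt[OF Y.convex_P w_in_Y, of x' \<tau>] by simp
  qed
qed

definition new_edge :: "plane set \<Rightarrow> plane set" where
  "new_edge E = {x \<in> Poly Y. EdgeFun X E x = 0}"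

lemma new_edge:
  assumes E: "E edge_of Poly X" "E \<noteq> E2"
  shows "new_edge E edge_of Poly Y" "old_edge X E2 (new_edge E) = E"
    "Char Y (new_edge E) = Char X E" "EdgeFun Y (new_edge E) = EdgeFun X E"
proof -
  have "new_edge E = Poly Y \<inter> {x. grad X E \<bullet> x = - EdgeFun X E 0}"
    using X.EdgeFun_grad[OF E(1), of _ 0] by (force simp: new_edge_def)
  moreover have "(Poly Y \<inter> {x. grad X E \<bullet> x = - EdgeFun X E 0}) face_of Poly Y"
  proof (rule face_of_Int_supporting_hyperplane_ge[OF Y.convex_P])
    show "- EdgeFun X E 0 \<le> grad X E \<bullet> x" if "x \<in> Poly Y" for x
      using X.EdgeFun_grad[OF E(1), of x 0] that E unfolding Poly_Y_iff by fastforce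
  qed
  ultimately have face: "new_edge E face_of Poly Y" by simp
  have sub: "E \<subseteq> new_edge E"
    using X.edge_subset[OF E(1)] X_subset_Y X.EdgeFun_edge[OF E(1)] by (auto simp: new_edge_def)
  have "aff_dim E \<le> aff_dim (new_edge E)" by (rule aff_dim_subset[OF sub])
  moreover have "new_edge E \<noteq> Poly Y"
  proof -
    obtain c where c: "c \<in> interior (Poly X)" using X.interior_P_nonempty by blast
    then have "c \<in> Poly Y" "c \<notin> new_edge E"
      using X.EdgeFun_interior[OF E(1) c] interior_subset X_subset_Y by (auto simp: new_edge_def)
    then show ?thesis by blast
  qed
  then have "aff_dim (new_edge E) < 2"
    using face_of_aff_dim_lt[OF Y.convex_P face] Y.aff_dim_P by simp
  ultimately show "new_edge E edge_of Poly Y"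
    using face E by (simp add: edge_of_def)
  show old: "old_edge X E2 (new_edge E) = E"
    unfolding old_edge_def
  proof (rule the_equality)
    show "E edge_of Poly X \<and> E \<noteq> E2 \<and> E \<subseteq> new_edge E" using E sub by simp
    fix E' assume E': "E' edge_of Poly X \<and> E' \<noteq> E2 \<and> E' \<subseteq> new_edge E"
    then have "E' \<subseteq> E"
      using X.edge_iff[OF E(1)] X.edge_subset[of E'] by (auto simp: new_edge_def)
    then show "E' = E" using X.edges_subset_eq E' E by blast
  qed
  show "Char Y (new_edge E) = Char X E" "EdgeFun Y (new_edge E) = EdgeFun X E"
    using old by (simp_all add: Y_eq blowdown_model_def)
qed

text \<open>A relative interior point of an edge lies on the boundary, so that one of the inequalities defining the
  new polygon is an equality there.\<close>

lemma edge_of_Y: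
  assumes F: "F edge_of Poly Y"
  obtains E where "E edge_of Poly X" "E \<noteq> E2" "F = new_edge E"
proof -
  have face: "F face_of Poly Y" and "convex F" "F \<noteq> {}"
    using F by (auto simp: edge_of_def face_of_imp_convex)
  then have "rel_interior F \<noteq> {}" by (simp add: rel_interior_eq_empty)
  then obtain y where y: "y \<in> rel_interior F" by blast
  then have "y \<in> F" using rel_interior_subset by blast
  then have "y \<in> Poly Y" and "y \<notin> interior (Poly Y)"
    using Y.edge_subset[OF F] Y.interior_iff[of y] F by (auto simp: edges_at_def)
  have "\<exists>E. E edge_of Poly X \<and> E \<noteq> E2 \<and> EdgeFun X E y = 0"
  proof (rule ccontr)
    assume neg: "\<nexists>E. E edge_of Poly X \<and> E \<noteq> E2 \<and> EdgeFun X E y = 0"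
    let ?Q = "\<Inter>E\<in>{E. E edge_of Poly X} - {E2}. {x. EdgeFun X E x > 0}"
    have "open ?Q"
    proof (intro open_INT ballI)
      show "finite ({E. E edge_of Poly X} - {E2})" using X.finite_edges by simp
      show "open {x. EdgeFun X E x > 0}" if "E \<in> {E. E edge_of Poly X} - {E2}" for E
        using that by (intro open_Collect_less continuous_on_const X.continuous_on_EdgeFun) auto
    qed
    moreover have "?Q \<subseteq> Poly Y"
    proof
      fix x assume x: "x \<in> ?Q"
      have "EdgeFun X E x \<ge> 0" if "E edge_of Poly X" "E \<noteq> E2" for E
        using INT_D[OF x, of E] that by simp
      then show "x \<in> Poly Y" unfolding Poly_Y_iff by blast
    qed
    moreover have "y \<in> ?Q"
    proof (rule INT_I)
      fix E assume "E \<in> {E. E edge_of Poly X} - {E2}"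
      then have "EdgeFun X E y \<ge> 0" "EdgeFun X E y \<noteq> 0" using \<open>y \<in> Poly Y\<close> neg unfolding Poly_Y_iff by auto
      then show "y \<in> {x. EdgeFun X E x > 0}" by simp
    qed
    ultimately have "y \<in> interior (Poly Y)" by (meson interiorI)
    then show False using \<open>y \<notin> interior (Poly Y)\<close> by blast
  qed
  then obtain E where E: "E edge_of Poly X" "E \<noteq> E2" "EdgeFun X E y = 0" by blast
  have "F \<subseteq> new_edge E"
  proof (rule subset_of_face_of[of _ "Poly Y"])
    show "new_edge E face_of Poly Y" using new_edge(1)[OF E(1,2)] by (simp add: edge_of_def)
    show "F \<subseteq> Poly Y" by (rule Y.edge_subset[OF F])
    have "y \<in> new_edge E" using E \<open>y \<in> Poly Y\<close> by (simp add: new_edge_def)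
    then show "new_edge E \<inter> rel_interior F \<noteq> {}" using y by blast
  qed
  then have "F = new_edge E" by (rule Y.edges_subset_eq[OF F new_edge(1)[OF E(1,2)]])
  then show ?thesis using that E by blast
qed

lemma new_edge_inj: "E edge_of Poly X \<Longrightarrow> E \<noteq> E2 \<Longrightarrow> E' edge_of Poly X \<Longrightarrow> E' \<noteq> E2 \<Longrightarrow>
    new_edge E = new_edge E' \<Longrightarrow> E = E'"
  using new_edge(2) by metis

lemma edges_at_Y:
  assumes "q \<in> Poly Y"
  shows "edges_at Y q = new_edge ` {E. E edge_of Poly X \<and> E \<noteq> E2 \<and> EdgeFun X E q = 0}"
proof
  show "edges_at Y q \<subseteq> new_edge ` {E. E edge_of Poly X \<and> E \<noteq> E2 \<and> EdgeFun X E q = 0}"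
  proof
    fix F assume "F \<in> edges_at Y q"
    then have F: "F edge_of Poly Y" "q \<in> F" by (auto simp: edges_at_def)
    obtain E where E: "E edge_of Poly X" "E \<noteq> E2" "F = new_edge E" using edge_of_Y[OF F(1)] .
    then show "F \<in> new_edge ` {E. E edge_of Poly X \<and> E \<noteq> E2 \<and> EdgeFun X E q = 0}"
      using F(2) by (auto simp: new_edge_def)
  qed
  show "new_edge ` {E. E edge_of Poly X \<and> E \<noteq> E2 \<and> EdgeFun X E q = 0} \<subseteq> edges_at Y q"
  proof
    fix F assume "F \<in> new_edge ` {E. E edge_of Poly X \<and> E \<noteq> E2 \<and> EdgeFun X E q = 0}"
    then obtain E where "E edge_of Poly X" "E \<noteq> E2" "EdgeFun X E q = 0" "F = new_edge E" by blast
    then show "F \<in> edges_at Y q"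
      using new_edge(1)[of E] assms by (simp add: edges_at_def) (simp add: new_edge_def)
  qed
qed

subsection \<open>The blowdown map on the base and on the orbifold\<close>

lemma f_away: "ph p > \<epsilon>2 \<Longrightarrow> f p = p"
  by (rule coords_determine) (simp_all add: f_values \<delta>_one)

text \<open>Since \<open>\<delta> \<le> 1\<close>, the map \<open>f\<close> moves points of the strip towards \<open>w\<close>, where the other edge functions remain
  positive.\<close>

lemma f_near:
  assumes "p \<in> Poly X" "ph p \<le> \<epsilon>2"
  shows "ph (f p) \<le> \<epsilon>2" "p1 (f p) \<ge> 0" "p2 (f p) \<ge> 0"
proof -
  have p: "p1 p \<ge> 0" "p2 p \<ge> 0" "ph p \<ge> 0" using X.EdgeFun_nonneg assms edges by auto
  then have d: "0 \<le> \<delta> (ph p)" "\<delta> (ph p) \<le> 1" using \<delta>_nonneg \<delta>_le_1 by auto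
  show "p1 (f p) \<ge> 0" "p2 (f p) \<ge> 0" using p d by (simp_all add: f_values)
  have "p1 (f p) \<le> p1 p" "p2 (f p) \<le> p2 p"
    using p d by (auto simp: f_values intro!: mult_left_le_one_le power_le_one)
  then have "ph (f p) \<le> ph p" using st by (simp add: coords add_mono)
  then show "ph (f p) \<le> \<epsilon>2" using assms by simp
qed

lemma f_others:
  assumes "p \<in> Poly X" "E \<in> others"
  shows "EdgeFun X E (f p) \<ge> 0" "EdgeFun X E (f p) = 0 \<longleftrightarrow> EdgeFun X E p = 0"
proof -
  have edge: "E edge_of Poly X" using assms by (simp add: others_def)
  have "EdgeFun X E (f p) \<ge> 0 \<and> (EdgeFun X E (f p) = 0 \<longleftrightarrow> EdgeFun X E p = 0)"
  proof (cases "ph p > \<epsilon>2")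
    case True
    then show ?thesis using f_away X.EdgeFun_nonneg[OF edge assms(1)] by simp
  next
    case False
    then have "EdgeFun X E p > 0"
      using others_pos[of p E] X.EdgeFun_nonneg assms edges by simp
    moreover have "EdgeFun X E (f p) > 0"
      using others_pos[of "f p" E] f_near[OF assms(1)] assms(2) False by simp
    ultimately show ?thesis by simp
  qed
  then show "EdgeFun X E (f p) \<ge> 0" "EdgeFun X E (f p) = 0 \<longleftrightarrow> EdgeFun X E p = 0" by auto
qed

lemma f_in_Y:
  assumes "p \<in> Poly X"
  shows "f p \<in> Poly Y"
  unfolding Poly_Y_iff
proof (intro allI impI)
  fix E assume E: "E edge_of Poly X" "E \<noteq> E2"
  have p: "p1 p \<ge> 0" "p2 p \<ge> 0" "ph p \<ge> 0" using X.EdgeFun_nonneg assms edges by auto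
  show "EdgeFun X E (f p) \<ge> 0"
    by (rule edge_cases[OF E]) (use p f_others[OF assms] \<delta>_nonneg in \<open>auto simp: f_values\<close>)
qed

lemma f_zero_iff:
  assumes "p \<in> Poly X" "ph p > 0" and E: "E edge_of Poly X" "E \<noteq> E2"
  shows "EdgeFun X E (f p) = 0 \<longleftrightarrow> EdgeFun X E p = 0"
  by (rule edge_cases[OF E]) (use f_others[OF assms(1)] \<delta>_pos[OF assms(2)] in \<open>auto simp: f_values\<close>)

lemma f_E2: "ph p = 0 \<Longrightarrow> f p = w"
  using dets(4) by (intro coords_determine) (simp_all add: f_values w_values \<delta>_0)

lemma continuous_f: "continuous_on (Poly X) f"
proof -
  have ph: "continuous_on (Poly X) (\<lambda>p. \<delta> (ph p))"
    using X.EdgeFun_nonneg edges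
    by (intro continuous_on_compose2[OF continuous_\<delta> X.continuous_on_EdgeFun]) auto
  have "continuous_on (Poly X) (\<lambda>p. at_coords (\<delta> (ph p) ^ k * p1 p, \<delta> (ph p) * p2 p))"
    by (intro continuous_on_compose2[OF smooth_on_imp_continuous_on[OF smooth_at_coords] _ subset_UNIV]
        continuous_intros ph X.continuous_on_EdgeFun edges)
  then show ?thesis by (rule continuous_on_eq) (simp add: f_eq)
qed

text \<open>The map \<open>f\<close> carries each edge other than \<open>E2\<close> into the edge of \<open>Y\<close> with the same characteristic vector, and
  over \<open>w\<close> the isotropy group is the whole torus because \<open>m \<noteq> 0\<close>. Hence \<open>\<rho>\<close> respects the identifications.\<close>

lemma stab_subset:
  assumes p: "p \<in> Poly X"
  shows "stab X p \<subseteq> stab Y (f p)"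
proof (cases "ph p = 0")
  case True
  have edgesw: "new_edge E1 \<in> edges_at Y w" "new_edge E3 \<in> edges_at Y w"
    unfolding edges_at_Y[OF w_in_Y] using edges edges_distinct w_values by auto
  have "c1 \<in> stab Y w" "c3 \<in> stab Y w"
    unfolding stab_def
    using edgesw new_edge(3)[of E1] new_edge(3)[of E3] edges edges_distinct
    by (metis image_eqI span_base)+
  then have "u \<in> stab Y w" for u
  proof -
    have "u = (det2 u c3 / det2 c1 c3) *\<^sub>R c1 + (det2 c1 u / det2 c1 c3) *\<^sub>R c3"
      using m_pos by (intro cramer) (simp add: dets_lat)
    then show ?thesis
      using \<open>c1 \<in> stab Y w\<close> \<open>c3 \<in> stab Y w\<close>
      by (metis Y.subspace_stab subspace_add subspace_scale)
  qed
  then show ?thesis using f_E2[OF True] by auto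
next
  case False
  then have "ph p > 0" using X.EdgeFun_nonneg[OF edges(2) p] by simp
  have "Char X ` edges_at X p \<subseteq> Char Y ` edges_at Y (f p)"
  proof
    fix c assume "c \<in> Char X ` edges_at X p"
    then obtain E where E: "E edge_of Poly X" "p \<in> E" "c = Char X E" by (auto simp: edges_at_def)
    have "EdgeFun X E p = 0" by (rule X.EdgeFun_edge[OF E(1,2)])
    moreover from this have "E \<noteq> E2" using False by auto
    ultimately have "new_edge E \<in> edges_at Y (f p)"
      unfolding edges_at_Y[OF f_in_Y[OF p]] using f_zero_iff[OF p \<open>ph p > 0\<close>] E by auto
    then show "c \<in> Char Y ` edges_at Y (f p)"
      using new_edge(3)[OF E(1) \<open>E \<noteq> E2\<close>] E(3) by force
  qed
  then show ?thesis unfolding stab_def by (intro span_mono image_mono)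
qed

lemma rho_orb_class:
  assumes p: "p \<in> Poly X"
  shows "\<rho> (orb_class X (p, u)) = orb_class Y (f p, u)"
proof -
  let ?c = "(\<lambda>(p, u). (f p, u)) ` orb_class X (p, u)"
  have fp: "f p \<in> Poly Y" by (rule f_in_Y[OF p])
  have sub: "orb_rel Y `` {x} = orb_class Y (f p, u)" if "x \<in> ?c" for x
  proof -
    from that obtain q where q: "q \<in> orb_class X (p, u)" "x = (\<lambda>(p, u). (f p, u)) q"
      by blast
    from q(1) obtain u' a n where "q = (p, u')" and a: "a \<in> stab X p" "u - u' = a + lat n"
      unfolding X.orb_class_eq[OF p] by blast
    with q(2) have x: "x = (f p, u')" by simp
    have "((f p, u), (f p, u')) \<in> orb_rel Y"
      using a stab_subset[OF p] fp by (auto simp: Y.orb_rel_eq)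
    then show ?thesis
      unfolding x orb_class_def by (rule equiv_class_eq[OF Y.equiv_orb_rel, symmetric])
  qed
  have "(f p, u) \<in> ?c" using X.orb_class_self[OF p, of u] by force
  then have "?c \<noteq> {}" by blast
  have "orb_rel Y `` ?c = (\<Union>x\<in>?c. orb_rel Y `` {x})" by (rule Image_eq_UN)
  also have "\<dots> = (\<Union>x\<in>?c. orb_class Y (f p, u))" by (rule SUP_cong[OF refl sub])
  also have "\<dots> = orb_class Y (f p, u)" using \<open>?c \<noteq> {}\<close> by (simp only: UN_constant if_False)
  finally have "orb_rel Y `` ?c = orb_class Y (f p, u)" .
  moreover have "\<rho> (orb_class X (p, u)) = orb_rel Y `` ?c"
    by (simp only: rho_def blowdown_map_def Y_eq f_def)
  ultimately show ?thesis by simp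
qed

lemma continuous_map_rho: "continuous_map (orb_topology X) (orb_topology Y) \<rho>"
  unfolding continuous_map_def X.topspace_orb_topology Y.topspace_orb_topology
proof (intro conjI allI impI)
  show "\<rho> \<in> orb X \<rightarrow> orb Y"
    using rho_orb_class f_in_Y by (auto simp: X.orb_eq Y.orb_eq)
  fix V assume V: "openin (orb_topology Y) V"
  then have "openin (top_of_set (Poly Y \<times> UNIV)) {x \<in> Poly Y \<times> UNIV. orb_class Y x \<in> V}"
    by (simp add: Y.openin_orb_topology)
  moreover have "continuous_on (Poly X \<times> UNIV) (\<lambda>x. (f (fst x), snd x))"
    by (intro continuous_intros continuous_on_compose2[OF continuous_f]) auto
  moreover have "(\<lambda>x. (f (fst x), snd x)) \<in> Poly X \<times> UNIV \<rightarrow> Poly Y \<times> UNIV" using f_in_Y by auto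
  ultimately have "openin (top_of_set (Poly X \<times> UNIV)) ((Poly X \<times> UNIV) \<inter>
      (\<lambda>x. (f (fst x), snd x)) -` {x \<in> Poly Y \<times> UNIV. orb_class Y x \<in> V})"
    by (intro continuous_openin_preimage)
  moreover have "(Poly X \<times> UNIV) \<inter> (\<lambda>x. (f (fst x), snd x)) -` {x \<in> Poly Y \<times> UNIV. orb_class Y x \<in> V}
      = {x \<in> Poly X \<times> UNIV. orb_class X x \<in> {x \<in> orb X. \<rho> x \<in> V}}"
    using f_in_Y rho_orb_class by (auto simp: X.orb_eq)
  ultimately show "openin (orb_topology X) {x \<in> orb X. \<rho> x \<in> V}"
    unfolding X.openin_orb_topology by auto
qed

end

section \<open>Local lifts of the blowdown\<close>

lemma smooth_on_powr_fun:
  fixes g :: "'a::euclidean_space \<Rightarrow> real"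
  assumes "open S" "smooth_on S g" "\<And>x. x \<in> S \<Longrightarrow> g x > 0"
  shows "smooth_on S (\<lambda>x. g x powr a)"
  using assms by (intro smooth_on_compose[OF _ open_greaterThan _ smooth_on_powr]) auto

lemma smooth_on_sqrt:
  fixes g :: "'a::euclidean_space \<Rightarrow> real"
  assumes "open S" "smooth_on S g" "\<And>x. x \<in> S \<Longrightarrow> g x > 0"
  shows "smooth_on S (\<lambda>x. sqrt (g x))"
  using smooth_on_cong[OF assms(1) _ smooth_on_powr_fun[OF assms, of "1 / 2"]] assms(3)
  by (simp add: powr_half_sqrt less_imp_le)

lemma smooth_on_divide:
  fixes f g :: "'a::euclidean_space \<Rightarrow> real"
  assumes "open S" "smooth_on S f" "smooth_on S g" "\<And>x. x \<in> S \<Longrightarrow> g x > 0"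
  shows "smooth_on S (\<lambda>x. f x / g x)"
proof (rule smooth_on_cong[OF assms(1) _ smooth_on_mult[OF assms(1,2) smooth_on_powr_fun[OF assms(1,3,4), of "- 1"]]])
  show "f x * g x powr - 1 = f x / g x" if "x \<in> S" for x
    using assms(4)[OF that] by (simp add: powr_minus_divide)
qed

lemma smooth_on_of_real:
  "open S \<Longrightarrow> smooth_on S f \<Longrightarrow> smooth_on S (\<lambda>x. complex_of_real (f x))"
  by (rule smooth_on_bounded_linear[OF bounded_linear_of_real])

text \<open>A logarithm on the plane slit opposite to \<open>c\<close> supplies a branch of the \<open>m\<close>-th root near \<open>c\<close>, together with
  the argument \<open>\<theta>\<close> that it divides by \<open>m\<close>.\<close>

lemma root_branch:
  fixes c :: complex and m :: nat
  assumes "c \<noteq> 0" "m > 0"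
  obtains T \<beta> where "open T" "c \<in> T" "0 \<notin> T" "\<beta> holomorphic_on T"
    "\<And>y. y \<in> T \<Longrightarrow> \<exists>\<theta>. y = of_real (cmod y) * cis \<theta> \<and>
       \<beta> y = of_real (cmod y powr (1 / real m)) * cis (\<theta> / real m)"
proof
  define e where "e = cis (Arg c)"
  define T where "T = (\<lambda>y. y / e) -` (- \<real>\<^sub>\<le>\<^sub>0)"
  define \<beta> where "\<beta> y = exp ((Ln (y / e) + \<i> * of_real (Arg c)) / of_nat m)" for y
  have e: "e \<noteq> 0" "cmod e = 1" by (simp_all add: e_def)
  show "open T"
    unfolding T_def using e
    by (intro open_vimage continuous_intros) (auto simp: closed_nonpos_Reals_complex open_Compl)
  have "c = of_real (cmod c) * e" unfolding e_def using rcis_cmod_Arg[of c] by (simp add: rcis_def)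
  then have "c / e = of_real (cmod c)" using e by (metis nonzero_mult_div_cancel_right)
  then show "c \<in> T" using assms(1) by (simp add: T_def)
  show "0 \<notin> T" by (simp add: T_def)
  show "\<beta> holomorphic_on T"
    unfolding \<beta>_def using e assms(2) by (intro holomorphic_intros) (auto simp: T_def)
  fix y assume "y \<in> T"
  then have "y \<noteq> 0" using \<open>0 \<notin> T\<close> by auto
  define u where "u = y / e"
  define \<theta> where "\<theta> = Arg u + Arg c"
  have u: "u \<noteq> 0" "cmod u = cmod y" using \<open>y \<noteq> 0\<close> e by (simp_all add: u_def norm_divide)
  have "y = u * e" using e by (simp add: u_def)
  also have "u = of_real (cmod y) * cis (Arg u)" using rcis_cmod_Arg[of u] u by (simp add: rcis_def)
  finally have 1: "y = of_real (cmod y) * cis \<theta>" by (simp add: e_def \<theta>_def cis_mult mult.assoc)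
  have "Ln u = of_real (ln (cmod y)) + \<i> * of_real (Arg u)"
    using u Arg_eq_Im_Ln[OF u(1)] Re_Ln[OF u(1)] by (intro complex_eqI) simp_all
  then have "(Ln u + \<i> * of_real (Arg c)) / of_nat m = of_real (ln (cmod y) / m) + \<i> * of_real (\<theta> / m)"
    by (simp add: \<theta>_def add_divide_distrib distrib_left)
  then have "\<beta> y = exp (of_real (ln (cmod y) / m) + \<i> * of_real (\<theta> / m))"
    unfolding \<beta>_def u_def[symmetric] by (rule arg_cong)
  also have "\<dots> = of_real (exp (ln (cmod y) / m)) * cis (\<theta> / m)"
    by (simp only: exp_add exp_of_real cis_conv_exp)
  also have "exp (ln (cmod y) / m) = cmod y powr (1 / real m)"
    using \<open>y \<noteq> 0\<close> by (simp add: powr_def)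
  finally show "\<exists>\<theta>. y = of_real (cmod y) * cis \<theta> \<and>
      \<beta> y = of_real (cmod y powr (1 / real m)) * cis (\<theta> / real m)" using 1 by blast
qed

context blowdown
begin

lemma vertex_on_E2: "V \<in> vertices (Poly X) \<Longrightarrow> V \<in> E2 \<Longrightarrow> V = v1 \<or> V = v2" for V
proof (rule ccontr)
  assume V: "V \<in> vertices (Poly X)" "V \<in> E2" and neq: "\<not> (V = v1 \<or> V = v2)"
  have "ph V = 0" by (rule X.EdgeFun_edge[OF edges(2) V(2)])
  then have sum: "p2 V + s * p1 V = t" using coords[of V] by simp
  have nonneg: "p1 V \<ge> 0" "p2 V \<ge> 0" using X.EdgeFun_nonneg X.vertex_in_P[OF V(1)] edges by auto
  define \<tau> where "\<tau> = s * p1 V / t"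
  have "\<tau> * (t / s) = p1 V" "\<tau> * t = s * p1 V" using st by (simp_all add: \<tau>_def)
  moreover from this have "(1 - \<tau>) * t = p2 V" using sum by (simp add: left_diff_distrib)
  ultimately have eq: "V = (1 - \<tau>) *\<^sub>R v1 + \<tau> *\<^sub>R v2"
    by (intro coords_determine) (simp_all add: X.EdgeFun_convex_combination edges v_values)
  have \<tau>: "0 \<le> \<tau>" "\<tau> \<le> 1" using sum nonneg st by (auto simp: \<tau>_def)
  moreover have "\<tau> \<noteq> 0" "\<tau> \<noteq> 1" using eq neq by auto
  moreover have "v1 \<noteq> v2" using v_values st by auto
  ultimately have "0 < \<tau>" "\<tau> < 1" "v1 \<noteq> v2" by auto
  then have "V \<in> open_segment v1 v2" unfolding in_segment using eq by blast
  then show False using V(1) v_in_X by (auto simp: vertices_def extreme_point_of_def)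
qed

lemma w_edges: "new_edge E1 \<in> edges_at Y w" "new_edge E3 \<in> edges_at Y w"
  unfolding edges_at_Y[OF w_in_Y] using edges edges_distinct w_values by auto

lemma w_vertex: "w \<in> vertices (Poly Y)"
  using Y.vertexI[OF w_edges] new_edge_inj edges edges_distinct by blast

sublocale W: quasitoric_vertex Y w "new_edge E1" "new_edge E3" c1 c3
proof unfold_locales
  have "det2 (Char Y (new_edge E1)) (Char Y (new_edge E3)) > 0"
    using new_edge(3)[of E1] new_edge(3)[of E3] edges edges_distinct dets m_pos by simp
  from Y.edge12_eqI[OF w_vertex w_edges this]
  show "new_edge E1 = edge1 (Poly Y) w" "new_edge E3 = edge2 (Poly Y) w" by auto
  show "c1 = lat (Char Y (new_edge E1))" "c3 = lat (Char Y (new_edge E3))"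
    using new_edge(3)[of E1] new_edge(3)[of E3] edges edges_distinct by simp_all
qed (rule w_vertex)

lemma f_in_U_vertex:
  assumes "v \<in> Poly X" "p \<in> U_vertex (Poly X) v" "ph p > 0" "u \<in> Poly Y"
    and "\<And>E. E \<in> edges_at X v \<Longrightarrow> E \<noteq> E2 \<Longrightarrow> EdgeFun X E u = 0"
  shows "f p \<in> U_vertex (Poly Y) u"
proof -
  have p: "p \<in> Poly X" "edges_at X p \<subseteq> edges_at X v"
    using assms(2) X.U_vertex_iff[OF assms(1)] by auto
  have "edges_at Y (f p) \<subseteq> edges_at Y u"
  proof
    fix F assume "F \<in> edges_at Y (f p)"
    then obtain E where E: "E edge_of Poly X" "E \<noteq> E2" "EdgeFun X E (f p) = 0" "F = new_edge E"
      unfolding edges_at_Y[OF f_in_Y[OF p(1)]] by blast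
    then have "E \<in> edges_at X p"
      using f_zero_iff[OF p(1) assms(3)] X.edge_iff p(1) by (simp add: edges_at_def)
    then have "EdgeFun X E u = 0" using p assms(5) E by blast
    then show "F \<in> edges_at Y u" unfolding edges_at_Y[OF assms(4)] using E by blast
  qed
  then show ?thesis using Y.U_vertex_iff[OF assms(4)] f_in_Y[OF p(1)] by blast
qed

text \<open>A map of charts lifts \<open>\<rho>\<close> if it transforms the base point by \<open>f\<close> and keeps some representative of the angles
  in \<open>N \<otimes> \<real>\<close>.\<close>

lemma is_liftI:
  assumes v: "v \<in> vertices (Poly X)" and u: "u \<in> vertices (Poly Y)"
    and "open D" "D \<subseteq> chart_dom X v" "smooth_on D \<phi>"
    and lift: "\<And>z. z \<in> D \<Longrightarrow> \<exists>p \<tau>. p \<in> U_vertex (Poly X) v \<and> f p \<in> U_vertex (Poly Y) u \<and>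
      z = torus_coord X v (p, \<tau>) \<and> \<phi> z = torus_coord Y u (f p, \<tau>)"
  shows "is_lift X v Y u \<rho> D \<phi>"
proof -
  interpret V: quasitoric_vertex X v "edge1 (Poly X) v" "edge2 (Poly X) v"
    "lat (Char X (edge1 (Poly X) v))" "lat (Char X (edge2 (Poly X) v))"
    by unfold_locales (use v in auto)
  interpret U: quasitoric_vertex Y u "edge1 (Poly Y) u" "edge2 (Poly Y) u"
    "lat (Char Y (edge1 (Poly Y) u))" "lat (Char Y (edge2 (Poly Y) u))"
    by unfold_locales (use u in auto)
  have "\<phi> z \<in> chart_dom Y u \<and> chart_map Y u (\<phi> z) = \<rho> (chart_map X v z)" if "z \<in> D" for z
  proof -
    from lift[OF that] obtain p \<tau> where *: "p \<in> U_vertex (Poly X) v" "f p \<in> U_vertex (Poly Y) u"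
      "z = torus_coord X v (p, \<tau>)" "\<phi> z = torus_coord Y u (f p, \<tau>)"
      by blast
    have "p \<in> Poly X" using *(1) V.U_vertex_subset by blast
    then have "chart_map Y u (\<phi> z) = \<rho> (chart_map X v z)"
      using U.chart_map_torus_coord[OF *(2), of \<tau>] V.chart_map_torus_coord[OF *(1), of \<tau>]
        rho_orb_class by (simp add: *(3)[symmetric] *(4)[symmetric])
    moreover have "\<phi> z \<in> chart_dom Y u" unfolding *(4) U.chart_dom_eq using *(2) by (intro imageI) simp
    ultimately show ?thesis by blast
  qed
  then show ?thesis using assms(3-5) by (auto simp: is_lift_def)
qed

text \<open>One coordinate \<open>y\<close> of the chart at \<open>v1\<close> or \<open>v2\<close> vanishes on \<open>E2\<close>; for it, \<open>\<bar>y\<bar>\<^sup>2\<close> is \<open>p\<close>-hat. The function \<open>\<gamma>\<close> is a branch of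
  \<open>\<surd>(\<delta>(\<bar>y\<bar>\<^sup>2)) (y / \<bar>y\<bar>)\<^bsup>1/m\<^esup>\<close>, from which the lifts of \<open>\<rho>\<close> near \<open>E2\<close> are built.\<close>

lemma unit_root:
  fixes c :: complex
  assumes "c \<noteq> 0"
  obtains T \<gamma> where "open T" "c \<in> T" "0 \<notin> T" "smooth_on T \<gamma>"
    "\<And>y. y \<in> T \<Longrightarrow> \<exists>\<theta>. y = of_real (cmod y) * cis \<theta> \<and>
       \<gamma> y = of_real (sqrt (\<delta> ((cmod y)\<^sup>2))) * cis (\<theta> / real m)"
proof -
  obtain T \<beta> where T: "open T" "c \<in> T" "0 \<notin> T" and \<beta>: "\<beta> holomorphic_on T"
    and branch: "\<And>y. y \<in> T \<Longrightarrow> \<exists>\<theta>. y = of_real (cmod y) * cis \<theta> \<and>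
       \<beta> y = of_real (cmod y powr (1 / real m)) * cis (\<theta> / real m)"
    by (rule root_branch[OF assms m_pos]) (rule that)
  (* The factor that corrects the modulus of the root of y. *)
  define \<kappa> where "\<kappa> y = sqrt (\<delta> ((cmod y)\<^sup>2)) * ((cmod y)\<^sup>2) powr (- (1 / (2 * real m)))" for y :: complex
  have sq: "(cmod y)\<^sup>2 > 0" if "y \<in> T" for y using T(3) that by auto
  have sm: "smooth_on T (\<lambda>y. (cmod y)\<^sup>2)" by (intro smooth_on_cmod_square smooth_on_ident T(1))
  have sm': "smooth_on T (\<lambda>y. \<delta> ((cmod y)\<^sup>2))"
    by (rule smooth_on_compose[OF T(1) open_greaterThan _ \<delta>_smooth sm]) (use sq in auto)
  have "smooth_on T \<kappa>"
    unfolding \<kappa>_def by (intro smooth_on_mult T(1) smooth_on_sqrt sm' smooth_on_powr_fun sm)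
      (use T(3) in \<open>auto intro!: \<delta>_pos\<close>)
  then have "smooth_on T (\<lambda>y. \<beta> y * of_real (\<kappa> y))"
    by (intro smooth_on_mult T(1) smooth_on_holomorphic \<beta> smooth_on_of_real)
  moreover have "\<exists>\<theta>. y = of_real (cmod y) * cis \<theta> \<and>
       \<beta> y * of_real (\<kappa> y) = of_real (sqrt (\<delta> ((cmod y)\<^sup>2))) * cis (\<theta> / real m)" if "y \<in> T" for y
  proof -
    obtain \<theta> where \<theta>: "y = of_real (cmod y) * cis \<theta>" "\<beta> y = of_real (cmod y powr (1 / real m)) * cis (\<theta> / real m)"
      using branch[OF \<open>y \<in> T\<close>] by blast
    have "cmod y > 0" using T(3) that by auto
    then have "((cmod y)\<^sup>2) powr (- (1 / (2 * real m))) = cmod y powr (- (1 / real m))"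
      by (simp add: powr_powr flip: powr_numeral)
    then have "cmod y powr (1 / real m) * \<kappa> y = sqrt (\<delta> ((cmod y)\<^sup>2))"
      using \<open>cmod y > 0\<close> by (simp add: \<kappa>_def powr_minus field_simps)
    then have "of_real (sqrt (\<delta> ((cmod y)\<^sup>2))) = complex_of_real (cmod y powr (1 / real m)) * of_real (\<kappa> y)"
      by (metis of_real_mult)
    then have "\<beta> y * of_real (\<kappa> y) = of_real (sqrt (\<delta> ((cmod y)\<^sup>2))) * cis (\<theta> / real m)"
      by (simp only: \<theta>(2) mult_ac)
    with \<theta>(1) show ?thesis by blast
  qed
  ultimately show ?thesis using that[OF T] by blast
qed

lemma smooth_on_EdgeFun:
  fixes g :: "C2 \<Rightarrow> plane"
  assumes "E edge_of Poly X" "open S" "smooth_on S g"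
  shows "smooth_on S (\<lambda>z. EdgeFun X E (g z))"
proof (rule smooth_on_cong[OF assms(2)])
  show "smooth_on S (\<lambda>z. EdgeFun X E 0 + grad X E \<bullet> g z)"
    by (intro smooth_on_add smooth_on_const assms smooth_on_bounded_linear[OF bounded_linear_inner_right])
  show "EdgeFun X E 0 + grad X E \<bullet> g z = EdgeFun X E (g z)" for z
    using X.EdgeFun_grad[OF assms(1), of "g z" 0] by simp
qed

lemma smooth_on_f:
  fixes g :: "C2 \<Rightarrow> plane"
  assumes "open S" "smooth_on S g" "\<And>z. z \<in> S \<Longrightarrow> ph (g z) > 0"
  shows "smooth_on S (\<lambda>z. \<delta> (ph (g z)))" "smooth_on S (\<lambda>z. f (g z))"
proof -
  show d: "smooth_on S (\<lambda>z. \<delta> (ph (g z)))"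
    by (rule smooth_on_compose[OF assms(1) open_greaterThan _ \<delta>_smooth smooth_on_EdgeFun[OF edges(2) assms(1,2)]])
      (use assms(3) in auto)
  show "smooth_on S (\<lambda>z. f (g z))"
    unfolding f_eq
    by (intro smooth_on_compose[OF _ open_UNIV _ smooth_at_coords] smooth_on_Pair smooth_on_mult
        smooth_on_power d smooth_on_EdgeFun edges assms) simp
qed

text \<open>Expressing the angles at \<open>w\<close> by those at \<open>v1\<close> gives \<open>q\<^sub>1(w) = q\<^sub>1 + (k/m) q\<^sub>2\<close> and \<open>q\<^sub>2(w) = q\<^sub>2 / m\<close>. The branch
  \<open>\<gamma>\<close> in the second coordinate therefore enters the lift with exponents \<open>k\<close> and \<open>1\<close>.\<close>

lemma lift_v1:
  assumes z0: "z0 \<in> chart_dom X v1" "ph (base X v1 z0) > 0"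
  shows "\<exists>D \<phi>. z0 \<in> D \<and> is_lift X v1 Y w \<rho> D \<phi> \<and> (\<forall>z\<in>D. ph (base X v1 z) > 0)"
proof -
  have "snd z0 \<noteq> 0" using z0(2) by (auto simp: V1.EdgeFun_base)
  then obtain T \<gamma> where T: "open T" "snd z0 \<in> T" "0 \<notin> T" "smooth_on T \<gamma>"
    and branch: "\<And>y. y \<in> T \<Longrightarrow> \<exists>\<theta>. y = of_real (cmod y) * cis \<theta> \<and>
       \<gamma> y = of_real (sqrt (\<delta> ((cmod y)\<^sup>2))) * cis (\<theta> / real m)"
    using unit_root by blast
  define D where "D = chart_dom X v1 \<inter> snd -` T"
  define \<phi> where "\<phi> z = (fst z * \<gamma> (snd z) ^ k, \<gamma> (snd z) * of_real (sqrt (p2 (base X v1 z))))" for z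
  have "open D" unfolding D_def by (intro open_Int V1.open_chart_dom open_vimage_snd T)
  have p2: "p2 (base X v1 z) > 0" if "z \<in> D" for z
    using that V1.chart_dom_iff_base[of z] V1.U_vertex_iff_pos[of "base X v1 z"] edges edges_distinct
    by (auto simp: D_def)
  have ph: "ph (base X v1 z) > 0" if "z \<in> D" for z using that T(3) by (auto simp: D_def V1.EdgeFun_base)
  have smb: "smooth_on D (base X v1)" using smooth_on_subset[OF V1.smooth_on_base] by simp
  have sm\<gamma>: "smooth_on D (\<lambda>z. \<gamma> (snd z))"
    by (intro smooth_on_compose[OF \<open>open D\<close> T(1) _ T(4)] smooth_on_bounded_linear[OF bounded_linear_snd]
        smooth_on_ident \<open>open D\<close>) (auto simp: D_def)
  have "smooth_on D \<phi>"
    unfolding \<phi>_def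
    by (intro smooth_on_Pair smooth_on_mult smooth_on_power sm\<gamma> smooth_on_of_real smooth_on_sqrt
        smooth_on_EdgeFun edges smb smooth_on_bounded_linear[OF bounded_linear_fst] smooth_on_ident \<open>open D\<close> p2)
  have "is_lift X v1 Y w \<rho> D \<phi>"
  proof (rule is_liftI[OF v_vertices(1) w_vertex \<open>open D\<close> _ \<open>smooth_on D \<phi>\<close>])
    fix z assume z: "z \<in> D"
    let ?p = "base X v1 z"
    have U: "?p \<in> U_vertex (Poly X) v1" using z V1.chart_dom_iff_base by (simp add: D_def)
    obtain \<theta> where \<theta>: "snd z = of_real (cmod (snd z)) * cis \<theta>"
      "\<gamma> (snd z) = of_real (sqrt (\<delta> ((cmod (snd z))\<^sup>2))) * cis (\<theta> / real m)"
      using branch[of "snd z"] z by (auto simp: D_def)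
    define \<psi> where "\<psi> = Arg (fst z)"
    have \<psi>: "fst z = of_real (cmod (fst z)) * cis \<psi>" unfolding \<psi>_def by (rule polar)
    define \<tau> where "\<tau> = (\<psi> / (2 * pi)) *\<^sub>R c1 + (\<theta> / (2 * pi)) *\<^sub>R c2"
    have "z = (of_real (cmod (fst z)) * cis \<psi>, of_real (cmod (snd z)) * cis \<theta>)"
      using \<theta>(1) \<psi> by (simp add: prod_eq_iff)
    from V1.torus_coord_base[OF this] have z_eq: "torus_coord X v1 (?p, \<tau>) = z"
      by (simp add: \<tau>_def)
    have angles: "2 * pi * angle1 Y w \<tau> = \<psi> + real k * (\<theta> / real m)" "2 * pi * angle2 Y w \<tau> = \<theta> / real m"
      using m_pos by (simp_all add: W.angle_eq \<tau>_def det2_linear dets_lat field_simps)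
    have \<gamma>: "\<gamma> (snd z) = of_real (sqrt (\<delta> (ph ?p))) * cis (\<theta> / real m)" using \<theta>(2) by (simp add: V1.EdgeFun_base)
    have "fst z = of_real (sqrt (p1 ?p)) * cis \<psi>" using \<psi> by (simp add: V1.EdgeFun_base)
    moreover have "cis (2 * pi * angle1 Y w \<tau>) = cis \<psi> * cis (\<theta> / real m) ^ k"
      unfolding angles by (simp only: Complex.DeMoivre cis_mult)
    ultimately have "fst z * \<gamma> (snd z) ^ k = of_real (sqrt (p1 (f ?p))) * cis (2 * pi * angle1 Y w \<tau>)"
      unfolding \<gamma> by (simp add: f_values real_sqrt_mult real_sqrt_power power_mult_distrib)
    moreover have "\<gamma> (snd z) * of_real (sqrt (p2 ?p)) = of_real (sqrt (p2 (f ?p))) * cis (2 * pi * angle2 Y w \<tau>)"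
      unfolding angles \<gamma> by (simp add: f_values real_sqrt_mult mult_ac)
    ultimately have "\<phi> z = torus_coord Y w (f ?p, \<tau>)"
      using new_edge(4)[of E1] new_edge(4)[of E3] edges edges_distinct
      by (simp add: \<phi>_def torus_coord_def W.A[symmetric] W.B[symmetric])
    moreover have "f ?p \<in> U_vertex (Poly Y) w"
      using V1.vertex_AB(1) by (intro f_in_U_vertex[OF v_in_X(1) U ph[OF z] w_in_Y]) (auto simp: w_values)
    ultimately show "\<exists>p \<tau>. p \<in> U_vertex (Poly X) v1 \<and> f p \<in> U_vertex (Poly Y) w \<and>
        z = torus_coord X v1 (p, \<tau>) \<and> \<phi> z = torus_coord Y w (f p, \<tau>)"
      using U z_eq by metis
  qed (auto simp: D_def)
  moreover have "z0 \<in> D" using z0 T by (simp add: D_def)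
  ultimately show ?thesis using ph by blast
qed

text \<open>Here \<open>q\<^sub>1(w) = (k/m) q\<^sub>1\<close> and \<open>q\<^sub>2(w) = q\<^sub>2 + q\<^sub>1 / m\<close> in terms of the angles at \<open>v2\<close>, and it is the first coordinate
  that vanishes on \<open>E2\<close>.\<close>

lemma lift_v2:
  assumes z0: "z0 \<in> chart_dom X v2" "ph (base X v2 z0) > 0"
  shows "\<exists>D \<phi>. z0 \<in> D \<and> is_lift X v2 Y w \<rho> D \<phi> \<and> (\<forall>z\<in>D. ph (base X v2 z) > 0)"
proof -
  have "fst z0 \<noteq> 0" using z0(2) by (auto simp: V2.EdgeFun_base)
  then obtain T \<gamma> where T: "open T" "fst z0 \<in> T" "0 \<notin> T" "smooth_on T \<gamma>"
    and branch: "\<And>y. y \<in> T \<Longrightarrow> \<exists>\<theta>. y = of_real (cmod y) * cis \<theta> \<and>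
       \<gamma> y = of_real (sqrt (\<delta> ((cmod y)\<^sup>2))) * cis (\<theta> / real m)"
    using unit_root by blast
  define D where "D = chart_dom X v2 \<inter> fst -` T"
  define \<phi> where "\<phi> z = (\<gamma> (fst z) ^ k * of_real (sqrt (p1 (base X v2 z))), snd z * \<gamma> (fst z))" for z
  have "open D" unfolding D_def by (intro open_Int V2.open_chart_dom open_vimage_fst T)
  have p1: "p1 (base X v2 z) > 0" if "z \<in> D" for z
    using that V2.chart_dom_iff_base[of z] V2.U_vertex_iff_pos[of "base X v2 z"] edges edges_distinct
    by (auto simp: D_def)
  have ph: "ph (base X v2 z) > 0" if "z \<in> D" for z using that T(3) by (auto simp: D_def V2.EdgeFun_base)
  have smb: "smooth_on D (base X v2)" using smooth_on_subset[OF V2.smooth_on_base] by simp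
  have sm\<gamma>: "smooth_on D (\<lambda>z. \<gamma> (fst z))"
    by (intro smooth_on_compose[OF \<open>open D\<close> T(1) _ T(4)] smooth_on_bounded_linear[OF bounded_linear_fst]
        smooth_on_ident \<open>open D\<close>) (auto simp: D_def)
  have "smooth_on D \<phi>"
    unfolding \<phi>_def
    by (intro smooth_on_Pair smooth_on_mult smooth_on_power sm\<gamma> smooth_on_of_real smooth_on_sqrt
        smooth_on_EdgeFun edges smb smooth_on_bounded_linear[OF bounded_linear_snd] smooth_on_ident \<open>open D\<close> p1)
  have "is_lift X v2 Y w \<rho> D \<phi>"
  proof (rule is_liftI[OF v_vertices(2) w_vertex \<open>open D\<close> _ \<open>smooth_on D \<phi>\<close>])
    fix z assume z: "z \<in> D"
    let ?p = "base X v2 z"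
    have U: "?p \<in> U_vertex (Poly X) v2" using z V2.chart_dom_iff_base by (simp add: D_def)
    obtain \<theta> where \<theta>: "fst z = of_real (cmod (fst z)) * cis \<theta>"
      "\<gamma> (fst z) = of_real (sqrt (\<delta> ((cmod (fst z))\<^sup>2))) * cis (\<theta> / real m)"
      using branch[of "fst z"] z by (auto simp: D_def)
    define \<psi> where "\<psi> = Arg (snd z)"
    have \<psi>: "snd z = of_real (cmod (snd z)) * cis \<psi>" unfolding \<psi>_def by (rule polar)
    define \<tau> where "\<tau> = (\<theta> / (2 * pi)) *\<^sub>R c2 + (\<psi> / (2 * pi)) *\<^sub>R c3"
    have "z = (of_real (cmod (fst z)) * cis \<theta>, of_real (cmod (snd z)) * cis \<psi>)"
      using \<theta>(1) \<psi> by (simp add: prod_eq_iff)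
    from V2.torus_coord_base[OF this] have z_eq: "torus_coord X v2 (?p, \<tau>) = z"
      by (simp add: \<tau>_def)
    have angles: "2 * pi * angle1 Y w \<tau> = real k * (\<theta> / real m)" "2 * pi * angle2 Y w \<tau> = \<psi> + \<theta> / real m"
      using m_pos by (simp_all add: W.angle_eq \<tau>_def det2_linear dets_lat field_simps)
    have \<gamma>: "\<gamma> (fst z) = of_real (sqrt (\<delta> (ph ?p))) * cis (\<theta> / real m)" using \<theta>(2) by (simp add: V2.EdgeFun_base)
    have "snd z = of_real (sqrt (p2 ?p)) * cis \<psi>" using \<psi> by (simp add: V2.EdgeFun_base)
    then have "snd z * \<gamma> (fst z) = of_real (sqrt (p2 (f ?p))) * cis (2 * pi * angle2 Y w \<tau>)"
      unfolding angles \<gamma> by (simp add: f_values real_sqrt_mult cis_mult[symmetric] mult_ac)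
    moreover have "cis (2 * pi * angle1 Y w \<tau>) = cis (\<theta> / real m) ^ k"
      unfolding angles by (simp only: Complex.DeMoivre)
    then have "\<gamma> (fst z) ^ k * of_real (sqrt (p1 ?p)) = of_real (sqrt (p1 (f ?p))) * cis (2 * pi * angle1 Y w \<tau>)"
      unfolding \<gamma> by (simp add: f_values real_sqrt_mult real_sqrt_power power_mult_distrib)
    ultimately have "\<phi> z = torus_coord Y w (f ?p, \<tau>)"
      using new_edge(4)[of E1] new_edge(4)[of E3] edges edges_distinct
      by (simp add: \<phi>_def torus_coord_def W.A[symmetric] W.B[symmetric])
    moreover have "f ?p \<in> U_vertex (Poly Y) w"
      using V2.vertex_AB(1) by (intro f_in_U_vertex[OF v_in_X(2) U ph[OF z] w_in_Y]) (auto simp: w_values)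
    ultimately show "\<exists>p \<tau>. p \<in> U_vertex (Poly X) v2 \<and> f p \<in> U_vertex (Poly Y) w \<and>
        z = torus_coord X v2 (p, \<tau>) \<and> \<phi> z = torus_coord Y w (f p, \<tau>)"
      using U z_eq by metis
  qed (auto simp: D_def)
  moreover have "z0 \<in> D" using z0 T by (simp add: D_def)
  ultimately show ?thesis using ph by blast
qed

text \<open>Off \<open>E2\<close> the map \<open>f\<close> multiplies each edge function by a smooth positive factor: a power of \<open>\<delta>\<close> for \<open>E1\<close> and
  \<open>E3\<close>, and \<open>1\<close> near any other edge. The square root of this factor rescales the corresponding chart
  coordinate.\<close>

lemma radius_ratio:
  fixes g :: "C2 \<Rightarrow> plane"
  assumes "open S" "smooth_on S g" and S: "\<And>z. z \<in> S \<Longrightarrow> g z \<in> Poly X \<and> ph (g z) > 0"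
    and C: "C edge_of Poly X" "C \<noteq> E2" and "z0 \<in> S"
  shows "\<exists>D \<kappa>. open D \<and> z0 \<in> D \<and> D \<subseteq> S \<and> smooth_on D \<kappa> \<and>
    (\<forall>z\<in>D. \<kappa> z > 0 \<and> EdgeFun X C (f (g z)) = \<kappa> z * EdgeFun X C (g z))"
proof (rule edge_cases[OF C])
  have ph: "ph (g z) > 0" if "z \<in> S" for z using S that by blast
  note sm = smooth_on_f[OF assms(1,2) ph]
  show ?thesis if "C = E1"
    using assms(1,6) sm(1) \<delta>_pos ph unfolding that
    by (intro exI[of _ S] exI[of _ "\<lambda>z. \<delta> (ph (g z)) ^ k"]) (auto simp: f_values intro: smooth_on_power)
  show ?thesis if "C = E3"
    using assms(1,6) sm(1) \<delta>_pos ph unfolding that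
    by (intro exI[of _ S] exI[of _ "\<lambda>z. \<delta> (ph (g z))"]) (auto simp: f_values)
  show ?thesis if "C \<in> others"
  proof -
    have cont: "continuous_on S (\<lambda>z. EdgeFun X E (g z))" if "E edge_of Poly X" for E
      by (rule smooth_on_imp_continuous_on[OF smooth_on_EdgeFun[OF that assms(1,2)]])
    have op: "open {z \<in> S. EdgeFun X E (g z) > r}" if "E edge_of Poly X" for E r
    proof -
      have "{z \<in> S. EdgeFun X E (g z) > r} = S \<inter> (\<lambda>z. EdgeFun X E (g z)) -` {r<..}" by auto
      then show ?thesis
        using continuous_open_preimage[OF cont[OF that] assms(1) open_greaterThan[of r]] by (simp only:)
    qed
    show ?thesis
    proof (cases "EdgeFun X C (g z0) > 0")
      case True
      let ?D = "{z \<in> S. EdgeFun X C (g z) > 0}"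
      have "smooth_on ?D (\<lambda>z. EdgeFun X C (f (g z)) / EdgeFun X C (g z))"
        using assms(2) sm(2)
        by (intro smooth_on_divide smooth_on_EdgeFun op C) (auto intro: smooth_on_subset)
      moreover have "EdgeFun X C (f (g z)) > 0" if "z \<in> ?D" for z
        using f_others[of "g z" C] S that \<open>C \<in> others\<close> by (simp add: less_le)
      ultimately show ?thesis
        using op[OF C(1), of 0] True assms(6)
        by (intro exI[of _ ?D] exI[of _ "\<lambda>z. EdgeFun X C (f (g z)) / EdgeFun X C (g z)"]) auto
    next
      case False
      let ?D = "{z \<in> S. ph (g z) > \<epsilon>2}"
      have "g z0 \<in> Poly X" using S assms(6) by blast
      then have "EdgeFun X C (g z0) = 0" using X.EdgeFun_nonneg[OF C(1)] False by (simp add: antisym)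
      then have "g z0 \<in> C" using X.edge_iff[OF C(1)] \<open>g z0 \<in> Poly X\<close> by blast
      then have "z0 \<in> ?D" using small[OF C(1)] \<open>C \<in> others\<close> assms(6) by (simp add: others_def)
      then show ?thesis
        using op[OF edges(2), of \<epsilon>2] smooth_on_const[of ?D 1]
        by (intro exI[of _ ?D] exI[of _ "\<lambda>z. 1"]) (auto simp: f_away)
    qed
  qed
qed

text \<open>A vertex away from \<open>E2\<close> persists in \<open>Y\<close> with the same characteristic vectors, so that \<open>\<rho>\<close> preserves the
  arguments of both coordinates.\<close>

lemma lift_other:
  assumes v: "v \<in> vertices (Poly X)" "v \<notin> E2" and z0: "z0 \<in> chart_dom X v" "ph (base X v z0) > 0"
  shows "v \<in> vertices (Poly Y)"
    "\<exists>D \<phi>. z0 \<in> D \<and> is_lift X v Y v \<rho> D \<phi> \<and> (\<forall>z\<in>D. ph (base X v z) > 0)"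
proof -
  define A where "A = edge1 (Poly X) v"
  define B where "B = edge2 (Poly X) v"
  interpret V: quasitoric_vertex X v A B "lat (Char X A)" "lat (Char X B)"
    by unfold_locales (use v in \<open>auto simp: A_def B_def\<close>)
  have AB: "A edge_of Poly X" "A \<noteq> E2" "B edge_of Poly X" "B \<noteq> E2" "v \<in> A" "v \<in> B"
    using V.vertex_AB(3-6) v(2) by (auto simp: edges_at_def)
  have vX: "v \<in> Poly X" using v X.vertex_in_P by blast
  then have vY: "v \<in> Poly Y" using X_subset_Y by blast
  have zero: "EdgeFun X A v = 0" "EdgeFun X B v = 0" using X.EdgeFun_edge AB by auto
  have new: "new_edge A \<in> edges_at Y v" "new_edge B \<in> edges_at Y v"
    unfolding edges_at_Y[OF vY] using AB zero by auto
  have "new_edge A \<noteq> new_edge B" using new_edge_inj AB V.vertex_AB(2) by blast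
  then show vertex: "v \<in> vertices (Poly Y)" using Y.vertexI[OF new] by blast
  have chars: "Char Y (new_edge A) = Char X A" "Char Y (new_edge B) = Char X B"
    "EdgeFun Y (new_edge A) = EdgeFun X A" "EdgeFun Y (new_edge B) = EdgeFun X B"
    using new_edge AB by auto
  have "det2 (Char Y (new_edge A)) (Char Y (new_edge B)) > 0"
    using X.vertex_edges(3)[OF v(1), folded A_def B_def] by (simp only: chars)
  note Yedges = Y.edge12_eqI[OF vertex new this]
  have angles: "angle1 Y v \<tau> = angle1 X v \<tau>" "angle2 Y v \<tau> = angle2 X v \<tau>" for \<tau>
    by (simp_all add: angle1_def angle2_def Yedges chars flip: A_def B_def)
  define S where "S = chart_dom X v \<inter> {z. ph (base X v z) > 0}"
  have "open S"
    unfolding S_def by (intro open_Int V.open_chart_dom open_Collect_less continuous_on_const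
        smooth_on_imp_continuous_on[OF V.smooth_on_EdgeFun_base] edges)
  have smb: "smooth_on S (base X v)" using smooth_on_subset[OF V.smooth_on_base] by simp
  have S: "base X v z \<in> Poly X \<and> ph (base X v z) > 0" if "z \<in> S" for z
    using that V.base_in_P by (auto simp: S_def)
  have "z0 \<in> S" using z0 by (simp add: S_def)
  obtain D1 \<kappa>1 where D1: "open D1" "z0 \<in> D1" "D1 \<subseteq> S" "smooth_on D1 \<kappa>1"
    and \<kappa>1: "\<And>z. z \<in> D1 \<Longrightarrow> \<kappa>1 z > 0 \<and> EdgeFun X A (f (base X v z)) = \<kappa>1 z * EdgeFun X A (base X v z)"
    using radius_ratio[OF \<open>open S\<close> smb S AB(1,2) \<open>z0 \<in> S\<close>] by blast
  obtain D2 \<kappa>2 where D2: "open D2" "z0 \<in> D2" "D2 \<subseteq> S" "smooth_on D2 \<kappa>2"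
    and \<kappa>2: "\<And>z. z \<in> D2 \<Longrightarrow> \<kappa>2 z > 0 \<and> EdgeFun X B (f (base X v z)) = \<kappa>2 z * EdgeFun X B (base X v z)"
    using radius_ratio[OF \<open>open S\<close> smb S AB(3,4) \<open>z0 \<in> S\<close>] by blast
  define D where "D = D1 \<inter> D2"
  define \<phi> where "\<phi> z = (fst z * of_real (sqrt (\<kappa>1 z)), snd z * of_real (sqrt (\<kappa>2 z)))" for z
  have "open D" using D1 D2 by (simp add: D_def open_Int)
  have "smooth_on D \<kappa>1" "smooth_on D \<kappa>2" 
    using smooth_on_subset[OF D1(4)] smooth_on_subset[OF D2(4)] by (auto simp: D_def)
  then have "smooth_on D \<phi>"
    unfolding \<phi>_def using \<kappa>1 \<kappa>2
    by (intro smooth_on_Pair smooth_on_mult smooth_on_of_real smooth_on_sqrt \<open>open D\<close>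
        smooth_on_bounded_linear[OF bounded_linear_fst] smooth_on_bounded_linear[OF bounded_linear_snd]
        smooth_on_ident) (auto simp: D_def)
  have "is_lift X v Y v \<rho> D \<phi>"
  proof (rule is_liftI[OF v(1) vertex \<open>open D\<close> _ \<open>smooth_on D \<phi>\<close>])
    show "D \<subseteq> chart_dom X v" using D1 by (auto simp: D_def S_def)
    fix z assume z: "z \<in> D"
    let ?p = "base X v z"
    have zS: "z \<in> S" using z D1 by (auto simp: D_def)
    then have U: "?p \<in> U_vertex (Poly X) v" using V.chart_dom_iff_base by (simp add: S_def)
    obtain \<tau> where z_eq: "torus_coord X v (?p, \<tau>) = z"
      using V.torus_coord_base[OF polar_C2, of z] by blast
    have "sqrt (EdgeFun X A (f ?p)) = sqrt (EdgeFun X A ?p) * sqrt (\<kappa>1 z)"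
      "sqrt (EdgeFun X B (f ?p)) = sqrt (EdgeFun X B ?p) * sqrt (\<kappa>2 z)"
      using \<kappa>1[of z] \<kappa>2[of z] z by (simp_all add: D_def real_sqrt_mult)
    moreover have "fst z = of_real (sqrt (EdgeFun X A ?p)) * cis (2 * pi * angle1 X v \<tau>)"
      "snd z = of_real (sqrt (EdgeFun X B ?p)) * cis (2 * pi * angle2 X v \<tau>)"
      using arg_cong[OF z_eq, of fst] arg_cong[OF z_eq, of snd]
      by (simp_all add: torus_coord_def V.A[symmetric] V.B[symmetric])
    ultimately have "\<phi> z = torus_coord Y v (f ?p, \<tau>)"
      by (simp add: \<phi>_def torus_coord_def Yedges chars angles)
    moreover have "f ?p \<in> U_vertex (Poly Y) v"
      using S[OF zS] X.EdgeFun_edge by (intro f_in_U_vertex[OF vX U _ vY]) (auto simp: edges_at_def)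
    ultimately show "\<exists>p \<tau>. p \<in> U_vertex (Poly X) v \<and> f p \<in> U_vertex (Poly Y) v \<and>
        z = torus_coord X v (p, \<tau>) \<and> \<phi> z = torus_coord Y v (f p, \<tau>)"
      using U z_eq by metis
  qed
  moreover have "\<forall>z\<in>D. ph (base X v z) > 0" using S D1 by (auto simp: D_def)
  ultimately show "\<exists>D \<phi>. z0 \<in> D \<and> is_lift X v Y v \<rho> D \<phi> \<and> (\<forall>z\<in>D. ph (base X v z) > 0)"
    using D1 D2 by (auto simp: D_def)
qed

lemma local_lift:
  assumes v: "v \<in> vertices (Poly X)" and z0: "z0 \<in> chart_dom X v" "ph (base X v z0) > 0"
  obtains u D \<phi> where "u \<in> vertices (Poly Y)" "z0 \<in> D" "is_lift X v Y u \<rho> D \<phi>"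
    "\<And>z. z \<in> D \<Longrightarrow> ph (base X v z) > 0"
proof -
  have "\<exists>u D \<phi>. u \<in> vertices (Poly Y) \<and> z0 \<in> D \<and> is_lift X v Y u \<rho> D \<phi> \<and> (\<forall>z\<in>D. ph (base X v z) > 0)"
  proof (cases "v \<in> E2")
    case False
    show ?thesis
      using lift_other[OF v False z0] by (intro exI[of _ v]) simp
  next
    case True
    from vertex_on_E2[OF v True] show ?thesis
    proof
      assume "v = v1"
      then show ?thesis using lift_v1 z0 w_vertex by (intro exI[of _ w]) simp
    next
      assume "v = v2"
      then show ?thesis using lift_v2 z0 w_vertex by (intro exI[of _ w]) simp
    qed
  qed
  then show ?thesis by (elim exE conjE) (erule (2) that, erule (1) bspec)
qed

end

section \<open>Pullback of holomorphic functions\<close>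

lemma holomorphic_functionsD:
  assumes "g \<in> holomorphic_functions M J V" "v \<in> vertices (Poly M)"
  shows "smooth_on {z \<in> chart_dom M v. chart_map M v z \<in> V} (g \<circ> chart_map M v)"
    "\<And>z h. z \<in> chart_dom M v \<Longrightarrow> chart_map M v z \<in> V \<Longrightarrow>
      differential (g \<circ> chart_map M v) z (J v z h) = \<i> * differential (g \<circ> chart_map M v) z h"
  using assms by (auto simp: holomorphic_functions_def Let_def)

context blowdown
begin

lemma openin_rho_preimage:
  "openin (orb_topology Y) V \<Longrightarrow> openin (orb_topology X) {x \<in> orb X. \<rho> x \<in> V}"
  using continuous_map_rho by (simp add: continuous_map_def X.topspace_orb_topology)

text \<open>The chain rule for a local lift, whose differential intertwines \<open>J1\<close> and \<open>J2\<close>.\<close>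

lemma pullback_off_E2:
  assumes V: "openin (orb_topology Y) V" and g: "g \<in> holomorphic_functions Y J2 V"
    and J: "intertwines X Y \<rho> {x \<in> orb X. orbit_map x \<notin> E2} J1 J2"
    and v: "v \<in> vertices (Poly X)"
    and z0: "z0 \<in> chart_dom X v" "\<rho> (chart_map X v z0) \<in> V" "ph (base X v z0) > 0"
  shows "\<exists>D. open D \<and> z0 \<in> D \<and> smooth_on D (g \<circ> \<rho> \<circ> chart_map X v) \<and>
    (\<forall>k. differential (g \<circ> \<rho> \<circ> chart_map X v) z0 (J1 v z0 k)
      = \<i> * differential (g \<circ> \<rho> \<circ> chart_map X v) z0 k)"
proof -
  interpret V: quasitoric_vertex X v "edge1 (Poly X) v" "edge2 (Poly X) v"
    "lat (Char X (edge1 (Poly X) v))" "lat (Char X (edge2 (Poly X) v))"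
    by unfold_locales (use v in auto)
  obtain u D \<phi> where u: "u \<in> vertices (Poly Y)" and "z0 \<in> D" and lift: "is_lift X v Y u \<rho> D \<phi>"
    and ph: "\<And>z. z \<in> D \<Longrightarrow> ph (base X v z) > 0"
    using local_lift[OF v z0(1,3)] by metis
  interpret U: quasitoric_vertex Y u "edge1 (Poly Y) u" "edge2 (Poly Y) u"
    "lat (Char Y (edge1 (Poly Y) u))" "lat (Char Y (edge2 (Poly Y) u))"
    by unfold_locales (use u in auto)
  have D: "open D" "D \<subseteq> chart_dom X v" "smooth_on D \<phi>" "\<phi> ` D \<subseteq> chart_dom Y u"
    and comm: "\<And>z. z \<in> D \<Longrightarrow> chart_map Y u (\<phi> z) = \<rho> (chart_map X v z)"
    using lift by (auto simp: is_lift_def)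
  have "chart_map X v ` D \<subseteq> {x \<in> orb X. orbit_map x \<notin> E2}"
  proof (intro image_subsetI CollectI conjI)
    fix z assume z: "z \<in> D"
    then have "z \<in> chart_dom X v" using D(2) by blast
    then show "chart_map X v z \<in> orb X" by (rule V.chart_map_in_orb)
    show "orbit_map (chart_map X v z) \<notin> E2"
      using V.orbit_map_chart_map[OF \<open>z \<in> chart_dom X v\<close>] ph[OF z]
        X.EdgeFun_edge[OF edges(2), of "base X v z"] by auto
  qed
  then have d\<phi>: "differential \<phi> z0 (J1 v z0 k) = J2 u (\<phi> z0) (differential \<phi> z0 k)" for k
    using J v u lift \<open>z0 \<in> D\<close> unfolding intertwines_def by blast
  let ?G = "g \<circ> chart_map Y u"
  define Q where "Q = {y \<in> chart_dom Y u. chart_map Y u y \<in> V}"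
  have Q: "open Q" unfolding Q_def by (rule U.open_chart_map_preimage[OF V])
  define D' where "D' = D \<inter> {z \<in> chart_dom X v. chart_map X v z \<in> {x \<in> orb X. \<rho> x \<in> V}}"
  have "open D'" unfolding D'_def by (intro open_Int D V.open_chart_map_preimage openin_rho_preimage V)
  have "z0 \<in> D'" using z0 \<open>z0 \<in> D\<close> V.chart_map_in_orb by (simp add: D'_def)
  have maps: "\<phi> ` D' \<subseteq> Q" using D(4) comm by (auto simp: D'_def Q_def)
  have smG: "smooth_on Q ?G" unfolding Q_def by (rule holomorphic_functionsD(1)[OF g u])
  have sm\<phi>: "smooth_on D' \<phi>" using D(3) by (rule smooth_on_subset) (simp add: D'_def)
  have eq: "?G (\<phi> z) = (g \<circ> \<rho> \<circ> chart_map X v) z" if "z \<in> D'" for z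
    using comm that by (simp add: D'_def)
  have sm: "smooth_on D' (g \<circ> \<rho> \<circ> chart_map X v)"
    by (rule smooth_on_cong[OF \<open>open D'\<close> eq smooth_on_compose[OF \<open>open D'\<close> Q maps smG sm\<phi>]])
  have "\<phi> z0 \<in> Q" using maps \<open>z0 \<in> D'\<close> by blast
  have "((\<lambda>z. ?G (\<phi> z)) has_derivative (\<lambda>k. differential ?G (\<phi> z0) (differential \<phi> z0 k))) (at z0)"
    by (rule has_derivative_compose[OF smooth_on_has_derivative[OF sm\<phi> \<open>z0 \<in> D'\<close>]
        smooth_on_has_derivative[OF smG \<open>\<phi> z0 \<in> Q\<close>]])
  then have "((g \<circ> \<rho> \<circ> chart_map X v) has_derivative
      (\<lambda>k. differential ?G (\<phi> z0) (differential \<phi> z0 k))) (at z0)"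
    by (rule has_derivative_transform_within_open[OF _ \<open>open D'\<close> \<open>z0 \<in> D'\<close> eq])
  then have d: "differential (g \<circ> \<rho> \<circ> chart_map X v) z0 = (\<lambda>k. differential ?G (\<phi> z0) (differential \<phi> z0 k))"
    by (rule frechet_derivative_at[symmetric])
  have "\<phi> z0 \<in> chart_dom Y u" "chart_map Y u (\<phi> z0) \<in> V" using \<open>\<phi> z0 \<in> Q\<close> by (auto simp: Q_def)
  then have "differential (g \<circ> \<rho> \<circ> chart_map X v) z0 (J1 v z0 k)
      = \<i> * differential (g \<circ> \<rho> \<circ> chart_map X v) z0 k" for k
    unfolding d d\<phi> by (rule holomorphic_functionsD(2)[OF g u])
  then show ?thesis using sm \<open>open D'\<close> \<open>z0 \<in> D'\<close> by blast
qed

lemma continuous_pullback: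
  assumes V: "openin (orb_topology Y) V" and g: "g \<in> holomorphic_functions Y J2 V"
    and v: "v \<in> vertices (Poly X)"
  shows "continuous_on {z \<in> chart_dom X v. \<rho> (chart_map X v z) \<in> V} (g \<circ> \<rho> \<circ> chart_map X v)"
    "open {z \<in> chart_dom X v. \<rho> (chart_map X v z) \<in> V}"
proof -
  interpret V: quasitoric_vertex X v "edge1 (Poly X) v" "edge2 (Poly X) v"
    "lat (Char X (edge1 (Poly X) v))" "lat (Char X (edge2 (Poly X) v))"
    by unfold_locales (use v in auto)
  have pre: "open {z \<in> chart_dom X v. \<rho> (chart_map X v z) \<in> V'}" if "openin (orb_topology Y) V'" for V'
  proof -
    have "{z \<in> chart_dom X v. \<rho> (chart_map X v z) \<in> V'}
        = {z \<in> chart_dom X v. chart_map X v z \<in> {x \<in> orb X. \<rho> x \<in> V'}}"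
      using V.chart_map_in_orb by blast
    then show ?thesis using V.open_chart_map_preimage[OF openin_rho_preimage[OF that]] by simp
  qed
  show op: "open {z \<in> chart_dom X v. \<rho> (chart_map X v z) \<in> V}" by (rule pre[OF V])
  show "continuous_on {z \<in> chart_dom X v. \<rho> (chart_map X v z) \<in> V} (g \<circ> \<rho> \<circ> chart_map X v)"
    unfolding continuous_on_open_vimage[OF op]
  proof (intro allI impI)
    fix B :: "complex set" assume "open B"
    have "continuous_map (subtopology (orb_topology Y) V) euclidean g"
      using g by (simp add: holomorphic_functions_def)
    then have "openin (subtopology (orb_topology Y) V) {y \<in> topspace (subtopology (orb_topology Y) V). g y \<in> B}"
      using \<open>open B\<close> by (simp add: continuous_map_def)
    moreover have "topspace (subtopology (orb_topology Y) V) = V"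
      using openin_subset[OF V] by auto
    ultimately have "openin (subtopology (orb_topology Y) V) {y \<in> V. g y \<in> B}" by (simp only:)
    then have "openin (orb_topology Y) {y \<in> V. g y \<in> B}" by (rule openin_trans_full[OF _ V])
    from pre[OF this] show "open ((g \<circ> \<rho> \<circ> chart_map X v) -` B \<inter> {z \<in> chart_dom X v. \<rho> (chart_map X v z) \<in> V})"
      by (rule back_subst[where P = "open"]) auto
  qed
qed

lemma open_chart_over:
  assumes v: "v \<in> vertices (Poly X)" and U: "openin (top_of_set (Poly X)) U"
  shows "open (chart_over X v U)"
proof -
  interpret V: quasitoric_vertex X v "edge1 (Poly X) v" "edge2 (Poly X) v"
    "lat (Char X (edge1 (Poly X) v))" "lat (Char X (edge2 (Poly X) v))"
    by unfold_locales (use v in auto)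
  obtain U' where U': "open U'" "U = Poly X \<inter> U'" using U by (auto simp: openin_open)
  have "chart_over X v U = chart_dom X v \<inter> base X v -` U'"
  proof (rule set_eqI)
    fix z
    show "z \<in> chart_over X v U \<longleftrightarrow> z \<in> chart_dom X v \<inter> base X v -` U'"
      using V.orbit_map_chart_map[of z] V.base_in_P[of z] by (auto simp: chart_over_def U'(2))
  qed
  moreover have "open (base X v -` U')"
    using smooth_on_imp_continuous_on[OF V.smooth_on_base] U'(1) by (intro open_vimage)
  ultimately show ?thesis using V.open_chart_dom by (simp add: open_Int)
qed

text \<open>Near \<open>E2\<close> the pullback is continuous, and holomorphic off the curve over \<open>E2\<close>, on which one of
  the holomorphic coordinates of \<open>J1\<close> vanishes; so it extends holomorphically across that curve.\<close>

lemma pullback_holomorphic: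
  assumes V: "openin (orb_topology Y) V" and g: "g \<in> holomorphic_functions Y J2 V"
    and U: "openin (top_of_set (Poly X)) U" "E2 \<subseteq> U"
    and J1: "holomorphic_coords (chart_over X v1 U) (new_coords1 X E2 E3 v1 k m \<delta>) (J1 v1)"
      "holomorphic_coords (chart_over X v2 U) (new_coords2 X E1 E2 v2 k m \<delta>) (J1 v2)"
    and J: "intertwines X Y \<rho> {x \<in> orb X. orbit_map x \<notin> E2} J1 J2"
    and v: "v \<in> vertices (Poly X)"
    and z0: "z0 \<in> chart_dom X v" "\<rho> (chart_map X v z0) \<in> V"
  shows "\<exists>D. open D \<and> z0 \<in> D \<and> smooth_on D (g \<circ> \<rho> \<circ> chart_map X v) \<and>
    (\<forall>k. differential (g \<circ> \<rho> \<circ> chart_map X v) z0 (J1 v z0 k)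
      = \<i> * differential (g \<circ> \<rho> \<circ> chart_map X v) z0 k)"
proof (cases "ph (base X v z0) > 0")
  case True
  show ?thesis by (rule pullback_off_E2[OF V g J v z0 True])
next
  case False
  interpret V: quasitoric_vertex X v "edge1 (Poly X) v" "edge2 (Poly X) v"
    "lat (Char X (edge1 (Poly X) v))" "lat (Char X (edge2 (Poly X) v))"
    by unfold_locales (use v in auto)
  let ?h = "g \<circ> \<rho> \<circ> chart_map X v"
  have P: "base X v z0 \<in> Poly X" by (rule V.base_in_P[OF z0(1)])
  then have "ph (base X v z0) = 0" using X.EdgeFun_nonneg[OF edges(2) P] False by simp
  then have E2: "base X v z0 \<in> E2" using X.edge_iff[OF edges(2)] P by blast
  define D where "D = {z \<in> chart_dom X v. \<rho> (chart_map X v z) \<in> V} \<inter> chart_over X v U"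
  have "open D" unfolding D_def by (intro open_Int continuous_pullback[OF V g v] open_chart_over[OF v U(1)])
  have "z0 \<in> D" using z0 E2 U(2) V.orbit_map_chart_map[OF z0(1)] by (auto simp: D_def chart_over_def)
  have cont: "continuous_on D ?h"
    using continuous_pullback(1)[OF V g v] by (rule continuous_on_subset) (simp add: D_def)
  have off: "?h differentiable (at z) \<and> (\<forall>k. differential ?h z (J1 v z k) = \<i> * differential ?h z k)"
    if "z \<in> D" "ph (base X v z) > 0" for z
  proof -
    from that(1) have z: "z \<in> chart_dom X v" "\<rho> (chart_map X v z) \<in> V" by (auto simp: D_def)
    from pullback_off_E2[OF V g J v z that(2)]
    show ?thesis using smooth_on_has_derivative differentiableI by blast
  qed
  have "v \<in> E2"
  proof (rule ccontr)
    assume "v \<notin> E2"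
    then have "base X v z0 \<notin> U_vertex (Poly X) v" using E2 edges(2) by (auto simp: U_vertex_def)
    then show False using z0(1) V.chart_dom_iff_base by blast
  qed
  from vertex_on_E2[OF v this] have "smooth_on D ?h \<and> (\<forall>z\<in>D. \<forall>k. differential ?h z (J1 v z k) = \<i> * differential ?h z k)"
  proof
    assume v1: "v = v1"
    have "holomorphic_coords D (new_coords1 X E2 E3 v1 k m \<delta>) (J1 v)"
      using J1(1) smooth_on_subset[of "chart_over X v1 U" _ D]
      by (auto simp: holomorphic_coords_def D_def v1)
    then show ?thesis
    proof (rule holomorphic_extension_snd[OF \<open>open D\<close> _ cont])
      fix z assume z: "z \<in> D" "snd (new_coords1 X E2 E3 v1 k m \<delta> z) \<noteq> 0"
      then have "snd z \<noteq> 0" by (auto simp: new_coords1_def Let_def)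
      then show "?h differentiable (at z) \<and> (\<forall>k. differential ?h z (J1 v z k) = \<i> * differential ?h z k)"
        by (intro off[OF z(1)]) (simp add: v1 V1.EdgeFun_base)
    qed
  next
    assume v2: "v = v2"
    have "holomorphic_coords D (new_coords2 X E1 E2 v2 k m \<delta>) (J1 v)"
      using J1(2) smooth_on_subset[of "chart_over X v2 U" _ D]
      by (auto simp: holomorphic_coords_def D_def v2)
    then show ?thesis
    proof (rule holomorphic_extension_fst[OF \<open>open D\<close> _ cont])
      fix z assume z: "z \<in> D" "fst (new_coords2 X E1 E2 v2 k m \<delta> z) \<noteq> 0"
      then have "fst z \<noteq> 0" by (auto simp: new_coords2_def Let_def)
      then show "?h differentiable (at z) \<and> (\<forall>k. differential ?h z (J1 v z k) = \<i> * differential ?h z k)"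
        by (intro off[OF z(1)]) (simp add: v2 V2.EdgeFun_base)
    qed
  qed
  then show ?thesis using \<open>open D\<close> \<open>z0 \<in> D\<close> by blast
qed

end

theorem corollary4p3:
  fixes X Y :: model and E1 E2 E3 U :: "plane set" and v1 v2 w :: plane
    and k m :: nat and s t \<epsilon>1 \<epsilon>2 :: real and \<delta> :: "real \<Rightarrow> real"
    and f :: "plane \<Rightarrow> plane" and \<rho> :: "point \<Rightarrow> point" and J1 J2 :: endo_field
  assumes X: "primitive_model X" "positively_omnioriented X"
    and edges: "E1 edge_of Poly X" "E2 edge_of Poly X" "E3 edge_of Poly X"
      "E1 \<inter> E2 = {v1}" "E2 \<inter> E3 = {v2}"
    and dets: "det2 (Char X E1) (Char X E2) = 1"
      "det2 (Char X E2) (Char X E3) = int k" "det2 (Char X E1) (Char X E3) = int m"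
      "0 < k" "k \<le> m"
    and coords: "s > 0" "t > 0"
      "\<And>x. EdgeFun X E2 x = EdgeFun X E3 x + s * EdgeFun X E1 x - t"
    and Y: "Y = blowdown_model X E1 E2 E3" "primitive_model Y" "positively_omnioriented Y"
    and w: "w = new_vertex X E1 E3"
    and small: "0 < \<epsilon>1" "\<epsilon>1 < \<epsilon>2" "\<epsilon>2 < 1"
      "\<And>E x. E edge_of Poly X \<Longrightarrow> E \<notin> {E1, E2, E3} \<Longrightarrow> x \<in> E \<Longrightarrow> EdgeFun X E2 x > \<epsilon>2"
    and delta: "mono_on {0..} \<delta>" "smooth_on {0<..} \<delta>"
      "\<And>x. 0 \<le> x \<Longrightarrow> x < \<epsilon>1 \<Longrightarrow> \<delta> x = root m x" "\<And>x. x > \<epsilon>2 \<Longrightarrow> \<delta> x = 1"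
    and rho: "f = blowdown_base X E1 E2 E3 k \<delta>" "\<rho> = blowdown_map X E1 E2 E3 k \<delta>"
    and U: "openin (top_of_set (Poly X)) U" "E2 \<subseteq> U"
      "\<And>E. E edge_of Poly X \<Longrightarrow> E \<notin> {E1, E2, E3} \<Longrightarrow> U \<inter> E = {}"
    and J1: "almost_complex X J1" "torus_invariant_acs X J1"
      "\<exists>g. riemannian X g \<and> torus_invariant_metric X g \<and> orthogonal_acs X g J1"
      "holomorphic_coords (chart_over X v1 U) (new_coords1 X E2 E3 v1 k m \<delta>) (J1 v1)"
      "holomorphic_coords (chart_over X v2 U) (new_coords2 X E1 E2 v2 k m \<delta>) (J1 v2)"
    and J2: "almost_complex Y J2" "torus_invariant_acs Y J2"
      "holomorphic_coords (chart_over Y w (f ` U)) id (J2 w)"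
      "intertwines X Y \<rho> {x \<in> orb X. orbit_map x \<notin> E2} J1 J2"
  shows "pseudo_holomorphic X J1 Y J2 \<rho>"
proof -
  interpret blowdown X Y E1 E2 E3 v1 v2 w k m s t \<epsilon>1 \<epsilon>2 \<delta> f \<rho>
    by unfold_locales (fact assms)+
  have "g \<circ> \<rho> \<in> holomorphic_functions X J1 {x \<in> orb X. \<rho> x \<in> V}"
    if V: "openin (orb_topology Y) V" and g: "g \<in> holomorphic_functions Y J2 V" for V g
  proof -
    let ?VX = "{x \<in> orb X. \<rho> x \<in> V}"
    have "continuous_map (subtopology (orb_topology X) ?VX) (subtopology (orb_topology Y) V) \<rho>"
      unfolding continuous_map_in_subtopology
      using continuous_map_from_subtopology[OF continuous_map_rho] by auto
    moreover have "continuous_map (subtopology (orb_topology Y) V) euclidean g"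
      using g by (simp add: holomorphic_functions_def)
    ultimately have cont: "continuous_map (subtopology (orb_topology X) ?VX) euclidean (g \<circ> \<rho>)"
      by (rule continuous_map_compose)
    have "smooth_on {z \<in> chart_dom X v. chart_map X v z \<in> ?VX} (g \<circ> \<rho> \<circ> chart_map X v)"
      "\<And>z h. z \<in> {z \<in> chart_dom X v. chart_map X v z \<in> ?VX} \<Longrightarrow>
        differential (g \<circ> \<rho> \<circ> chart_map X v) z (J1 v z h)
          = \<i> * differential (g \<circ> \<rho> \<circ> chart_map X v) z h"
      if v: "v \<in> vertices (Poly X)" for v
    proof -
      note local = pullback_holomorphic[OF V g U(1,2) J1(4,5) J2(4) v]
      show "smooth_on {z \<in> chart_dom X v. chart_map X v z \<in> ?VX} (g \<circ> \<rho> \<circ> chart_map X v)"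
        by (rule smooth_on_local) (use local in blast)
      show "differential (g \<circ> \<rho> \<circ> chart_map X v) z (J1 v z h)
          = \<i> * differential (g \<circ> \<rho> \<circ> chart_map X v) z h"
        if "z \<in> {z \<in> chart_dom X v. chart_map X v z \<in> ?VX}" for z h
        using local[of z] that by blast
    qed
    with cont show ?thesis
      unfolding holomorphic_functions_def Let_def mem_Collect_eq by blast
  qed
  with continuous_map_rho show ?thesis
    unfolding pseudo_holomorphic_def by blast
qed

end
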